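(* Let $G$ be a Carnot group with first layer $\mathfrak{g}_1$ and Haar measure $\mu$. Assume that for any $X\in\mathfrak{g}_1\setminus\{0\}$ there is an integer $p\ge2$ such that the map $\Gamma_p:(\mathfrak{g}_1)^p\to G$ defined by $\Gamma_p(X_1,\dots,X_p)=\exp X_1\cdots\exp X_p$ is open at $(X,\dots,X)\in(\mathfrak{g}_1)^p$. Then for any monotone subset $E$ of $G$ both $\operatorname{Int}_\mu(E)$ and $\operatorname{spt}_\mu(E)$ are precisely monotone measure-theoretic representatives of $E$.
   Context: A Carnot group $G$ is a connected, simply connected Lie group whose Lie algebra $\mathfrak{g}$ of left-invariant vector fields is equipped with a stratification $\mathfrak{g}=\mathfrak{g}_1\oplus\cdots\oplus\mathfrak{g}_s$, i.e. $[\mathfrak{g}_1,\mathfrak{g}_i]=\mathfrak{g}_{i+1}$ for $i=1,\dots,s$, $\mathfrak{g}_s\neq\{0\}$ and $\mathfrak{g}_i=\{0\}$ for $i>s$ (where $[\mathfrak{g}_1,\mathfrak{g}_i]$ is the linear span of brackets). The exponential map $\exp:\mathfrak{g}\to G$ is a smooth diffeomorphism. $\mu$ is a Haar measure on $G$. A map is open at a point $a$ if it maps every neighborhood of $a$ onto a neighborhood of the image of $a$. Lines. A line in $G$ is the unparameterized oriented image of an integral curve of some $X\in\mathfrak{g}_1\setminus\{0\}$, i.e. a set $\{x\cdot\exp(tX): t\in\mathbb{R}\}$ with the orientation given by $X$. Fix a scalar product on $\mathfrak{g}_1$ with unit sphere $\mathbb{S}(\mathfrak{g}_1)$. For $X\in\mathbb{S}(\mathfrak{g}_1)$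 let $N_X=\exp(X^\perp)$, where $X^\perp$ is the direct sum of the orthogonal complement of $\mathbb{R}X$ in $\mathfrak{g}_1$ with $\oplus_{i=2}^s\mathfrak{g}_i$; $N_X$ is a subgroup of $G$. Every line can be written uniquely as $\{x\cdot\exp(tX):t\in\mathbb{R}\}$, oriented by $X$, with $X\in\mathbb{S}(\mathfrak{g}_1)$ and $x\in N_X$, so the set of lines is identified with the smooth manifold $\bigsqcup_{X\in\mathbb{S}(\mathfrak{g}_1)}\{X\}\times N_X$. A set of lines is null if it has measure zero for some (equivalently any) smooth measure with positive density on this manifold; one such measure is $A\mapsto\int_{\mathbb{S}(\mathfrak{g}_1)}\mu_X(\{x\in N_X:(X,x)\in A\})\,d\sigma(X)$ for Borel $A$ (extended to all sets as an outer measure), where $\sigma$ is the standard measure on the sphere and $\mu_X$ is the Haar measure on $N_X$ normalized so that $(x,t)\mapsto x\cdot\exp(tX)$ is measure preserving from $(N_X\times\mathbb{R},\mu_X\otimes dt)$ to $(G,\mu)$. The notion of null set of lines does not depend on the scalar product. Monotone sets. A line $L$ is monotone for $E\subset G$ if for some (equivalently any) parameterization $t\in\mathbb{R}\mapsto x\cdot\exp(tX)$ of $L$, with $X\in\mathfrak{g}_1\setminus\{0\}$ and $x\in G$ such that $L=\{x\cdot\exp(tX):t\in\mathbb{R}\}$ oriented by $X$, the function $t\mapsto \mathbf{1}_E(x\cdot\exp(tX))$ agrees almost everywhere (for Lebesgue measure on $\mathbb{R}$) with a monotone function. A set $E\subset G$ is monotone if it is $\mu$-measurable and almost every line in $G$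 is monotone for $E$. A set $E\subset G$ is precisely monotone if for every line $L$ both $E\cap L$ and $L\setminus E$ are connected (the empty set being connected). Measure-theoretic notions. $E^c=G\setminus E$. For $\mu$-measurable $E$: $\operatorname{spt}_\mu(E)$ is the support of the restriction of $\mu$ to $E$ (i.e. the set of $x$ such that $\mu(E\cap U)>0$ for every open neighborhood $U$ of $x$), and $\operatorname{Int}_\mu(E)=G\setminus\operatorname{spt}_\mu(E^c)$. A set $F\subset G$ is a measure-theoretic representative of $E$ if $\mu(E\triangle F)=0$, where $E\triangle F=(E\setminus F)\cup(F\setminus E)$. *)

theory Defs
  imports "HOL-Analysis.Analysis" "HOL-Algebra.Group"
begin

section \<open>Smooth maps and Lie groups\<close>

text \<open>\<open>Ck_on k S f\<close> is meant for open \<open>S\<close>: the map is differentiable \<open>k\<close> times, with continuous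
  directional derivatives up to order \<open>k\<close>.\<close>

primrec Ck_on :: "nat \<Rightarrow> 'e::euclidean_space set \<Rightarrow> ('e \<Rightarrow> 'f::euclidean_space) \<Rightarrow> bool" where
  "Ck_on 0 S f = continuous_on S f"
| "Ck_on (Suc k) S f =
     ((\<forall>x\<in>S. f differentiable (at x)) \<and> (\<forall>v. Ck_on k S (\<lambda>x. frechet_derivative f (at x) v)))"

definition smooth_on :: "'e::euclidean_space set \<Rightarrow> ('e \<Rightarrow> 'f::euclidean_space) \<Rightarrow> bool" where
  "smooth_on S f \<longleftrightarrow> (\<forall>k. Ck_on k S f)"

text \<open>A chart is a pair of an open domain and a coordinate map; the coordinate map is only relevant
  on the domain. An atlas need not be maximal.\<close>

type_synonym ('a, 'e) chart = "'a set \<times> ('a \<Rightarrow> 'e)"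

definition smooth_atlas :: "('a::topological_space, 'e::euclidean_space) chart set \<Rightarrow> bool" where
  "smooth_atlas A \<longleftrightarrow>
     (\<Union>(U, \<phi>)\<in>A. U) = UNIV \<and>
     (\<forall>(U, \<phi>)\<in>A. open U \<and> open (\<phi> ` U) \<and> homeomorphism U (\<phi> ` U) \<phi> (inv_into U \<phi>)) \<and>
     (\<forall>(U, \<phi>)\<in>A. \<forall>(V, \<psi>)\<in>A. smooth_on (\<phi> ` (U \<inter> V)) (\<psi> \<circ> inv_into U \<phi>))"

definition smooth_map ::
  "('a::topological_space, 'e::euclidean_space) chart set \<Rightarrow>
   ('b::topological_space, 'f::euclidean_space) chart set \<Rightarrow> ('a \<Rightarrow> 'b) \<Rightarrow> bool" where
  "smooth_map A B f \<longleftrightarrow>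
     continuous_on UNIV f \<and>
     (\<forall>(U, \<phi>)\<in>A. \<forall>(V, \<psi>)\<in>B. smooth_on (\<phi> ` (U \<inter> f -` V)) (\<psi> \<circ> f \<circ> inv_into U \<phi>))"

definition euclidean_atlas :: "('e, 'e::euclidean_space) chart set" where
  "euclidean_atlas = {(UNIV, id)}"

definition prod_atlas ::
  "('a, 'e) chart set \<Rightarrow> ('b, 'f) chart set \<Rightarrow> ('a \<times> 'b, 'e \<times> 'f) chart set" where
  "prod_atlas A B = {(U \<times> V, map_prod \<phi> \<psi>) | U \<phi> V \<psi>. (U, \<phi>) \<in> A \<and> (V, \<psi>) \<in> B}"

record ('a, 'e) manifold_group = "'a monoid" +
  charts :: "('a, 'e) chart set"

text \<open>The underlying manifold is the whole type \<open>'a\<close>, with its type class topology.\<close>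

definition lie_group ::
  "('a::{second_countable_topology, t2_space}, 'e::euclidean_space, 'z) manifold_group_scheme \<Rightarrow> bool"
  where
  "lie_group G \<longleftrightarrow>
     group G \<and> carrier G = UNIV \<and> smooth_atlas (charts G) \<and>
     smooth_map (prod_atlas (charts G) (charts G)) (charts G) (\<lambda>(x, y). x \<otimes>\<^bsub>G\<^esub> y) \<and>
     smooth_map (charts G) (charts G) (\<lambda>x. inv\<^bsub>G\<^esub> x)"

definition smooth_functions ::
  "('a::topological_space, 'e::euclidean_space, 'z) manifold_group_scheme \<Rightarrow> ('a \<Rightarrow> real) set" where
  "smooth_functions G = {f. smooth_map (charts G) euclidean_atlas f}"

text \<open>Smooth vector fields are derivations of the algebra of smooth functions. For definiteness they
  are extended by zero to functions that are not smooth.\<close>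

definition left_invariant_fields ::
  "('a::topological_space, 'e::euclidean_space, 'z) manifold_group_scheme
     \<Rightarrow> (('a \<Rightarrow> real) \<Rightarrow> 'a \<Rightarrow> real) set" where
  "left_invariant_fields G = {D.
     (\<forall>f\<in>smooth_functions G. D f \<in> smooth_functions G) \<and>
     (\<forall>f\<in>smooth_functions G. \<forall>g\<in>smooth_functions G. D (\<lambda>x. f x + g x) = (\<lambda>x. D f x + D g x)) \<and>
     (\<forall>f\<in>smooth_functions G. \<forall>c. D (\<lambda>x. c * f x) = (\<lambda>x. c * D f x)) \<and>
     (\<forall>f\<in>smooth_functions G. \<forall>g\<in>smooth_functions G.
        D (\<lambda>x. f x * g x) = (\<lambda>x. D f x * g x + f x * D g x)) \<and>
     (\<forall>f\<in>smooth_functions G. \<forall>a. D (\<lambda>x. f (a \<otimes>\<^bsub>G\<^esub> x)) = (\<lambda>x. D f (a \<otimes>\<^bsub>G\<^esub> x))) \<and>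
     (\<forall>f. f \<notin> smooth_functions G \<longrightarrow> D f = (\<lambda>x. 0))}"


section \<open>Carnot groups\<close>

text \<open>The Lie algebra of left-invariant vector fields is carried by a Euclidean space \<open>'g\<close> through a
  linear bijection \<open>field_of\<close>. The inner product of \<open>'g\<close> only serves to provide the auxiliary
  scalar product on the first layer. Layers are indexed from \<open>1\<close>.\<close>

record ('a, 'e, 'g) carnot_data = "('a, 'e) manifold_group" +
  field_of :: "'g \<Rightarrow> ('a \<Rightarrow> real) \<Rightarrow> 'a \<Rightarrow> real"
  exp_map :: "'g \<Rightarrow> 'a"
  layer :: "nat \<Rightarrow> 'g set"
  step :: nat

definition lie_algebra_of ::
  "('a::topological_space, 'e::euclidean_space, 'g::euclidean_space) carnot_data \<Rightarrow> bool" where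
  "lie_algebra_of G \<longleftrightarrow>
     bij_betw (field_of G) UNIV (left_invariant_fields G) \<and>
     (\<forall>X Y f x. field_of G (X + Y) f x = field_of G X f x + field_of G Y f x) \<and>
     (\<forall>c X f x. field_of G (c *\<^sub>R X) f x = c * field_of G X f x)"

definition lie_bracket ::
  "('a::topological_space, 'e::euclidean_space, 'g::euclidean_space) carnot_data \<Rightarrow> 'g \<Rightarrow> 'g \<Rightarrow> 'g" where
  "lie_bracket G X Y = inv_into UNIV (field_of G)
     (\<lambda>f x. field_of G X (field_of G Y f) x - field_of G Y (field_of G X f) x)"

text \<open>\<open>t \<mapsto> exp (t X)\<close> is the one-parameter subgroup with initial velocity \<open>X\<close>; by left invariance,
  \<open>t \<mapsto> x exp (t X)\<close> is then the integral curve of \<open>X\<close> through \<open>x\<close>.\<close>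

definition exponential_map ::
  "('a::topological_space, 'e::euclidean_space, 'g::euclidean_space) carnot_data \<Rightarrow> bool" where
  "exponential_map G \<longleftrightarrow>
     (\<forall>X s t. exp_map G ((s + t) *\<^sub>R X) = exp_map G (s *\<^sub>R X) \<otimes>\<^bsub>G\<^esub> exp_map G (t *\<^sub>R X)) \<and>
     (\<forall>X. \<forall>f\<in>smooth_functions G.
        ((\<lambda>t. f (exp_map G (t *\<^sub>R X))) has_real_derivative field_of G X f \<one>\<^bsub>G\<^esub>) (at 0))"

definition stratification ::
  "('a::topological_space, 'e::euclidean_space, 'g::euclidean_space) carnot_data \<Rightarrow> bool" where
  "stratification G \<longleftrightarrow>
     1 \<le> step G \<and>
     (\<forall>i\<ge>1. subspace (layer G i)) \<and>
     (\<forall>X. \<exists>!Y. Y \<in> (\<Pi>\<^sub>E i\<in>{1..step G}. layer G i) \<and> X = (\<Sum>i=1..step G. Y i)) \<and>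
     (\<forall>i\<in>{1..step G}.
        span {lie_bracket G X Y | X Y. X \<in> layer G 1 \<and> Y \<in> layer G i} = layer G (i + 1)) \<and>
     layer G (step G) \<noteq> {0} \<and>
     (\<forall>i>step G. layer G i = {0})"

text \<open>That the exponential map is a diffeomorphism is automatic here, by a classical theorem on
  simply connected nilpotent Lie groups; it is listed as part of the structure.\<close>

definition carnot_group ::
  "('a::{second_countable_topology, t2_space}, 'e::euclidean_space, 'g::euclidean_space) carnot_data
     \<Rightarrow> bool" where
  "carnot_group G \<longleftrightarrow>
     lie_group G \<and>
     connected (UNIV :: 'a set) \<and> simply_connected (UNIV :: 'a set) \<and>
     lie_algebra_of G \<and> stratification G \<and>
     exponential_map G \<and> bij (exp_map G) \<and>
     smooth_map euclidean_atlas (charts G) (exp_map G) \<and>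
     smooth_map (charts G) euclidean_atlas (inv_into UNIV (exp_map G))"


section \<open>The maps \<open>\<Gamma>\<^sub>p\<close>\<close>

text \<open>A \<open>p\<close>-tuple is a function on \<open>{..<p}\<close>, and \<open>\<Gamma>\<^sub>p(X\<^sub>0, \<dots>) = exp X\<^sub>0 \<cdots> exp X\<^bsub>p-1\<^esub>\<close>.\<close>

primrec Gamma_map :: "('a, 'e, 'g) carnot_data \<Rightarrow> nat \<Rightarrow> (nat \<Rightarrow> 'g) \<Rightarrow> 'a" where
  "Gamma_map G 0 Xs = \<one>\<^bsub>G\<^esub>"
| "Gamma_map G (Suc p) Xs = Gamma_map G p Xs \<otimes>\<^bsub>G\<^esub> exp_map G (Xs p)"

definition open_map_at :: "'b topology \<Rightarrow> 'c topology \<Rightarrow> ('b \<Rightarrow> 'c) \<Rightarrow> 'b \<Rightarrow> bool" where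
  "open_map_at T T' f a \<longleftrightarrow>
     (\<forall>U. openin T U \<and> a \<in> U \<longrightarrow> (\<exists>V. openin T' V \<and> f a \<in> V \<and> V \<subseteq> f ` U))"

definition layer_power_topology ::
  "('a, 'e, 'g::euclidean_space) carnot_data \<Rightarrow> nat \<Rightarrow> (nat \<Rightarrow> 'g) topology" where
  "layer_power_topology G p = product_topology (\<lambda>_. top_of_set (layer G 1)) {..<p}"


section \<open>Haar measures and null sets of lines\<close>

definition haar_measure_on ::
  "('a::topological_space, 'z) monoid_scheme \<Rightarrow> 'a set \<Rightarrow> 'a measure \<Rightarrow> bool" where
  "haar_measure_on G H \<nu> \<longleftrightarrow>
     subgroup H G \<and> closed H \<and>
     space \<nu> = H \<and> sets \<nu> = sets (restrict_space borel H) \<and>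
     (\<forall>x\<in>H. \<forall>B\<in>sets \<nu>. emeasure \<nu> ((\<lambda>y. x \<otimes>\<^bsub>G\<^esub> y) ` B) = emeasure \<nu> B) \<and>
     (\<forall>K. compact K \<and> K \<subseteq> H \<longrightarrow> emeasure \<nu> K < \<infinity>) \<and>
     (\<forall>U. open U \<and> U \<inter> H \<noteq> {} \<longrightarrow> 0 < emeasure \<nu> (U \<inter> H))"

abbreviation haar_measure :: "('a::topological_space, 'z) monoid_scheme \<Rightarrow> 'a measure \<Rightarrow> bool" where
  "haar_measure G \<equiv> haar_measure_on G (carrier G)"

definition layer_sphere :: "('a, 'e, 'g::euclidean_space) carnot_data \<Rightarrow> 'g set" where
  "layer_sphere G = {X \<in> layer G 1. norm X = 1}"

definition perp_space :: "('a, 'e, 'g::euclidean_space) carnot_data \<Rightarrow> 'g \<Rightarrow> 'g set" where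
  "perp_space G X =
     {Y + Z | Y Z. Y \<in> layer G 1 \<and> inner X Y = 0 \<and> Z \<in> span (\<Union>i\<in>{2..step G}. layer G i)}"

definition perp_group :: "('a, 'e, 'g::euclidean_space) carnot_data \<Rightarrow> 'g \<Rightarrow> 'a set" where
  "perp_group G X = exp_map G ` perp_space G X"

text \<open>Lebesgue measure on a linear subspace, carried to the ambient space. It does not depend on the
  chosen orthonormal basis.\<close>

definition orthonormal_basis :: "'g::euclidean_space set \<Rightarrow> 'g set" where
  "orthonormal_basis V =
     (SOME B. B \<subseteq> V \<and> pairwise orthogonal B \<and> (\<forall>b\<in>B. norm b = 1) \<and> span B = V)"

definition subspace_lborel :: "'g::euclidean_space set \<Rightarrow> 'g measure" where
  "subspace_lborel V =
     distr (\<Pi>\<^sub>M b\<in>orthonormal_basis V. lborel) borel (\<lambda>c. \<Sum>b\<in>orthonormal_basis V. c b *\<^sub>R b)"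

text \<open>Surface measure on the unit sphere of \<open>V\<close>, in the form \<open>\<sigma>(A) = dim V \<cdot> \<lambda>{t x. x \<in> A, 0 < t \<le> 1}\<close>
  (integration in polar coordinates).\<close>

definition sphere_measure :: "'g::euclidean_space set \<Rightarrow> 'g measure" where
  "sphere_measure V =
     distr (density (subspace_lborel V)
              (\<lambda>x. ennreal (real (dim V)) * indicator (cball 0 1 - {0}) x))
       borel (\<lambda>x. x /\<^sub>R norm x)"

definition normalized_haar ::
  "('a::topological_space, 'e, 'g::euclidean_space) carnot_data
     \<Rightarrow> 'a measure \<Rightarrow> 'g \<Rightarrow> 'a measure \<Rightarrow> bool" where
  "normalized_haar G \<mu> X \<nu> \<longleftrightarrow>
     haar_measure_on G (perp_group G X) \<nu> \<and>
     (\<lambda>(x, t). x \<otimes>\<^bsub>G\<^esub> exp_map G (t *\<^sub>R X)) \<in> \<nu> \<Otimes>\<^sub>M lborel \<rightarrow>\<^sub>M \<mu> \<and>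
     distr (\<nu> \<Otimes>\<^sub>M lborel) \<mu> (\<lambda>(x, t). x \<otimes>\<^bsub>G\<^esub> exp_map G (t *\<^sub>R X)) = \<mu>"

text \<open>A line is represented by its unique parameters \<open>(X, x)\<close> with \<open>X\<close> in the unit sphere of the
  first layer and \<open>x \<in> N\<^sub>X\<close>. The measures \<open>\<nu> X\<close> below are uniquely determined by \<open>\<mu>\<close> for \<open>X\<close>
  in the sphere, and irrelevant elsewhere.\<close>

definition line_parameters :: "('a, 'e, 'g::euclidean_space) carnot_data \<Rightarrow> ('g \<times> 'a) set" where
  "line_parameters G = (SIGMA X:layer_sphere G. perp_group G X)"

definition null_set_of_lines ::
  "('a::topological_space, 'e, 'g::euclidean_space) carnot_data
     \<Rightarrow> 'a measure \<Rightarrow> ('g \<times> 'a) set \<Rightarrow> bool" where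
  "null_set_of_lines G \<mu> A \<longleftrightarrow>
     A \<subseteq> line_parameters G \<and>
     (\<exists>\<nu> B. (\<forall>X\<in>layer_sphere G. normalized_haar G \<mu> X (\<nu> X)) \<and>
        B \<in> sets borel \<and> A \<subseteq> B \<and>
        (\<integral>\<^sup>+X\<in>layer_sphere G. emeasure (\<nu> X) {x \<in> perp_group G X. (X, x) \<in> B}
           \<partial>sphere_measure (layer G 1)) = 0)"


section \<open>Monotone and precisely monotone sets\<close>

definition line_monotone :: "('a, 'e, 'g::euclidean_space) carnot_data \<Rightarrow> 'a set \<Rightarrow> 'g \<Rightarrow> 'a \<Rightarrow> bool"
  where
  "line_monotone G E X x \<longleftrightarrow>
     (\<exists>h :: real \<Rightarrow> real. (mono h \<or> antimono h) \<and>
        (AE t in lborel. indicator E (x \<otimes>\<^bsub>G\<^esub> exp_map G (t *\<^sub>R X)) = h t))"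

definition monotone_set ::
  "('a::topological_space, 'e, 'g::euclidean_space) carnot_data \<Rightarrow> 'a measure \<Rightarrow> 'a set \<Rightarrow> bool" where
  "monotone_set G \<mu> E \<longleftrightarrow>
     E \<in> sets (completion \<mu>) \<and>
     null_set_of_lines G \<mu> {(X, x) \<in> line_parameters G. \<not> line_monotone G E X x}"

definition line :: "('a, 'e, 'g::euclidean_space) carnot_data \<Rightarrow> 'g \<Rightarrow> 'a \<Rightarrow> 'a set" where
  "line G X x = range (\<lambda>t::real. x \<otimes>\<^bsub>G\<^esub> exp_map G (t *\<^sub>R X))"

definition precisely_monotone ::
  "('a::topological_space, 'e, 'g::euclidean_space) carnot_data \<Rightarrow> 'a set \<Rightarrow> bool" where
  "precisely_monotone G E \<longleftrightarrow>
     (\<forall>X\<in>layer G 1 - {0}. \<forall>x. connected (E \<inter> line G X x) \<and> connected (line G X x - E))"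


section \<open>Measure-theoretic support, interior and representatives\<close>

definition measure_support :: "'a::topological_space measure \<Rightarrow> 'a set \<Rightarrow> 'a set" where
  "measure_support \<mu> E = {x. \<forall>U. open U \<and> x \<in> U \<longrightarrow> 0 < emeasure (completion \<mu>) (E \<inter> U)}"

definition measure_interior :: "'a::topological_space measure \<Rightarrow> 'a set \<Rightarrow> 'a set" where
  "measure_interior \<mu> E = - measure_support \<mu> (- E)"

definition measure_representative :: "'a measure \<Rightarrow> 'a set \<Rightarrow> 'a set \<Rightarrow> bool" where
  "measure_representative \<mu> E F \<longleftrightarrow> (E - F) \<union> (F - E) \<in> null_sets (completion \<mu>)"

end

theory Submission
  imports Defs
begin

text \<open>In exponential coordinates, let \<open>A\<close> and \<open>B\<close> be the measure-theoretic interiors of \<open>E\<close> and of its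
  complement. Moving a line slightly shows that \<open>A\<close> and \<open>B\<close> meet every horizontal line in an interval.

  The complement \<open>D\<close> of \<open>A \<union> B\<close> is null: from almost every point of \<open>E\<close> and for any fixed step, one of the two
  opposite horizontal steps stays in \<open>E\<close>. Hence, for a word of \<open>p\<close> steps, one of the \<open>2^p\<close> sign choices leads back
  into \<open>E\<close>. For a generic word the endpoint is a submersion in some of the parameters, whatever the signs:
  the vectors \<open>Ad(h) Z\<close>, with \<open>Z\<close> horizontal, span the Lie algebra and depend polynomially on the parameters. So
  the laws of the endpoints are absolutely continuous, and the lower bound \<open>2^-p\<close> for the probability of ending
  in \<open>E\<close> extends to the support of \<open>E\<close>; likewise for the complement. On \<open>D\<close> both bounds hold for arbitrarily short
  words, which is impossible near almost every point of \<open>D\<close>.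

  If \<open>x\<close> is in the support of \<open>E\<close> and \<open>x exp X\<close> is in \<open>B\<close>, walks from points of \<open>A\<close> near \<open>x\<close> with steps close to \<open>-X\<close>
  remain in \<open>A\<close>. Openness of \<open>\<Gamma>\<^sub>p\<close> at \<open>(-X, \<dots>, -X)\<close> makes the set of endpoints uniformly large, so that
  \<open>x exp (-pX)\<close> is in \<open>A\<close>, and the half line beyond \<open>x exp X\<close> is contained in \<open>B\<close>.\<close>

section \<open>Calculus of \<open>Ck_on\<close>\<close>

text \<open>The hypothesis controls almost every line, and only through an integral over directions.
  It yields a set \<open>Q\<close> of directions, dense in the first layer, such that for each of
  them almost every line is good. Density suffices because the interiors are open and generic words
  can be built from letters in \<open>Q\<close>. The walk argument rests on the order of choices:
  the length \<open>p\<close> and the letters are fixed before the scale, so there are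
  \<open>m = 2^p\<close> sign patterns at every scale. For a compact set \<open>K\<close> of measure
  \<open>k\<close> in the boundary part of \<open>E\<close>, at most the share
  \<open>(m - 1)/m\<close> of the short walks can end in \<open>E\<close>, while nearly all return
  to \<open>K\<close>; losing \<open>k/(2m)\<close> in the overlap of \<open>K\<close> with its
  translates does not bridge this gap. Absolute continuity makes the probability of ending in a
  Borel set upper semicontinuous in the starting point, which carries bounds from almost every point
  to the support. Only left invariance is built into \<open>haar_measure\<close>. Horizontal right
  invariance is read off from the normalization of the slice measures, and openness spreads it to
  the whole group.\<close>

lemma Ck_on_SucD: "Ck_on (Suc k) S f \<Longrightarrow> Ck_on k S f"
proof (induction k arbitrary: f)
  case 0
  then show ?case
    by (auto intro!: continuous_at_imp_continuous_on differentiable_imp_continuous_within)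
qed auto

lemma Ck_on_imp_continuous_on: "Ck_on k S f \<Longrightarrow> continuous_on S f"
  by (induction k) (use Ck_on_SucD in auto)

lemma Ck_on_cong:
  assumes "open S" "\<And>x. x \<in> S \<Longrightarrow> f x = g x" "Ck_on k S f"
  shows "Ck_on k S g"
  using assms(2,3)
proof (induction k arbitrary: f g)
  case 0
  then show ?case by (simp cong: continuous_on_cong)
next
  case (Suc k)
  have der: "(g has_derivative frechet_derivative f (at x)) (at x)" if "x \<in> S" for x
  proof -
    have "(f has_derivative frechet_derivative f (at x)) (at x)"
      using Suc.prems(2) that frechet_derivative_works by auto
    then show ?thesis
      using assms(1) that Suc.prems(1) by (rule has_derivative_transform_within_open)
  qed
  have eq: "frechet_derivative f (at x) = frechet_derivative g (at x)" if "x \<in> S" for x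
    using frechet_derivative_at[OF der[OF that]] .
  have "Ck_on k S (\<lambda>x. frechet_derivative g (at x) v)" for v
    by (rule Suc.IH[of "\<lambda>x. frechet_derivative f (at x) v"]) (use eq Suc.prems in auto)
  then show ?case using der by (auto simp: differentiable_def)
qed

text \<open>The group structure is smooth chart by chart, whereas exponential coordinates are
  global; this lemma glues.\<close>

lemma Ck_on_locally:
  assumes "\<And>x. x \<in> S \<Longrightarrow> \<exists>T. open T \<and> x \<in> T \<and> Ck_on k T f"
  shows "Ck_on k S f"
  using assms
proof (induction k arbitrary: f)
  case 0
  have "isCont f x" if "x \<in> S" for x
    using 0[OF that] by (auto simp: continuous_on_eq_continuous_at)
  then show ?case by (simp add: continuous_at_imp_continuous_on)
next
  case (Suc k)
  have "Ck_on k S (\<lambda>x. frechet_derivative f (at x) v)" for v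
    by (rule Suc.IH) (use Suc.prems in fastforce)
  with Suc.prems show ?case by fastforce
qed

lemma Ck_on_Suc_intro:
  assumes "\<And>x. x \<in> S \<Longrightarrow> (f has_derivative f' x) (at x)" "\<And>v. Ck_on k S (\<lambda>x. f' x v)" "open S"
  shows "Ck_on (Suc k) S f"
proof -
  have eq: "f' x = frechet_derivative f (at x)" if "x \<in> S" for x
    using frechet_derivative_at assms(1)[OF that] by blast
  have "Ck_on k S (\<lambda>x. frechet_derivative f (at x) v)" for v
    by (rule Ck_on_cong[of S "\<lambda>x. f' x v"]) (use eq assms in auto)
  then show ?thesis using assms(1) by (auto simp: differentiable_def)
qed

lemma Ck_on_Suc_derivative:
  assumes "Ck_on (Suc k) S f" "x \<in> S"
  shows "(f has_derivative frechet_derivative f (at x)) (at x)"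
  using assms frechet_derivative_works by auto

lemma Ck_on_const: "Ck_on k S (\<lambda>x. c)"
  by (induction k arbitrary: c) auto

lemma Ck_on_bounded_linear:
  assumes "bounded_linear f" "open S"
  shows "Ck_on k S f"
proof (cases k)
  case 0
  then show ?thesis using assms by (simp add: linear_continuous_on)
next
  case (Suc j)
  then show ?thesis
    using Ck_on_Suc_intro[of S f "\<lambda>_. f" j] bounded_linear_imp_has_derivative[OF assms(1)] assms(2)
    by (auto simp: Ck_on_const)
qed

lemma Ck_on_linear_compose:
  assumes "bounded_linear h" "open S" "Ck_on k S f"
  shows "Ck_on k S (\<lambda>x. h (f x))"
  using assms(3)
proof (induction k arbitrary: f)
  case 0
  then show ?case using assms(1) by (simp add: bounded_linear.continuous_on)
next
  case (Suc k)
  show ?case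
  proof (rule Ck_on_Suc_intro[OF _ _ assms(2)])
    show "((\<lambda>x. h (f x)) has_derivative (\<lambda>v. h (frechet_derivative f (at x) v))) (at x)" if "x \<in> S" for x
      using bounded_linear.has_derivative[OF assms(1) Ck_on_Suc_derivative[OF Suc.prems that]] .
  qed (use Suc in auto)
qed

lemma Ck_on_add:
  assumes "open S" "Ck_on k S f" "Ck_on k S g"
  shows "Ck_on k S (\<lambda>x. f x + g x)"
  using assms(2,3)
proof (induction k arbitrary: f g)
  case 0
  then show ?case by (simp add: continuous_on_add)
next
  case (Suc k)
  show ?case
  proof (rule Ck_on_Suc_intro[OF _ _ assms(1)])
    show "((\<lambda>x. f x + g x) has_derivative (\<lambda>v. frechet_derivative f (at x) v + frechet_derivative g (at x) v)) (at x)" if "x \<in> S" for x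
      using has_derivative_add[OF Ck_on_Suc_derivative[OF Suc.prems(1) that] Ck_on_Suc_derivative[OF Suc.prems(2) that]] .
  qed (use Suc in auto)
qed

lemma Ck_on_sum:
  assumes "open S" "\<And>i. i \<in> I \<Longrightarrow> Ck_on k S (f i)"
  shows "Ck_on k S (\<lambda>x. \<Sum>i\<in>I. f i x)"
  using assms(2)
  by (induction I rule: infinite_finite_induct) (auto intro: Ck_on_const Ck_on_add[OF assms(1)])

lemma Ck_on_scaleR:
  fixes a :: "'e::euclidean_space \<Rightarrow> real" and f :: "'e \<Rightarrow> 'f::euclidean_space"
  assumes "open S" "Ck_on k S a" "Ck_on k S f"
  shows "Ck_on k S (\<lambda>x. a x *\<^sub>R f x)"
  using assms(2,3)
proof (induction k arbitrary: a f)
  case 0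
  then show ?case by (simp add: continuous_on_scaleR)
next
  case (Suc k)
  show ?case
  proof (rule Ck_on_Suc_intro[OF _ _ assms(1)])
    show "((\<lambda>x. a x *\<^sub>R f x) has_derivative
        (\<lambda>v. a x *\<^sub>R frechet_derivative f (at x) v + frechet_derivative a (at x) v *\<^sub>R f x)) (at x)"
      if "x \<in> S" for x
      using has_derivative_scaleR[OF Ck_on_Suc_derivative[OF Suc.prems(1) that] Ck_on_Suc_derivative[OF Suc.prems(2) that]] .
    show "Ck_on k S (\<lambda>x. a x *\<^sub>R frechet_derivative f (at x) v + frechet_derivative a (at x) v *\<^sub>R f x)" for v
      using Suc.prems Ck_on_SucD[OF Suc.prems(1)] Ck_on_SucD[OF Suc.prems(2)]
      by (intro Ck_on_add[OF assms(1)] Suc.IH) auto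
  qed
qed

lemma Ck_on_mult:
  fixes f g :: "'e::euclidean_space \<Rightarrow> real"
  assumes "open S" "Ck_on k S f" "Ck_on k S g"
  shows "Ck_on k S (\<lambda>x. f x * g x)"
  using Ck_on_scaleR[OF assms] by simp

lemma Ck_on_compose:
  fixes f :: "'e::euclidean_space \<Rightarrow> 'f::euclidean_space" and g :: "'f \<Rightarrow> 'h::euclidean_space"
  assumes "open S" "f ` S \<subseteq> T" "Ck_on k S f" "Ck_on k T g"
  shows "Ck_on k S (\<lambda>x. g (f x))"
  using assms(3,4)
proof (induction k arbitrary: g)
  case 0
  then show ?case using assms(2) by (auto intro: continuous_on_compose2)
next
  case (Suc k)
  show ?case
  proof (rule Ck_on_Suc_intro[OF _ _ assms(1)])
    fix x assume x: "x \<in> S"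
    have g: "(g has_derivative frechet_derivative g (at (f x))) (at (f x))"
      using Ck_on_Suc_derivative Suc.prems(2) x assms(2) by blast
    have f: "(f has_derivative frechet_derivative f (at x)) (at x)"
      using Ck_on_Suc_derivative Suc.prems(1) x by blast
    have lin: "linear (frechet_derivative g (at (f x)))"
      using g has_derivative_linear by blast
    \<comment> \<open>The outer derivative is applied to a direction that varies with
      \<open>x\<close>, while \<open>Ck_on\<close> speaks of fixed directions. Expanding in the
      basis leaves fixed directions, covered by the induction hypothesis, with variable scalar
      coefficients.\<close>
    have rep: "frechet_derivative g (at (f x)) v = (\<Sum>b\<in>Basis. (v \<bullet> b) *\<^sub>R frechet_derivative g (at (f x)) b)" for v
      by (subst euclidean_representation[symmetric, of v])
        (simp add: linear_sum[OF lin] linear_scale[OF lin])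
    show "((\<lambda>x. g (f x)) has_derivative
       (\<lambda>v. \<Sum>b\<in>Basis. (frechet_derivative f (at x) v \<bullet> b) *\<^sub>R frechet_derivative g (at (f x)) b)) (at x)"
      using diff_chain_at[OF f g] unfolding rep[symmetric] o_def .
  next
    fix v
    show "Ck_on k S (\<lambda>x. \<Sum>b\<in>Basis. (frechet_derivative f (at x) v \<bullet> b) *\<^sub>R frechet_derivative g (at (f x)) b)"
    proof (intro Ck_on_sum Ck_on_scaleR assms(1))
      fix b :: 'f
      show "Ck_on k S (\<lambda>x. frechet_derivative f (at x) v \<bullet> b)"
        by (rule Ck_on_linear_compose[OF bounded_linear_inner_left assms(1)]) (use Suc.prems(1) in auto)
      show "Ck_on k S (\<lambda>x. frechet_derivative g (at (f x)) b)"
        by (rule Suc.IH) (use Suc.prems Ck_on_SucD[OF Suc.prems(1)] in auto)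
    qed
  qed
qed

lemma Ck_on_Pair:
  assumes "open S" "Ck_on k S f" "Ck_on k S g"
  shows "Ck_on k S (\<lambda>x. (f x, g x))"
proof -
  have "Ck_on k S (\<lambda>x. (f x, 0) + (0, g x))"
    using assms
    by (intro Ck_on_add Ck_on_linear_compose[of "\<lambda>x. (x, 0)"] Ck_on_linear_compose[of "\<lambda>x. (0, x)"])
      (auto intro!: bounded_linear_Pair bounded_linear_ident bounded_linear_zero)
  then show ?thesis by simp
qed

text \<open>Both sides are limits of the same second difference quotient, by the mean value theorem.\<close>

lemma mixed_partials_commute_real:
  fixes f :: "real \<times> real \<Rightarrow> real"
  assumes f: "Ck_on 2 UNIV f"
  shows "frechet_derivative (\<lambda>z. frechet_derivative f (at z) (1, 0)) (at 0) (0, 1) =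
         frechet_derivative (\<lambda>z. frechet_derivative f (at z) (0, 1)) (at 0) (1, 0)"
proof -
  have ck: "Ck_on (Suc (Suc 0)) UNIV f"
    using f by (simp only: numeral_2_eq_2)
  define d1 d2 where "d1 = (\<lambda>z. frechet_derivative f (at z) (1, 0))"
    and "d2 = (\<lambda>z. frechet_derivative f (at z) (0, 1))"
  define d12 d21 where "d12 = (\<lambda>z. frechet_derivative d1 (at z) (0, 1))"
    and "d21 = (\<lambda>z. frechet_derivative d2 (at z) (1, 0))"
  have cd: "Ck_on (Suc 0) UNIV d1" "Ck_on (Suc 0) UNIV d2"
    using ck unfolding d1_def d2_def by auto
  then have cont: "isCont d12 0" "isCont d21 0"
    by (simp_all add: d12_def d21_def continuous_on_eq_continuous_at zero_prod_def)
  have D1: "((\<lambda>s. g (s, t)) has_real_derivative frechet_derivative g (at (s, t)) (1, 0)) (at s)"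
    and D2: "((\<lambda>t. g (s, t)) has_real_derivative frechet_derivative g (at (s, t)) (0, 1)) (at t)"
    if g: "Ck_on (Suc 0) UNIV g" for g :: "real \<times> real \<Rightarrow> real" and s t
  proof -
    have G: "(g has_derivative frechet_derivative g (at (s, t))) (at (s, t))"
      using Ck_on_Suc_derivative[OF g] by simp
    then have lin: "linear (frechet_derivative g (at (s, t)))"
      using has_derivative_linear by blast
    have "((\<lambda>s. (s, t)) has_derivative (\<lambda>h. (h, 0))) (at s)"
      "((\<lambda>t. (s, t)) has_derivative (\<lambda>h. (0, h))) (at t)"
      by (auto intro!: derivative_eq_intros)
    from this(1)[THEN diff_chain_at, of g "frechet_derivative g (at (s, t))"]
      this(2)[THEN diff_chain_at, of g "frechet_derivative g (at (s, t))"] G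
    have a: "((\<lambda>s. g (s, t)) has_derivative (\<lambda>h. frechet_derivative g (at (s, t)) (h, 0))) (at s)"
      and b: "((\<lambda>t. g (s, t)) has_derivative (\<lambda>h. frechet_derivative g (at (s, t)) (0, h))) (at t)"
      by (auto simp: o_def)
    have e1: "(\<lambda>h. frechet_derivative g (at (s, t)) (h, 0)) = (\<lambda>h. frechet_derivative g (at (s, t)) (1, 0) * h)"
      and e2: "(\<lambda>h. frechet_derivative g (at (s, t)) (0, h)) = (\<lambda>h. frechet_derivative g (at (s, t)) (0, 1) * h)"
      subgoal using linear_scale[OF lin, of _ "(1,0)"] by (intro ext) (metis mult.commute mult_1_right mult_zero_right real_scaleR_def scaleR_Pair)
      subgoal using linear_scale[OF lin, of _ "(0,1)"] by (intro ext) (metis mult.commute mult_1_right mult_zero_right real_scaleR_def scaleR_Pair)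
      done
    show "((\<lambda>s. g (s, t)) has_real_derivative frechet_derivative g (at (s, t)) (1, 0)) (at s)"
      using a unfolding e1 has_field_derivative_def .
    show "((\<lambda>t. g (s, t)) has_real_derivative frechet_derivative g (at (s, t)) (0, 1)) (at t)"
      using b unfolding e2 has_field_derivative_def .
  qed
  have f1: "Ck_on (Suc 0) UNIV f" using ck Ck_on_SucD by blast
  have mv12: "\<exists>s t. 0 < s \<and> s < h \<and> 0 < t \<and> t < h \<and> f (h, h) - f (0, h) - (f (h, 0) - f (0, 0)) = h * h * d12 (s, t)"
    if h: "0 < h" for h
  proof -
    have "((\<lambda>s. f (s, h) - f (s, 0)) has_real_derivative (d1 (s, h) - d1 (s, 0))) (at s)" for s
      unfolding d1_def by (intro derivative_intros D1[OF f1])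
    then obtain s where s: "0 < s" "s < h" "(f (h, h) - f (h, 0)) - (f (0, h) - f (0, 0)) = h * (d1 (s, h) - d1 (s, 0))"
      using MVT2[OF h, of "\<lambda>s. f (s, h) - f (s, 0)" "\<lambda>s. d1 (s, h) - d1 (s, 0)"] by auto
    obtain t where t: "0 < t" "t < h" "d1 (s, h) - d1 (s, 0) = h * d12 (s, t)"
      using MVT2[OF h, of "\<lambda>t. d1 (s, t)" "\<lambda>t. d12 (s, t)"] D2[OF cd(1)] unfolding d12_def by auto
    show ?thesis using s t by (intro exI[of _ s] exI[of _ t]) (simp add: algebra_simps)
  qed
  have mv21: "\<exists>s t. 0 < s \<and> s < h \<and> 0 < t \<and> t < h \<and> f (h, h) - f (0, h) - (f (h, 0) - f (0, 0)) = h * h * d21 (s, t)"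
    if h: "0 < h" for h
  proof -
    have "((\<lambda>t. f (h, t) - f (0, t)) has_real_derivative (d2 (h, t) - d2 (0, t))) (at t)" for t
      unfolding d2_def by (intro derivative_intros D2[OF f1])
    then obtain t where t: "0 < t" "t < h" "(f (h, h) - f (0, h)) - (f (h, 0) - f (0, 0)) = h * (d2 (h, t) - d2 (0, t))"
      using MVT2[OF h, of "\<lambda>t. f (h, t) - f (0, t)" "\<lambda>t. d2 (h, t) - d2 (0, t)"] by auto
    obtain s where s: "0 < s" "s < h" "d2 (h, t) - d2 (0, t) = h * d21 (s, t)"
      using MVT2[OF h, of "\<lambda>s. d2 (s, t)" "\<lambda>s. d21 (s, t)"] D1[OF cd(2)] unfolding d21_def by auto
    show ?thesis using s t by (intro exI[of _ s] exI[of _ t]) (simp add: algebra_simps)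
  qed
  have "dist (d12 0) (d21 0) < e" if e: "0 < e" for e
  proof -
    obtain r1 where r1: "r1 > 0" "\<And>z. dist z 0 < r1 \<Longrightarrow> dist (d12 z) (d12 0) < e/2"
      using cont(1) half_gt_zero[OF e] unfolding continuous_at_eps_delta by metis
    obtain r2 where r2: "r2 > 0" "\<And>z. dist z 0 < r2 \<Longrightarrow> dist (d21 z) (d21 0) < e/2"
      using cont(2) half_gt_zero[OF e] unfolding continuous_at_eps_delta by metis
    define h where "h = min r1 r2 / 2"
    have h: "0 < h" using r1(1) r2(1) by (simp add: h_def)
    have small: "dist (s, t) 0 < min r1 r2" if "0 < s" "s < h" "0 < t" "t < h" for s t :: real
    proof -
      have "dist (s, t) 0 \<le> norm s + norm t"
        using norm_Pair_le[of s t] by (simp add: zero_prod_def[symmetric])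
      then show ?thesis using that unfolding h_def by auto
    qed
    obtain s t where st: "0 < s" "s < h" "0 < t" "t < h" "f (h, h) - f (0, h) - (f (h, 0) - f (0, 0)) = h * h * d12 (s, t)"
      using mv12[OF h] by blast
    obtain s' t' where st': "0 < s'" "s' < h" "0 < t'" "t' < h" "f (h, h) - f (0, h) - (f (h, 0) - f (0, 0)) = h * h * d21 (s', t')"
      using mv21[OF h] by blast
    have eq: "d12 (s, t) = d21 (s', t')" using st(5) st'(5) h by simp
    have "dist (d12 (s, t)) (d12 0) < e/2"
      by (rule r1(2)) (use small[OF st(1-4)] in simp)
    moreover have "dist (d21 (s', t')) (d21 0) < e/2"
      by (rule r2(2)) (use small[OF st'(1-4)] in simp)
    ultimately show ?thesis
      unfolding eq dist_real_def by linarith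
  qed
  from this[of "dist (d12 0) (d21 0)"] have "d12 0 = d21 0" by auto
  then show ?thesis by (simp add: d12_def d21_def d1_def d2_def)
qed

text \<open>By the inverse function theorem, the preimage of \<open>N\<close> near \<open>x0\<close>
  is the image of a part of \<open>N\<close> under the differentiable local inverse
  \<open>h\<close>, and differentiable maps between spaces of equal dimension preserve null sets.
  This is the source of absolute continuity for the endpoints of words.\<close>

lemma Ck_on_1_local_diffeo_null:
  fixes f :: "'g::euclidean_space \<Rightarrow> 'g"
  assumes f: "Ck_on (Suc 0) UNIV f" and inj: "inj (frechet_derivative f (at x0))"
  obtains r where "r > 0" "\<And>N. negligible N \<Longrightarrow> negligible {u \<in> ball x0 r. f u \<in> N}"
proof -
  define f' where "f' = (\<lambda>x. Blinfun (frechet_derivative f (at x)))"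
  have der: "(f has_derivative frechet_derivative f (at x)) (at x)" for x
    using Ck_on_Suc_derivative[OF f] by simp
  have f': "blinfun_apply (f' x) = frechet_derivative f (at x)" for x
    unfolding f'_def using has_derivative_bounded_linear[OF der] by (rule bounded_linear_Blinfun_apply)
  \<comment> \<open>The inverse function theorem wants a derivative that is continuous in operator
    norm; in finite dimension the directional continuity contained in \<open>Ck_on\<close> is
    enough.\<close>
  have cont: "continuous_on UNIV f'"
    by (rule continuous_on_blinfun_componentwise) (use f in \<open>auto simp: f'\<close>)
  have lin: "linear (frechet_derivative f (at x0))"
    using der has_derivative_linear by blast
  then obtain g where g: "linear g" "g \<circ> frechet_derivative f (at x0) = id"
    using linear_injective_left_inverse inj by blast
  have "Blinfun g o\<^sub>L f' x0 = id_blinfun"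
    using g by (intro blinfun_eqI)
      (simp add: f' bounded_linear_Blinfun_apply linear_conv_bounded_linear pointfree_idE)
  note I = this
  have D: "\<And>x. x \<in> UNIV \<Longrightarrow> (f has_derivative blinfun_apply (f' x)) (at x)"
    by (simp add: f' der)
  obtain U V h h' where U: "open U" "U \<subseteq> UNIV" "x0 \<in> U" "open V" "f x0 \<in> V" "homeomorphism U V f h"
    "\<And>y. y \<in> V \<Longrightarrow> (h has_derivative h' y) (at y)"
    by (rule inverse_function_theorem[OF open_UNIV D cont UNIV_I I]) (simp, rule that)
  obtain r where r: "r > 0" "ball x0 r \<subseteq> U"
    using U(1,3) open_contains_ball by blast
  show thesis
  proof
    fix N :: "'g set" assume N: "negligible N"
    have "negligible (h ` (N \<inter> V))"
      using N U(7) by (intro negligible_differentiable_image_negligible[OF order_refl])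
        (auto simp: negligible_Int differentiable_on_def intro: differentiableI has_derivative_at_withinI)
    moreover have "{u \<in> ball x0 r. f u \<in> N} \<subseteq> h ` (N \<inter> V)"
    proof safe
      fix u assume u: "u \<in> ball x0 r" "f u \<in> N"
      with r(2) have "u \<in> U" by auto
      then have "h (f u) = u" "f u \<in> V" using U(6) by (auto simp: homeomorphism_def)
      then show "u \<in> h ` (N \<inter> V)" using u by (metis IntI imageI)
    qed
    ultimately show "negligible {u \<in> ball x0 r. f u \<in> N}" by (rule negligible_subset)
  qed (use r in auto)
qed

section \<open>Polynomial antiderivatives\<close>

lemma poly_antiderivative:
  fixes q :: "real poly"
  obtains Q where "pderiv Q = q"
proof
  have "pderiv (monom (coeff q i / real (Suc i)) (Suc i)) = monom (coeff q i) i" for i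
    by (simp add: pderiv_monom field_simps del: of_nat_Suc)
  then show "pderiv (\<Sum>i\<le>degree q. monom (coeff q i / real (Suc i)) (Suc i)) = q"
    by (simp add: higher_pderiv_sum[where n=1, simplified] poly_as_sum_of_monoms del: of_nat_Suc)
qed

lemma polynomial_if_derivative_polynomial:
  fixes f :: "real \<Rightarrow> real"
  assumes "\<And>t. (f has_real_derivative poly q t) (at t)"
  obtains Q where "\<And>t. f t = poly Q t"
proof -
  obtain Q where Q: "pderiv Q = q" by (rule poly_antiderivative)
  have "((\<lambda>t. f t - poly Q t) has_real_derivative 0) (at t)" for t
    using DERIV_diff[OF assms poly_DERIV[of Q t]] Q by simp
  then have "f t - poly Q t = f 0 - poly Q 0" for t
    using DERIV_isconst_all by blast
  then have "f t = poly (Q + [:f 0 - poly Q 0:]) t" for t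
    by (simp add: algebra_simps)
  then show thesis by (rule that)
qed

section \<open>Group laws for which rays from the origin are one-parameter subgroups\<close>

text \<open>The group transported to its Lie algebra by the exponential map: the neutral element is
  \<open>0\<close>, inversion is negation, and derivatives and null sets are those of the vector
  space.\<close>

locale exp_group =
  fixes mul :: "'g::euclidean_space \<Rightarrow> 'g \<Rightarrow> 'g" (infixl "\<star>" 70)
  assumes assoc: "(a \<star> b) \<star> c = a \<star> (b \<star> c)"
    and zero_left [simp]: "0 \<star> a = a"
    and one_param: "(s *\<^sub>R a) \<star> (t *\<^sub>R a) = (s + t) *\<^sub>R a"
    and smooth: "smooth_on UNIV (\<lambda>z. fst z \<star> snd z)"
begin

lemma zero_right [simp]: "a \<star> 0 = a"
  using one_param[of 1 a 0] by simp

lemma minus_right [simp]: "a \<star> (- a) = 0"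
  using one_param[of 1 a "-1"] by simp

lemma minus_left [simp]: "(- a) \<star> a = 0"
  using one_param[of "-1" a 1] by simp

lemma minus_right_assoc [simp]: "a \<star> (- a \<star> b) = b" and minus_left_assoc [simp]: "- a \<star> (a \<star> b) = b"
  using assoc minus_right minus_left zero_left by metis+

lemma left_cancel: "a \<star> b = a \<star> c \<longleftrightarrow> b = c"
  using minus_left_assoc by metis

lemma minus_mul: "- (a \<star> b) = (- b) \<star> (- a)"
proof -
  have "(a \<star> b) \<star> (- (a \<star> b)) = (a \<star> b) \<star> ((- b) \<star> (- a))"
    by (simp add: assoc)
  then show ?thesis by (simp only: left_cancel)
qed

lemma Ck_mul:
  assumes "open S" "Ck_on k S f" "Ck_on k S g"
  shows "Ck_on k S (\<lambda>x. f x \<star> g x)"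
  using Ck_on_compose[OF assms(1) subset_UNIV Ck_on_Pair[OF assms], of "\<lambda>z. fst z \<star> snd z"]
    smooth by (auto simp: smooth_on_def)

lemma continuous_mul: "continuous_on UNIV (\<lambda>z. fst z \<star> snd z)"
  using smooth Ck_on.simps(1) unfolding smooth_on_def by blast

lemma tendsto_mul [tendsto_intros]:
  assumes "(f \<longlongrightarrow> a) F" "(g \<longlongrightarrow> b) F"
  shows "((\<lambda>x. f x \<star> g x) \<longlongrightarrow> a \<star> b) F"
proof -
  have "isCont (\<lambda>z. fst z \<star> snd z) (a, b)"
    using continuous_mul by (simp add: continuous_on_eq_continuous_at)
  from isCont_tendsto_compose[OF this tendsto_Pair[OF assms]] show ?thesis by simp
qed

lemma continuous_on_mul [continuous_intros]:
  "continuous_on S f \<Longrightarrow> continuous_on S g \<Longrightarrow> continuous_on S (\<lambda>x. f x \<star> g x)"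
  unfolding continuous_on_def by (auto intro: tendsto_mul)

lemma Ck_left: "Ck_on k UNIV (\<lambda>v. a \<star> v)" and Ck_right: "Ck_on k UNIV (\<lambda>v. v \<star> a)"
  by (intro Ck_mul Ck_on_const Ck_on_bounded_linear bounded_linear_ident open_UNIV)+

lemma left_differentiable: "(\<lambda>v. a \<star> v) differentiable (at x)"
  using Ck_left[of "Suc 0"] by simp

section \<open>Differentials of left translations and conjugations\<close>

definition dL :: "'g \<Rightarrow> 'g \<Rightarrow> 'g" where
  "dL a = frechet_derivative (\<lambda>v. a \<star> v) (at 0)"

lemma dL_has_derivative: "((\<lambda>v. a \<star> v) has_derivative dL a) (at 0)"
  unfolding dL_def using left_differentiable frechet_derivative_works by blast

lemma linear_dL: "linear (dL a)"
  using dL_has_derivative has_derivative_linear by blast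

lemma inj_dL: "inj (dL a)"
proof -
  have "((\<lambda>v. - a \<star> v) has_derivative frechet_derivative (\<lambda>v. - a \<star> v) (at a)) (at (a \<star> 0))"
    using left_differentiable frechet_derivative_works by force
  from diff_chain_at[OF dL_has_derivative this]
  have "((\<lambda>v. v) has_derivative frechet_derivative (\<lambda>v. - a \<star> v) (at a) \<circ> dL a) (at 0)"
    by (simp add: o_def)
  then have "frechet_derivative (\<lambda>v. - a \<star> v) (at a) \<circ> dL a = (\<lambda>v. v)"
    using has_derivative_unique has_derivative_ident by blast
  then show ?thesis
    by (metis comp_def injI)
qed

definition Ad :: "'g \<Rightarrow> 'g \<Rightarrow> 'g" where
  "Ad h = frechet_derivative (\<lambda>v. h \<star> v \<star> (- h)) (at 0)"

lemma Ad_has_derivative: "((\<lambda>v. h \<star> v \<star> (- h)) has_derivative Ad h) (at 0)"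
proof -
  have "Ck_on (Suc 0) UNIV (\<lambda>v. h \<star> v \<star> (- h))"
    by (intro Ck_mul Ck_on_const Ck_on_bounded_linear bounded_linear_ident open_UNIV)
  then show ?thesis unfolding Ad_def using Ck_on_Suc_derivative by blast
qed

lemma linear_Ad: "linear (Ad h)"
  using Ad_has_derivative has_derivative_linear by blast

lemma Ad_0 [simp]: "Ad 0 v = v"
proof -
  have "((\<lambda>v. v) has_derivative Ad 0) (at 0)"
    using Ad_has_derivative[of 0] by simp
  then show ?thesis using has_derivative_unique has_derivative_ident by metis
qed

lemma Ad_mul: "Ad (h \<star> k) v = Ad h (Ad k v)"
proof -
  have "((\<lambda>v. h \<star> v \<star> (- h)) has_derivative Ad h) (at (k \<star> 0 \<star> (- k)))"
    using Ad_has_derivative by simp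
  from diff_chain_at[OF Ad_has_derivative[of k] this]
  have "((\<lambda>v. (h \<star> k) \<star> v \<star> (- (h \<star> k))) has_derivative Ad h \<circ> Ad k) (at 0)"
    by (simp add: o_def minus_mul assoc)
  then show ?thesis using has_derivative_unique[OF Ad_has_derivative] by (metis comp_def)
qed

lemma Ad_minus_left [simp]: "Ad (- h) (Ad h v) = v" and Ad_minus_right [simp]: "Ad h (Ad (- h) v) = v"
  by (simp_all add: Ad_mul[symmetric])

lemma Ad_curve:
  assumes "(\<omega> has_vector_derivative w) (at 0)" "\<omega> 0 = 0"
  shows "((\<lambda>\<sigma>. h \<star> \<omega> \<sigma> \<star> (- h)) has_vector_derivative Ad h w) (at 0)"
proof -
  have "((\<lambda>v. h \<star> v \<star> (- h)) has_derivative Ad h) (at (\<omega> 0))"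
    using Ad_has_derivative assms by simp
  from diff_chain_at[OF assms(1)[unfolded has_vector_derivative_def] this]
  show ?thesis
    by (simp add: has_vector_derivative_def o_def linear_scale[OF linear_Ad])
qed

lemma dL_curve:
  assumes "(\<omega> has_vector_derivative w) (at 0)" "\<omega> 0 = 0"
  shows "((\<lambda>\<sigma>. a \<star> \<omega> \<sigma>) has_vector_derivative dL a w) (at 0)"
proof -
  have "((\<lambda>v. a \<star> v) has_derivative dL a) (at (\<omega> 0))"
    using dL_has_derivative assms by simp
  from diff_chain_at[OF assms(1)[unfolded has_vector_derivative_def] this]
  show ?thesis
    by (simp add: has_vector_derivative_def o_def linear_scale[OF linear_dL])
qed

text \<open>Since \<open>Ad ((t + h) *\<^sub>R Z)\<close> is the composition of
  \<open>Ad (t *\<^sub>R Z)\<close> and \<open>Ad (h *\<^sub>R Z)\<close>, the derivative at time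
  \<open>0\<close> determines the one at every time \<open>t\<close>.\<close>

lemma Ad_line_derivative:
  assumes br: "\<And>v. ((\<lambda>t. Ad (t *\<^sub>R Z) v) has_vector_derivative ad v) (at 0)"
  shows "((\<lambda>t. Ad (t *\<^sub>R Z) v) has_vector_derivative Ad (t *\<^sub>R Z) (ad v)) (at t)"
proof -
  have eq: "Ad ((t + h) *\<^sub>R Z) v = Ad (t *\<^sub>R Z) (Ad (h *\<^sub>R Z) v)" for h
    by (simp add: Ad_mul[symmetric] one_param)
  have "((\<lambda>h. Ad (t *\<^sub>R Z) (Ad (h *\<^sub>R Z) v)) has_vector_derivative Ad (t *\<^sub>R Z) (ad v)) (at 0)"
    by (rule bounded_linear.has_vector_derivative[OF _ br])
      (use linear_Ad linear_conv_bounded_linear in blast)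
  then have "((\<lambda>h. Ad ((t + h) *\<^sub>R Z) v) has_vector_derivative Ad (t *\<^sub>R Z) (ad v)) (at 0)"
    by (simp only: eq)
  then have "((\<lambda>u. Ad u v) \<circ> (\<lambda>h. (t + h) *\<^sub>R Z) has_vector_derivative Ad (t *\<^sub>R Z) (ad v)) (at (t - t))"
    by (simp add: o_def)
  moreover have "((\<lambda>s. s - t) has_vector_derivative 1) (at t)"
    by (auto intro!: derivative_eq_intros simp: has_vector_derivative_def)
  ultimately have "(((\<lambda>u. Ad u v) \<circ> (\<lambda>h. (t + h) *\<^sub>R Z)) \<circ> (\<lambda>s. s - t) has_vector_derivative 1 *\<^sub>R Ad (t *\<^sub>R Z) (ad v)) (at t)"
    by (intro vector_diff_chain_at)
  then show ?thesis by (simp add: o_def)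
qed

text \<open>Each differentiation in \<open>t\<close> replaces \<open>v\<close> by
  \<open>ad v\<close>, so after finitely many of them nothing is left. This stands in for the
  formula Ad(exp(tZ)) = exp(t ad Z), a finite series when ad Z is nilpotent.\<close>

lemma Ad_line_polynomial:
  assumes br: "\<And>v. ((\<lambda>t. Ad (t *\<^sub>R Z) v) has_vector_derivative ad v) (at 0)"
    and "(ad ^^ n) v = 0"
  shows "\<exists>q. \<forall>t. Ad (t *\<^sub>R Z) v \<bullet> b = poly q t"
  using assms(2)
proof (induction n arbitrary: v)
  case 0
  then have "Ad (t *\<^sub>R Z) v \<bullet> b = poly 0 t" for t
    by (simp add: linear_0[OF linear_Ad])
  then show ?case by blast
next
  case (Suc n)
  then obtain q where q: "\<And>t. Ad (t *\<^sub>R Z) (ad v) \<bullet> b = poly q t"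
    by (metis funpow_Suc_right comp_def)
  have "((\<lambda>t. Ad (t *\<^sub>R Z) v \<bullet> b) has_real_derivative poly q t) (at t)" for t
    unfolding q[symmetric] has_real_derivative_iff_has_vector_derivative
    by (rule bounded_linear.has_vector_derivative[OF bounded_linear_inner_left Ad_line_derivative[OF br]])
  then show ?case using polynomial_if_derivative_polynomial by metis
qed

text \<open>Used in two ways: with fixed directions \<open>Z\<close> and variable times
  \<open>t\<close> for the random walks, and with variable directions and all times equal to 1,
  where it is \<Gamma>_p in exponential coordinates.\<close>

primrec prd :: "nat \<Rightarrow> (nat \<Rightarrow> 'g) \<Rightarrow> (nat \<Rightarrow> real) \<Rightarrow> 'g" where
  "prd 0 Z t = 0"
| "prd (Suc p) Z t = prd p Z t \<star> (t p *\<^sub>R Z p)"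

text \<open>\<open>W p Z t k\<close> is the left translation to the origin of the partial derivative of \<open>prd p Z\<close> with
  respect to \<open>t k\<close>.\<close>

primrec W :: "nat \<Rightarrow> (nat \<Rightarrow> 'g) \<Rightarrow> (nat \<Rightarrow> real) \<Rightarrow> nat \<Rightarrow> 'g" where
  "W 0 Z t k = 0"
| "W (Suc p) Z t k = (if k < p then Ad (- (t p *\<^sub>R Z p)) (W p Z t k) else if k = p then Z p else 0)"

lemma prd_cong: "(\<And>i. i < p \<Longrightarrow> t i = t' i) \<Longrightarrow> (\<And>i. i < p \<Longrightarrow> Z i = Z' i) \<Longrightarrow> prd p Z t = prd p Z' t'"
  by (induction p) auto

lemma W_cong: "(\<And>i. i < p \<Longrightarrow> t i = t' i) \<Longrightarrow> (\<And>i. i < p \<Longrightarrow> Z i = Z' i) \<Longrightarrow> W p Z t k = W p Z' t' k"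
  by (induction p) auto

text \<open>The change of \<open>t k\<close> is kept as an exact right factor
  \<open>\<omega> \<sigma>\<close>. A later step \<open>c\<close> moves past it by conjugation,
  \<open>\<omega> \<star> c = c \<star> (- c \<star> \<omega> \<star> c)\<close>, which applies
  \<open>Ad (- c)\<close> to the velocity of the factor.\<close>

lemma prd_perturb:
  assumes "k < p"
  shows "\<exists>\<omega>. \<omega> 0 = 0 \<and> (\<omega> has_vector_derivative W p Z t k) (at 0) \<and>
    (\<forall>\<sigma>. prd p Z (t(k := t k + \<sigma>)) = prd p Z t \<star> \<omega> \<sigma>)"
  using assms
proof (induction p)
  case (Suc p)
  show ?case
  proof (cases "k = p")
    case True
    have "((\<lambda>\<sigma>. \<sigma> *\<^sub>R Z p) has_vector_derivative Z p) (at 0)"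
      by (auto intro!: derivative_eq_intros simp: has_vector_derivative_def)
    moreover have "prd (Suc p) Z (t(k := t k + \<sigma>)) = prd (Suc p) Z t \<star> (\<sigma> *\<^sub>R Z p)" for \<sigma>
      using True prd_cong[of p "t(k := t k + \<sigma>)" t Z Z] by (simp add: assoc one_param)
    ultimately show ?thesis using True by (intro exI[of _ "\<lambda>\<sigma>. \<sigma> *\<^sub>R Z p"] conjI allI) (simp_all del: prd.simps fun_upd_apply)
  next
    case False
    then have "k < p" using Suc.prems by simp
    from Suc.IH[OF this] obtain \<omega> where \<omega>: "\<omega> 0 = 0" "(\<omega> has_vector_derivative W p Z t k) (at 0)"
      "\<And>\<sigma>. prd p Z (t(k := t k + \<sigma>)) = prd p Z t \<star> \<omega> \<sigma>"
      by blast
    let ?c = "t p *\<^sub>R Z p"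
    have "((\<lambda>\<sigma>. - ?c \<star> \<omega> \<sigma> \<star> ?c) has_vector_derivative Ad (- ?c) (W p Z t k)) (at 0)"
      using Ad_curve[OF \<omega>(2,1), of "- ?c"] by simp
    moreover have "prd (Suc p) Z (t(k := t k + \<sigma>)) = prd (Suc p) Z t \<star> (- ?c \<star> \<omega> \<sigma> \<star> ?c)" for \<sigma>
      using False \<omega>(3) by (simp add: assoc)
    ultimately show ?thesis using \<omega>(1) False Suc.prems
      by (intro exI[of _ "\<lambda>\<sigma>. - ?c \<star> \<omega> \<sigma> \<star> ?c"] conjI allI) (simp_all del: prd.simps fun_upd_apply)
  qed
qed simp

lemma Ck_prd:
  assumes "open S" "\<And>i. i < p \<Longrightarrow> Ck_on k S (\<lambda>x. \<tau> x i)"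
  shows "Ck_on k S (\<lambda>x. prd p Z (\<tau> x))"
  using assms(2)
  by (induction p) (auto intro!: Ck_on_const Ck_mul[OF assms(1)] Ck_on_scaleR[OF assms(1)])

lemma prd_small:
  assumes "open V" "0 \<in> V"
  shows "\<exists>\<rho>>0. \<forall>t. (\<forall>i<p. \<bar>t i\<bar> < \<rho>) \<longrightarrow> prd p Z t \<in> V"
  using assms
proof (induction p arbitrary: V)
  case 0
  then show ?case by (intro exI[of _ 1]) auto
next
  case (Suc p)
  have "isCont (\<lambda>z. fst z \<star> (snd z *\<^sub>R Z p)) (0, 0)"
    unfolding isCont_def by (auto intro!: tendsto_eq_intros)
  moreover have "fst (0, 0) \<star> (snd (0, 0) *\<^sub>R Z p) \<in> V"
    using Suc.prems by simp
  ultimately obtain U where U: "open U" "(0, 0) \<in> U" "\<forall>z\<in>U. fst z \<star> (snd z *\<^sub>R Z p) \<in> V"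
    using Suc.prems(1) unfolding continuous_at_open by blast
  then obtain A B where AB: "open A" "open B" "0 \<in> A" "0 \<in> B" "A \<times> B \<subseteq> U"
    by (metis open_prod_elim mem_Sigma_iff)
  obtain \<rho> where \<rho>: "\<rho> > 0" "\<And>t. (\<forall>i<p. \<bar>t i\<bar> < \<rho>) \<Longrightarrow> prd p Z t \<in> A"
    using Suc.IH[OF AB(1,3)] by auto
  obtain \<rho>' where \<rho>': "\<rho>' > 0" "ball 0 \<rho>' \<subseteq> B"
    using AB open_contains_ball by blast
  have "prd (Suc p) Z t \<in> V" if t: "\<forall>i<Suc p. \<bar>t i\<bar> < min \<rho> \<rho>'" for t
  proof -
    have "(prd p Z t, t p) \<in> U" using t \<rho>(2)[of t] \<rho>'(2) AB(5) by (auto simp: subset_iff)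
    then show ?thesis using U(3) by fastforce
  qed
  then show ?case using \<rho>(1) \<rho>'(1) by (intro exI[of _ "min \<rho> \<rho>'"]) auto
qed

end

section \<open>Words with independent partial derivatives\<close>

text \<open>Gaussian elimination with entries in a ring of functions: the independence of finitely many
  vectors is implied by the non-vanishing of a single function in the ring, a substitute for a minor.\<close>

lemma generic_independence:
  fixes R :: "('x \<Rightarrow> real) set" and v :: "'i \<Rightarrow> 'x \<Rightarrow> 'g::euclidean_space"
  assumes one: "(\<lambda>x. 1) \<in> R"
    and mult: "\<And>f g. f \<in> R \<Longrightarrow> g \<in> R \<Longrightarrow> (\<lambda>x. f x * g x) \<in> R"
    and diff: "\<And>f g. f \<in> R \<Longrightarrow> g \<in> R \<Longrightarrow> (\<lambda>x. f x - g x) \<in> R"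
    and "finite I"
    and "\<And>i b. i \<in> I \<Longrightarrow> b \<in> Basis \<Longrightarrow> (\<lambda>x. v i x \<bullet> b) \<in> R"
    and "\<And>c. (\<Sum>i\<in>I. c i *\<^sub>R v i a) = 0 \<Longrightarrow> \<forall>i\<in>I. c i = 0"
  shows "\<exists>d\<in>R. d a \<noteq> 0 \<and> (\<forall>x c. d x \<noteq> 0 \<longrightarrow> (\<Sum>i\<in>I. c i *\<^sub>R v i x) = 0 \<longrightarrow> (\<forall>i\<in>I. c i = 0))"
  using assms(4-6)
proof (induction I arbitrary: v rule: finite_induct)
  case empty
  then show ?case using one by (intro bexI[of _ "\<lambda>x. 1"]) auto
next
  case (insert j I)
  have "v j a \<noteq> 0"
  proof
    assume "v j a = 0"
    moreover have "(\<Sum>i\<in>I. (if i = j then 1 else 0) *\<^sub>R v i a) = 0"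
      using insert.hyps by (intro sum.neutral) auto
    ultimately have "(\<Sum>i\<in>insert j I. (if i = j then 1 else 0) *\<^sub>R v i a) = 0"
      using insert.hyps by simp
    from insert.prems(2)[OF this] show False by simp
  qed
  then obtain b where b: "b \<in> Basis" "v j a \<bullet> b \<noteq> 0"
    using euclidean_all_zero_iff by blast
  define p where "p = (\<lambda>x. v j x \<bullet> b)"
  \<comment> \<open>Elimination without division: multiplying by the pivot \<open>p x\<close> keeps
    the entries in the ring, and subtracting the multiple of \<open>v j x\<close> kills the
    component along \<open>b\<close>.\<close>
  define w where "w = (\<lambda>i x. p x *\<^sub>R v i x - (v i x \<bullet> b) *\<^sub>R v j x)"
  have wR: "(\<lambda>x. w i x \<bullet> b') \<in> R" if "i \<in> I" "b' \<in> Basis" for i b'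
    unfolding w_def p_def using insert.prems(1) b that by (auto simp: inner_diff_left intro!: mult diff)
  have sum_w: "(\<Sum>i\<in>I. c i *\<^sub>R w i x) = p x *\<^sub>R (\<Sum>i\<in>I. c i *\<^sub>R v i x) - ((\<Sum>i\<in>I. c i *\<^sub>R v i x) \<bullet> b) *\<^sub>R v j x" for c x
    unfolding w_def by (simp add: sum_subtractf scaleR_sum_right inner_sum_left scaleR_sum_left algebra_simps)
  have ind: "\<forall>i\<in>I. c i = 0" if c: "(\<Sum>i\<in>I. c i *\<^sub>R w i a) = 0" for c
  proof -
    define c' where "c' = (\<lambda>i. if i = j then - ((\<Sum>i\<in>I. c i *\<^sub>R v i a) \<bullet> b) else p a * c i)"
    have "(\<Sum>i\<in>I. c' i *\<^sub>R v i a) = p a *\<^sub>R (\<Sum>i\<in>I. c i *\<^sub>R v i a)"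
      unfolding scaleR_sum_right by (rule sum.cong) (use insert.hyps in \<open>auto simp: c'_def\<close>)
    then have "(\<Sum>i\<in>insert j I. c' i *\<^sub>R v i a) = 0"
      using insert.hyps c sum_w[of c a] by (simp add: c'_def)
    from insert.prems(2)[OF this] have "\<forall>i\<in>I. p a * c i = 0"
      using insert.hyps unfolding c'_def by (metis insertCI)
    then show ?thesis using b by (simp add: p_def)
  qed
  from insert.IH[of w, OF wR ind] obtain d where d: "d \<in> R" "d a \<noteq> 0"
    "\<And>x c. d x \<noteq> 0 \<Longrightarrow> (\<Sum>i\<in>I. c i *\<^sub>R w i x) = 0 \<Longrightarrow> \<forall>i\<in>I. c i = 0"
    by blast
  have "p \<in> R" unfolding p_def using insert.prems(1) b by blast
  moreover have "\<forall>i\<in>insert j I. c i = 0"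
    if x: "p x * d x \<noteq> 0" and c: "(\<Sum>i\<in>insert j I. c i *\<^sub>R v i x) = 0" for x c
  proof -
    have s: "(\<Sum>i\<in>I. c i *\<^sub>R v i x) = - (c j *\<^sub>R v j x)"
      using c insert.hyps by (simp add: add_eq_0_iff)
    have "(\<Sum>i\<in>I. c i *\<^sub>R w i x) = 0"
      unfolding sum_w s by (simp add: p_def)
    then have 0: "\<forall>i\<in>I. c i = 0" using d(3) x by auto
    then have "c j *\<^sub>R v j x = 0" using s by simp
    moreover have "v j x \<noteq> 0" using x by (auto simp: p_def)
    ultimately show ?thesis using 0 by simp
  qed
  ultimately show ?case
    using d b by (intro bexI[of _ "\<lambda>x. p x * d x"]) (auto simp: mult p_def)
qed

text \<open>A stand-in for polynomials in the first \<open>p\<close> variables. Being polynomial in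
  each variable separately is what a choice of the variables one at a time requires, and it spares
  any bookkeeping of degrees and monomials.\<close>

definition sep_poly :: "nat \<Rightarrow> ((nat \<Rightarrow> real) \<Rightarrow> real) set" where
  "sep_poly p = {d. (\<forall>t i. \<exists>q. \<forall>x. d (t(i := x)) = poly q x) \<and>
     (\<forall>t t'. (\<forall>i<p. t i = t' i) \<longrightarrow> d t = d t')}"

lemma sep_polyI:
  assumes "\<And>t i. \<exists>q. \<forall>x. d (t(i := x)) = poly q x" "\<And>t t'. \<forall>i<p. t i = t' i \<Longrightarrow> d t = d t'"
  shows "d \<in> sep_poly p"
  using assms unfolding sep_poly_def by blast

lemma sep_polyD:
  assumes "d \<in> sep_poly p"
  shows "\<exists>q. \<forall>x. d (t(i := x)) = poly q x" "\<forall>i<p. t i = t' i \<Longrightarrow> d t = d t'"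
  using assms unfolding sep_poly_def by blast+

lemma sep_poly_const: "(\<lambda>t. c) \<in> sep_poly p"
  unfolding sep_poly_def by (auto intro!: exI[of _ "[:c:]"])

lemma sep_poly_mult:
  assumes "f \<in> sep_poly p" "g \<in> sep_poly p"
  shows "(\<lambda>t. f t * g t) \<in> sep_poly p"
proof -
  have "\<exists>q. \<forall>x. f (t(i := x)) * g (t(i := x)) = poly q x" for t i
  proof -
    obtain q r where "\<forall>x. f (t(i := x)) = poly q x" "\<forall>x. g (t(i := x)) = poly r x"
      using sep_polyD(1)[OF assms(1)] sep_polyD(1)[OF assms(2)] by blast
    then show ?thesis by (intro exI[of _ "q * r"]) simp
  qed
  moreover have "f t * g t = f t' * g t'" if "\<forall>i<p. t i = t' i" for t t'
    using sep_polyD(2)[OF assms(1) that] sep_polyD(2)[OF assms(2) that] by simp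
  ultimately show ?thesis by (rule sep_polyI)
qed

lemma sep_poly_add:
  assumes "f \<in> sep_poly p" "g \<in> sep_poly p"
  shows "(\<lambda>t. f t + g t) \<in> sep_poly p"
proof -
  have "\<exists>q. \<forall>x. f (t(i := x)) + g (t(i := x)) = poly q x" for t i
  proof -
    obtain q r where "\<forall>x. f (t(i := x)) = poly q x" "\<forall>x. g (t(i := x)) = poly r x"
      using sep_polyD(1)[OF assms(1)] sep_polyD(1)[OF assms(2)] by blast
    then show ?thesis by (intro exI[of _ "q + r"]) simp
  qed
  moreover have "f t + g t = f t' + g t'" if "\<forall>i<p. t i = t' i" for t t'
    using sep_polyD(2)[OF assms(1) that] sep_polyD(2)[OF assms(2) that] by simp
  ultimately show ?thesis by (rule sep_polyI)
qed

lemma sep_poly_diff: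
  assumes "f \<in> sep_poly p" "g \<in> sep_poly p"
  shows "(\<lambda>t. f t - g t) \<in> sep_poly p"
  using sep_poly_add[OF assms(1) sep_poly_mult[OF sep_poly_const[of "-1"] assms(2)]] by simp

lemma sep_poly_sum: "(\<And>i. i \<in> I \<Longrightarrow> f i \<in> sep_poly p) \<Longrightarrow> (\<lambda>t. \<Sum>i\<in>I. f i t) \<in> sep_poly p"
  by (induction I rule: infinite_finite_induct) (auto intro: sep_poly_const sep_poly_add)

lemma sep_poly_coord: "j < p \<Longrightarrow> (\<lambda>t. poly q (t j)) \<in> sep_poly p"
  unfolding sep_poly_def
proof (safe)
  fix t :: "nat \<Rightarrow> real" and i
  show "\<exists>r. \<forall>x. poly q ((t(i := x)) j) = poly r x"
    by (cases "i = j") (auto intro: exI[of _ q] exI[of _ "[:poly q (t j):]"])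
qed auto

lemma sep_poly_mono: "f \<in> sep_poly p \<Longrightarrow> p \<le> p' \<Longrightarrow> f \<in> sep_poly p'"
  using sep_polyD[of f p] by (intro sep_polyI) (meson order_less_le_trans)+

text \<open>Applied with \<open>\<eta>\<close> a pattern of signs, so that all sign choices of a
  word can be made generic simultaneously.\<close>

lemma sep_poly_scale:
  assumes "f \<in> sep_poly p"
  shows "(\<lambda>t. f (\<lambda>i. \<eta> i * t i)) \<in> sep_poly p"
proof -
  have "\<exists>q. \<forall>x. f (\<lambda>k. \<eta> k * (t(i := x)) k) = poly q x" for t i
  proof -
    obtain q where q: "\<And>x. f ((\<lambda>k. \<eta> k * t k)(i := x)) = poly q x"
      using assms unfolding sep_poly_def by blast
    have "(\<lambda>k. \<eta> k * (t(i := x)) k) = (\<lambda>k. \<eta> k * t k)(i := \<eta> i * x)" for x by auto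
    then have "f (\<lambda>k. \<eta> k * (t(i := x)) k) = poly (pcompose q [:0, \<eta> i:]) x" for x
      by (simp add: q poly_pcompose mult.commute)
    then show ?thesis by blast
  qed
  moreover have "f (\<lambda>i. \<eta> i * t i) = f (\<lambda>i. \<eta> i * t' i)" if "\<forall>i<p. t i = t' i" for t t'
    using that assms unfolding sep_poly_def by simp
  ultimately show ?thesis unfolding sep_poly_def by blast
qed

text \<open>The coordinates of \<open>s\<close> are fixed one at a time. Each \<open>d\<close> keeps
  its own witness \<open>a\<close> of non-vanishing that agrees with \<open>s\<close> so far; the
  values forbidden for the next coordinate are roots of finitely many nonzero polynomials in one
  variable, hence finite in number.\<close>

lemma sep_poly_common_nonzero:
  assumes D: "finite D" "D \<subseteq> sep_poly p" "\<And>d. d \<in> D \<Longrightarrow> \<exists>a. d a \<noteq> 0" and \<rho>: "\<rho> > 0"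
  obtains s where "\<And>i. \<bar>s i\<bar> < \<rho>" "\<And>d. d \<in> D \<Longrightarrow> d s \<noteq> 0"
proof -
  have "\<exists>s. (\<forall>i. \<bar>s i\<bar> < \<rho>) \<and> (\<forall>d\<in>D. \<exists>a. d a \<noteq> 0 \<and> (\<forall>i<k. a i = s i))" for k
  proof (induction k)
    case 0
    then show ?case using \<rho> D(3) by (intro exI[of _ "\<lambda>_. 0"]) auto
  next
    case (Suc k)
    then obtain s a where s: "\<And>i. \<bar>s i\<bar> < \<rho>"
      and a: "\<And>d. d \<in> D \<Longrightarrow> d (a d) \<noteq> 0" "\<And>d i. d \<in> D \<Longrightarrow> i < k \<Longrightarrow> a d i = s i"
      by metis
    have "finite {x. d ((a d)(k := x)) = 0}" if d: "d \<in> D" for d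
    proof -
      obtain q where q: "\<And>x. d ((a d)(k := x)) = poly q x"
        using D(2) d unfolding sep_poly_def by blast
      have "poly q (a d k) \<noteq> 0" using q[of "a d k"] a(1)[OF d] by simp
      then show ?thesis unfolding q by (intro poly_roots_finite) auto
    qed
    then have "finite (\<Union>d\<in>D. {x. d ((a d)(k := x)) = 0})" using D(1) by blast
    moreover have "infinite {0<..<\<rho>}" using \<rho> by simp
    ultimately have "\<not> {0<..<\<rho>} \<subseteq> (\<Union>d\<in>D. {x. d ((a d)(k := x)) = 0})"
      using finite_subset by blast
    then obtain x where "x \<in> {0<..<\<rho>}" "x \<notin> (\<Union>d\<in>D. {x. d ((a d)(k := x)) = 0})"
      by blast
    then have x: "0 < x" "x < \<rho>" "\<And>d. d \<in> D \<Longrightarrow> d ((a d)(k := x)) \<noteq> 0"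
      by auto
    show ?case
    proof (rule exI[of _ "s(k := x)"], intro conjI allI ballI)
      show "\<bar>(s(k := x)) i\<bar> < \<rho>" for i using s x by simp
      show "\<exists>a. d a \<noteq> 0 \<and> (\<forall>i<Suc k. a i = (s(k := x)) i)" if "d \<in> D" for d
        using x(3)[OF that] a(2)[OF that] by (intro exI[of _ "(a d)(k := x)"]) auto
    qed
  qed
  from this[of p] obtain s where s: "\<forall>i. \<bar>s i\<bar> < \<rho>" "\<forall>d\<in>D. \<exists>a. d a \<noteq> 0 \<and> (\<forall>i<p. a i = s i)"
    by blast
  moreover have "d s \<noteq> 0" if "d \<in> D" for d
    using s(2) D(2) that sep_polyD(2)[of d p] by (metis subsetD)
  ultimately show thesis using that by blast
qed

section \<open>Conjugates of horizontal vectors span the Lie algebra\<close>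

locale carnot_law = exp_group mul for mul :: "'g::euclidean_space \<Rightarrow> 'g \<Rightarrow> 'g" (infixl "\<star>" 70) +
  fixes V1 :: "'g set" and ad :: "'g \<Rightarrow> 'g \<Rightarrow> 'g"
  assumes subspace_V1: "subspace V1"
    and ad_derivative: "Z \<in> V1 \<Longrightarrow> ((\<lambda>t. Ad (t *\<^sub>R Z) v) has_vector_derivative ad Z v) (at 0)"
    and linear_ad: "linear (\<lambda>Z. ad Z v)"
    and ad_nilpotent: "\<exists>n. \<forall>Z\<in>V1. \<forall>v. (ad Z ^^ n) v = 0"
    and ad_generates: "subspace S \<Longrightarrow> V1 \<subseteq> S \<Longrightarrow> (\<And>Z v. Z \<in> V1 \<Longrightarrow> v \<in> S \<Longrightarrow> ad Z v \<in> S) \<Longrightarrow> S = UNIV"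
begin

lemma Ad_poly:
  assumes "Z \<in> V1"
  obtains q where "\<And>t. Ad (t *\<^sub>R Z) v \<bullet> b = poly q t"
proof -
  obtain n where "(ad Z ^^ n) v = 0" using ad_nilpotent assms by blast
  from Ad_line_polynomial[OF ad_derivative[OF assms] this] show thesis using that by blast
qed

text \<open>In matrix entries, the last step contributes polynomials in \<open>t p\<close>, because
  \<open>Ad\<close> is polynomial along horizontal lines; the other factor comes from the shorter
  word.\<close>

lemma W_sep_poly:
  assumes "\<And>i. i < p \<Longrightarrow> Z i \<in> V1"
  shows "(\<lambda>t. W p Z t k \<bullet> b) \<in> sep_poly p"
  using assms
proof (induction p arbitrary: b)
  case 0
  then show ?case by (simp add: sep_poly_const)
next
  case (Suc p)
  have "(\<lambda>t. Ad (- (t p *\<^sub>R Z p)) (W p Z t k) \<bullet> b) \<in> sep_poly (Suc p)"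
  proof -
    have eq: "Ad h v \<bullet> b = (\<Sum>c\<in>Basis. (v \<bullet> c) * (Ad h c \<bullet> b))" for h v
      by (subst euclidean_representation[symmetric, of v])
        (simp add: linear_sum[OF linear_Ad] linear_scale[OF linear_Ad] inner_sum_left)
    have "(\<lambda>t. Ad (- (t p *\<^sub>R Z p)) c \<bullet> b) \<in> sep_poly (Suc p)" for c
    proof -
      obtain q where q: "\<And>t. Ad (t *\<^sub>R Z p) c \<bullet> b = poly q t"
        using Ad_poly[of "Z p"] Suc.prems by blast
      have "Ad (- (t p *\<^sub>R Z p)) c \<bullet> b = poly (pcompose q [:0, -1:]) (t p)" for t
        using q[of "- t p"] by (simp add: poly_pcompose)
      then show ?thesis using sep_poly_coord[of p "Suc p"] by simp
    qed
    moreover have "(\<lambda>t. W p Z t k \<bullet> c) \<in> sep_poly (Suc p)" for c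
      using sep_poly_mono[OF Suc.IH] Suc.prems by auto
    ultimately have "(\<lambda>t. \<Sum>c\<in>Basis. (W p Z t k \<bullet> c) * (Ad (- (t p *\<^sub>R Z p)) c \<bullet> b)) \<in> sep_poly (Suc p)"
      by (intro sep_poly_sum sep_poly_mult)
    then show ?thesis by (simp only: eq[symmetric])
  qed
  then show ?case by (cases "k < p"; cases "k = p") (simp_all add: sep_poly_const)
qed

text \<open>The conjugations that the later steps of a word with letters in \<open>Q\<close> can
  apply to the vectors \<open>W\<close> of its earlier steps.\<close>

inductive_set Ads :: "'g set \<Rightarrow> ('g \<Rightarrow> 'g) set" for Q where
  Ads_id: "id \<in> Ads Q"
| Ads_comp: "T \<in> Ads Q \<Longrightarrow> Y \<in> Q \<Longrightarrow> Ad (\<tau> *\<^sub>R Y) \<circ> T \<in> Ads Q"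

definition orbit :: "'g set \<Rightarrow> 'g set" where
  "orbit Q = {U Z | U Z. U \<in> Ads Q \<and> Z \<in> Q}"

lemma orbitI: "U \<in> Ads Q \<Longrightarrow> Z \<in> Q \<Longrightarrow> U Z \<in> orbit Q"
  unfolding orbit_def by blast

lemma orbitE: "v \<in> orbit Q \<Longrightarrow> (\<And>U Z. v = U Z \<Longrightarrow> U \<in> Ads Q \<Longrightarrow> Z \<in> Q \<Longrightarrow> thesis) \<Longrightarrow> thesis"
  unfolding orbit_def by blast

lemma Ad_orbit: "v \<in> orbit Q \<Longrightarrow> Y \<in> Q \<Longrightarrow> Ad (t *\<^sub>R Y) v \<in> orbit Q"
  using orbitI[OF Ads_comp] by (auto elim!: orbitE)

text \<open>Each generator \<open>Ad (\<tau> *\<^sub>R Y)\<close> is undone by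
  \<open>Ad ((- \<tau>) *\<^sub>R Y)\<close>, which also maps the orbit to itself. This allows
  compensating in advance for steps that are appended to a word later.\<close>

lemma Ads_onto_orbit:
  assumes "T \<in> Ads Q" "v \<in> orbit Q"
  shows "\<exists>w \<in> orbit Q. T w = v"
  using assms
proof (induction arbitrary: v)
  case Ads_id
  then show ?case by auto
next
  case (Ads_comp T Y \<tau>)
  have "Ad ((- \<tau>) *\<^sub>R Y) v \<in> orbit Q"
    using Ad_orbit[OF Ads_comp.prems Ads_comp.hyps(2)] .
  from Ads_comp.IH[OF this] obtain w where w: "w \<in> orbit Q" "T w = Ad ((- \<tau>) *\<^sub>R Y) v"
    by blast
  then have "(Ad (\<tau> *\<^sub>R Y) \<circ> T) w = v" by simp
  then show ?case using w(1) by blast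
qed

lemma W_extend:
  assumes "T \<in> Ads Q" "\<forall>i<p. Z i \<in> Q"
  shows "\<exists>p' Z' t'. p \<le> p' \<and> (\<forall>i<p'. Z' i \<in> Q) \<and> (\<forall>k<p. W p' Z' t' k = T (W p Z t k))"
  using assms(1)
proof induction
  case Ads_id
  then show ?case using assms(2) by (intro exI[of _ p] exI[of _ Z] exI[of _ t]) auto
next
  case (Ads_comp T Y \<tau>)
  then obtain p' Z' t' where *: "p \<le> p'" "\<forall>i<p'. Z' i \<in> Q" "\<forall>k<p. W p' Z' t' k = T (W p Z t k)"
    by blast
  \<comment> \<open>The time \<open>- \<tau>\<close> cancels the sign in the recursion of
    \<open>W\<close>, so the appended step acts by \<open>Ad (\<tau> *\<^sub>R Y)\<close>.\<close>
  define Z1 t1 where "Z1 = Z'(p' := Y)" and "t1 = t'(p' := - \<tau>)"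
  have "W p' Z1 t1 k = W p' Z' t' k" for k
    unfolding Z1_def t1_def by (rule W_cong) auto
  moreover have "Z1 p' = Y" "t1 p' = - \<tau>" "\<And>i. i < p' \<Longrightarrow> Z1 i = Z' i"
    by (simp_all add: Z1_def t1_def)
  ultimately show ?case using * Ads_comp.hyps
    by (intro exI[of _ "Suc p'"] exI[of _ Z1] exI[of _ t1]) (auto simp: less_Suc_eq)
qed

text \<open>The vectors are produced one after another. To add \<open>v b0 = T Y\<close>, a word is
  first found for the preimages under \<open>T\<close> of the other vectors; then the letter
  \<open>Y\<close> is appended, and then the steps that apply \<open>T\<close> to
  everything.\<close>

lemma W_realize:
  assumes "finite B" "\<forall>b\<in>B. v b \<in> orbit Q"
  shows "\<exists>p Z t J. (\<forall>i<p. Z i \<in> Q) \<and> (\<forall>b\<in>B. J b < p \<and> W p Z t (J b) = v b)"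
  using assms
proof (induction B arbitrary: v rule: finite_induct)
  case empty
  then show ?case by (intro exI[of _ 0]) auto
next
  case (insert b0 B)
  obtain T Y where T: "T \<in> Ads Q" "Y \<in> Q" "v b0 = T Y" using insert.prems by (meson insertI1 orbitE)
  have "\<forall>b\<in>B. \<exists>w \<in> orbit Q. T w = v b"
    using insert.prems by (intro ballI Ads_onto_orbit[OF T(1)]) auto
  then have "\<exists>v'. \<forall>b\<in>B. v' b \<in> orbit Q \<and> T (v' b) = v b"
    unfolding Bex_def by (rule bchoice)
  then obtain v' where v': "\<forall>b\<in>B. v' b \<in> orbit Q" "\<And>b. b \<in> B \<Longrightarrow> T (v' b) = v b"
    by blast
  obtain p Z t J where *: "\<forall>i<p. Z i \<in> Q" "\<And>b. b \<in> B \<Longrightarrow> J b < p \<and> W p Z t (J b) = v' b"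
    using insert.IH[of v', OF v'(1)] by blast
  \<comment> \<open>Time \<open>0\<close> makes the new letter act trivially on the earlier vectors,
    while its own vector is \<open>Y\<close> whatever its time.\<close>
  define Z1 t1 where "Z1 = Z(p := Y)" and "t1 = t(p := 0)"
  have W1: "W p Z1 t1 k = W p Z t k" for k
    unfolding Z1_def t1_def by (rule W_cong) auto
  have "\<forall>i<Suc p. Z1 i \<in> Q" using *(1) T(2) by (auto simp: Z1_def less_Suc_eq)
  from W_extend[where t = t1, OF T(1) this] obtain p' Z' t' where
    **: "Suc p \<le> p'" "\<forall>i<p'. Z' i \<in> Q" "\<forall>k<Suc p. W p' Z' t' k = T (W (Suc p) Z1 t1 k)"
    by (elim exE conjE) (rule that; assumption)
  have "\<forall>b\<in>insert b0 B. (J(b0 := p)) b < p' \<and> W p' Z' t' ((J(b0 := p)) b) = v b"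
  proof
    fix b assume b: "b \<in> insert b0 B"
    show "(J(b0 := p)) b < p' \<and> W p' Z' t' ((J(b0 := p)) b) = v b"
    proof (cases "b = b0")
      case True
      then show ?thesis using ** T(3) by (simp add: Z1_def)
    next
      case False
      then have "b \<in> B" using b by simp
      then show ?thesis using *(2)[OF \<open>b \<in> B\<close>] **(1,3) False v'(2)
        by (simp add: W1) (simp add: t1_def)
    qed
  qed
  then show ?case using **(2) by blast
qed

text \<open>The span of the orbit is invariant under \<open>Ad (t *\<^sub>R Z)\<close> for
  \<open>Z\<close> in \<open>Q\<close>. Being closed, it contains the limits of difference
  quotients, hence is invariant under \<open>ad Z\<close>; by linearity in \<open>Z\<close> this
  extends to \<open>V1\<close>, and \<open>V1\<close> generates.\<close>

lemma span_orbit: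
  assumes Q: "Q \<subseteq> V1" "V1 \<subseteq> span Q"
  shows "span (orbit Q) = UNIV"
proof (rule ad_generates)
  have "Q \<subseteq> orbit Q" using orbitI[OF Ads_id] by auto
  then show "V1 \<subseteq> span (orbit Q)" using Q(2) span_mono by blast
  have inv: "Ad (t *\<^sub>R Z) v \<in> span (orbit Q)" if "Z \<in> Q" "v \<in> span (orbit Q)" for t Z v
  proof -
    have "Ad (t *\<^sub>R Z) ` orbit Q \<subseteq> orbit Q"
      using Ad_orbit that(1) by blast
    then have "Ad (t *\<^sub>R Z) ` span (orbit Q) \<subseteq> span (orbit Q)"
      by (metis linear_Ad linear_span_image span_mono)
    with that show ?thesis by blast
  qed
  have adQ: "ad Z v \<in> span (orbit Q)" if Z: "Z \<in> Q" and v: "v \<in> span (orbit Q)" for Z v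
  proof -
    have "((\<lambda>t. (Ad (t *\<^sub>R Z) v - Ad (0 *\<^sub>R Z) v) /\<^sub>R t) \<longlongrightarrow> ad Z v) (at 0)"
    proof -
      have "((\<lambda>t. norm (Ad (t *\<^sub>R Z) v - v - t *\<^sub>R ad Z v) / norm t) \<longlongrightarrow> 0) (at 0)"
        using ad_derivative[of Z v] Z Q(1) by (auto simp: has_vector_derivative_def has_derivative_iff_norm)
      moreover have "norm (Ad (t *\<^sub>R Z) v - v - t *\<^sub>R ad Z v) / norm t
          = norm ((Ad (t *\<^sub>R Z) v - Ad (0 *\<^sub>R Z) v) /\<^sub>R t - ad Z v)" if "t \<noteq> 0" for t
      proof -
        have "(Ad (t *\<^sub>R Z) v - Ad (0 *\<^sub>R Z) v) /\<^sub>R t - ad Z v = (Ad (t *\<^sub>R Z) v - v - t *\<^sub>R ad Z v) /\<^sub>R t"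
          using that by (simp add: scaleR_diff_right)
        then show ?thesis by (simp add: divide_inverse mult.commute)
      qed
      then have "\<forall>\<^sub>F t in at 0. norm (Ad (t *\<^sub>R Z) v - v - t *\<^sub>R ad Z v) / norm t
          = norm ((Ad (t *\<^sub>R Z) v - Ad (0 *\<^sub>R Z) v) /\<^sub>R t - ad Z v)"
        by (simp add: eventually_at_filter)
      ultimately have "((\<lambda>t. norm ((Ad (t *\<^sub>R Z) v - Ad (0 *\<^sub>R Z) v) /\<^sub>R t - ad Z v)) \<longlongrightarrow> 0) (at 0)"
        by (rule Lim_transform_eventually)
      then show ?thesis by (rule LIM_zero_cancel[OF tendsto_norm_zero_cancel])
    qed
    moreover have "(Ad (t *\<^sub>R Z) v - Ad (0 *\<^sub>R Z) v) /\<^sub>R t \<in> span (orbit Q)" for t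
      using inv[OF Z v, of t] v by (simp add: span_diff span_scale)
    ultimately show ?thesis
      using Lim_in_closed_set[OF closed_span _ trivial_limit_at] by (metis (no_types, lifting) always_eventually)
  qed
  show "ad Z v \<in> span (orbit Q)" if "Z \<in> V1" "v \<in> span (orbit Q)" for Z v
  proof -
    have "subspace {Z. ad Z v \<in> span (orbit Q)}"
      by (auto simp: subspace_def linear_0[OF linear_ad] linear_add[OF linear_ad] linear_scale[OF linear_ad]
          span_add span_scale span_zero)
    then have "span Q \<subseteq> {Z. ad Z v \<in> span (orbit Q)}"
      using adQ that(2) by (intro span_minimal) auto
    then show ?thesis using that(1) Q(2) by blast
  qed
qed auto

text \<open>A basis taken from the orbit is realized at one choice of the parameters, and
  \<open>generic_independence\<close> spreads the independence to all parameters where a single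
  function \<open>d\<close> does not vanish. Indexing the positions \<open>J\<close> by
  \<open>Basis\<close> lets a vector of \<open>'g\<close> serve as the increment of the
  parameters.\<close>

lemma generic_word:
  assumes Q: "Q \<subseteq> V1" "V1 \<subseteq> span Q"
  obtains p Z J d where "\<And>i. i < p \<Longrightarrow> Z i \<in> Q" "\<And>b. b \<in> (Basis :: 'g set) \<Longrightarrow> J b < p"
    "d \<in> sep_poly p" "\<exists>a. d a \<noteq> 0"
    "\<And>t c b. d t \<noteq> 0 \<Longrightarrow> (\<Sum>b\<in>(Basis :: 'g set). c b *\<^sub>R W p Z t (J b)) = 0 \<Longrightarrow> b \<in> Basis \<Longrightarrow> c b = 0"
proof -
  obtain B where B: "B \<subseteq> orbit Q" "independent B" "orbit Q \<subseteq> span B" "card B = dim (orbit Q)"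
    using basis_exists by blast
  have "span B = UNIV"
    using B(3) span_orbit[OF Q] by (metis span_mono span_span top.extremum_uniqueI)
  then have "card B = DIM('g)"
    using B(2) by (metis dim_UNIV dim_span dim_eq_card_independent)
  moreover have "finite B" using B(2) independent_imp_finite by blast
  ultimately obtain v where v: "bij_betw v (Basis :: 'g set) B"
    using finite_same_card_bij by (metis finite_Basis)
  then have "\<forall>b\<in>Basis. v b \<in> orbit Q" using B(1) bij_betwE by blast
  from W_realize[where v = v, OF finite_Basis this] obtain p Z t J where
    w: "\<forall>i<p. Z i \<in> Q" "\<forall>b\<in>Basis. J b < p \<and> W p Z t (J b) = v b"
    by (elim exE conjE) (rule that; assumption)
  have ind: "\<forall>b\<in>Basis. c b = 0" if "(\<Sum>b\<in>Basis. c b *\<^sub>R W p Z t (J b)) = 0" for c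
  proof -
    let ?u = "\<lambda>y. c (inv_into Basis v y)"
    have "(\<Sum>y\<in>B. ?u y *\<^sub>R y) = (\<Sum>b\<in>Basis. ?u (v b) *\<^sub>R v b)"
      by (rule sum.reindex_bij_betw[OF v, symmetric])
    also have "\<dots> = (\<Sum>b\<in>Basis. c b *\<^sub>R W p Z t (J b))"
      using v w(2) by (intro sum.cong) (auto simp: bij_betw_inv_into_left)
    finally have "(\<Sum>y\<in>B. ?u y *\<^sub>R y) = 0" using that by simp
    then have 0: "?u y = 0" if "y \<in> B" for y
      using independentD[OF B(2) \<open>finite B\<close> order_refl, of ?u y] that by simp
    show ?thesis
    proof
      fix b :: 'g assume b: "b \<in> Basis"
      then have "v b \<in> B" using v bij_betwE by blast
      then show "c b = 0" using 0[of "v b"] bij_betw_inv_into_left[OF v b] by simp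
    qed
  qed
  have "\<exists>d\<in>sep_poly p. d t \<noteq> 0 \<and> (\<forall>x c. d x \<noteq> 0 \<longrightarrow> (\<Sum>b\<in>Basis. c b *\<^sub>R W p Z x (J b)) = 0 \<longrightarrow> (\<forall>b\<in>Basis. c b = 0))"
    using w(1) Q(1) ind
    by (intro generic_independence[where v = "\<lambda>b t. W p Z t (J b)"] sep_poly_const sep_poly_mult sep_poly_diff finite_Basis W_sep_poly) auto
  then show thesis using that[of p Z J] w by blast
qed

end

section \<open>Haar measure and regularity\<close>

text \<open>The regularity theorems are for finite measures; as \<open>S\<close> is bounded, they
  are applied to the restriction \<open>M\<close> of \<open>\<mu>\<close> to a ball containing
  \<open>S\<close>.\<close>

lemma borel_measure_regular:
  fixes \<mu> :: "'g::euclidean_space measure"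
  assumes sets: "sets \<mu> = sets borel" and fin: "\<And>K. compact K \<Longrightarrow> emeasure \<mu> K < \<infinity>"
    and S: "S \<in> sets borel" "bounded S" and \<delta>: "0 < (\<delta>::real)"
  obtains C U where "compact C" "open U" "C \<subseteq> S" "S \<subseteq> U" "emeasure \<mu> (U - C) < \<delta>"
proof -
  obtain R where R: "S \<subseteq> ball 0 R" using bounded_subset_ballD[OF S(2)] by blast
  have sp: "space \<mu> = UNIV" using sets_eq_imp_space_eq[OF sets] by simp
  define M where "M = density \<mu> (indicator (ball 0 R))"
  have sM: "sets M = sets borel" by (simp add: M_def sets)
  have ind: "indicator (ball 0 R) \<in> borel_measurable \<mu>"
    by (rule borel_measurable_indicator) (simp add: sets)
  have eM: "emeasure M B = emeasure \<mu> (ball 0 R \<inter> B)" if "B \<in> sets borel" for B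
    unfolding M_def using that ind
    by (subst emeasure_density) (auto simp: sets indicator_inter_arith[symmetric])
  have "emeasure \<mu> (ball 0 R) \<le> emeasure \<mu> (cball 0 R)"
    by (rule emeasure_mono) (auto simp: sets)
  then have "emeasure \<mu> (ball 0 R) < \<infinity>"
    using fin[of "cball 0 R"] by (auto intro: le_less_trans)
  then have finM: "emeasure M (space M) \<noteq> \<infinity>"
    using eM[of UNIV] sets_eq_imp_space_eq[OF sM] by simp
  then interpret M: finite_measure M by (rule finite_measureI)
  have "emeasure M S < emeasure M S + ennreal (\<delta>/2)"
    using \<delta> by (simp add: M.emeasure_eq_measure ennreal_plus[symmetric] ennreal_less_iff del: ennreal_plus)
  then obtain U where U: "S \<subseteq> U" "open U" "emeasure M U < emeasure M S + ennreal (\<delta>/2)"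
    using outer_regular[OF sM finM S(1)] by (auto simp: INF_less_iff)
  have "\<exists>C. C \<subseteq> S \<and> compact C \<and> measure M S - \<delta>/2 < measure M C"
  proof (cases "measure M S = 0")
    \<comment> \<open>Here the lower bound is negative and \<open>ennreal\<close> would truncate it
      to 0, leaving no strict inequality for inner regularity; the empty set serves
      directly.\<close>
    case True
    then show ?thesis using \<delta> by (intro exI[of _ "{}"]) auto
  next
    case False
    then have "0 < measure M S" by (simp add: zero_less_measure_iff)
    then have "ennreal (measure M S - \<delta>/2) < emeasure M S"
      using \<delta> unfolding M.emeasure_eq_measure by (intro ennreal_lessI) auto
    then obtain C where C: "C \<subseteq> S" "compact C" "ennreal (measure M S - \<delta>/2) < emeasure M C"
      using inner_regular[OF sM finM S(1)] by (auto simp: less_SUP_iff)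
    have "measure M S - \<delta>/2 < measure M C"
    proof (rule ccontr)
      assume "\<not> ?thesis"
      then have "emeasure M C \<le> ennreal (measure M S - \<delta>/2)"
        unfolding M.emeasure_eq_measure by (intro ennreal_leI) simp
      with C(3) show False by simp
    qed
    with C show ?thesis by blast
  qed
  then obtain C where C: "C \<subseteq> S" "compact C" "measure M S - \<delta>/2 < measure M C" by blast
  have U': "measure M U < measure M S + \<delta>/2"
    using U(3) \<delta> by (simp add: M.emeasure_eq_measure ennreal_plus[symmetric] ennreal_less_iff del: ennreal_plus)
  have mb: "U \<in> sets M" "C \<in> sets M"
    using U C by (auto simp: sM compact_imp_closed)
  have "measure M (U - C) < \<delta>"
    using C U U' mb M.finite_measure_Diff[OF mb] by (smt (verit) subset_trans field_sum_of_halves)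
  then have "ennreal (measure M (U - C)) < \<delta>"
    using \<delta> by (intro ennreal_lessI)
  moreover have "emeasure \<mu> (ball 0 R \<inter> (U - C)) = ennreal (measure M (U - C))"
    using eM[of "U - C"] mb by (simp add: M.emeasure_eq_measure sM)
  ultimately have "emeasure \<mu> (ball 0 R \<inter> (U - C)) < \<delta>" by simp
  moreover have "ball 0 R \<inter> (U - C) = (ball 0 R \<inter> U) - C" by blast
  ultimately show thesis
    using that[of C "ball 0 R \<inter> U"] C U R by (simp add: open_Int)
qed

text \<open>In exponential coordinates, the image under \<Gamma>_p of the product of horizontal
  balls of radius \<open>\<delta>\<close> around \<open>X\<close>.\<close>

definition (in carnot_law) reach :: "nat \<Rightarrow> 'g \<Rightarrow> real \<Rightarrow> 'g set" where
  "reach p X \<delta> = {prd p Xs (\<lambda>_. 1) | Xs. \<forall>i<p. Xs i \<in> V1 \<and> dist (Xs i) X < \<delta>}"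

lemma borel_vimage_ball:
  fixes \<Phi> :: "'g::euclidean_space \<Rightarrow> 'h::euclidean_space"
  assumes "continuous_on UNIV \<Phi>" "N \<in> sets borel"
  shows "{u \<in> ball a r. \<Phi> u \<in> N} \<in> sets borel"
proof -
  have "ball a r \<inter> (\<Phi> -` N \<inter> space borel) \<in> sets borel"
    using measurable_sets[OF borel_measurable_continuous_onI[OF assms(1)] assms(2)] by auto
  moreover have "ball a r \<inter> (\<Phi> -` N \<inter> space borel) = {u \<in> ball a r. \<Phi> u \<in> N}" by auto
  ultimately show ?thesis by simp
qed

text \<open>Right invariance is stated along \<open>V1\<close> because this is what slicing by
  horizontal lines gives. In \<open>openness\<close>, the point \<open>real p *\<^sub>R X\<close> is
  \<Gamma>_p(X, ..., X).\<close>

locale carnot_haar = carnot_law mul V1 ad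
  for mul :: "'g::euclidean_space \<Rightarrow> 'g \<Rightarrow> 'g" (infixl "\<star>" 70) and V1 ad +
  fixes \<mu> :: "'g measure"
  assumes sets_mu: "sets \<mu> = sets borel"
    and fin_compact: "compact K \<Longrightarrow> emeasure \<mu> K < \<infinity>"
    and pos_open: "open U \<Longrightarrow> U \<noteq> {} \<Longrightarrow> 0 < emeasure \<mu> U"
    and left_inv: "B \<in> sets borel \<Longrightarrow> emeasure \<mu> {x. a \<star> x \<in> B} = emeasure \<mu> B"
    and right_inv_V1: "B \<in> sets borel \<Longrightarrow> X \<in> V1 \<Longrightarrow> emeasure \<mu> {x. x \<star> X \<in> B} = emeasure \<mu> B"
    and nontrivial: "V1 \<noteq> {0}"
    and openness: "X \<in> V1 \<Longrightarrow> X \<noteq> 0 \<Longrightarrow> \<exists>p\<ge>1. \<forall>\<delta>>0. \<exists>U. open U \<and> real p *\<^sub>R X \<in> U \<and> U \<subseteq> reach p X \<delta>"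
begin

lemma space_mu [simp]: "space \<mu> = UNIV"
  using sets_eq_imp_space_eq[OF sets_mu] by simp

sublocale mu: sigma_finite_measure \<mu>
proof
  show "\<exists>A. countable A \<and> A \<subseteq> sets \<mu> \<and> \<Union>A = space \<mu> \<and> (\<forall>a\<in>A. emeasure \<mu> a \<noteq> \<infinity>)"
  proof (intro exI[of _ "range (\<lambda>n::nat. cball 0 (real n))"] conjI)
    show "\<Union>(range (\<lambda>n::nat. cball (0::'g) (real n))) = space \<mu>"
      using real_arch_simple by (auto simp: dist_norm) 
  qed (use fin_compact in \<open>auto simp: sets_mu less_top[symmetric]\<close>)
qed

lemma borel_right: "B \<in> sets borel \<Longrightarrow> {x. x \<star> a \<in> B} \<in> sets borel"
  and borel_left: "B \<in> sets borel \<Longrightarrow> {x. a \<star> x \<in> B} \<in> sets borel"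
proof -
  have "(\<lambda>x. x \<star> a) \<in> borel_measurable borel" "(\<lambda>x. a \<star> x) \<in> borel_measurable borel"
    by (intro borel_measurable_continuous_onI continuous_on_mul continuous_on_id continuous_on_const)+
  from this[THEN measurable_sets] show "B \<in> sets borel \<Longrightarrow> {x. x \<star> a \<in> B} \<in> sets borel"
    "B \<in> sets borel \<Longrightarrow> {x. a \<star> x \<in> B} \<in> sets borel"
    by (auto simp: vimage_def)
qed

text \<open>The elements whose right translation preserves \<open>\<mu>\<close> form a subgroup
  \<open>R\<close> containing \<open>V1\<close>, hence the products in \<open>reach p X 1\<close>.
  By openness \<open>R\<close> has interior points, so it contains a ball around \<open>0\<close>,
  and every \<open>u\<close> is a power of the element \<open>(1 / real n) *\<^sub>R u\<close> of
  that ball.\<close>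

lemma right_inv:
  assumes "B \<in> sets borel"
  shows "emeasure \<mu> {x. x \<star> u \<in> B} = emeasure \<mu> B"
proof -
  define R where "R = {a. \<forall>B\<in>sets borel. emeasure \<mu> {x. x \<star> a \<in> B} = emeasure \<mu> B}"
  have V1R: "V1 \<subseteq> R" using right_inv_V1 by (auto simp: R_def)
  have mulR: "a \<star> b \<in> R" if "a \<in> R" "b \<in> R" for a b
    unfolding R_def
  proof (safe)
    fix B :: "'g set" assume B: "B \<in> sets borel"
    have "emeasure \<mu> {x. x \<star> (a \<star> b) \<in> B} = emeasure \<mu> {x. x \<star> a \<in> {y. y \<star> b \<in> B}}"
      by (simp add: assoc)
    also have "\<dots> = emeasure \<mu> {y. y \<star> b \<in> B}"
      using that(1) borel_right[OF B] unfolding R_def by blast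
    also have "\<dots> = emeasure \<mu> B" using that(2) B by (simp add: R_def)
    finally show "emeasure \<mu> {x. x \<star> (a \<star> b) \<in> B} = emeasure \<mu> B" .
  qed
  have minusR: "- a \<in> R" if "a \<in> R" for a
    unfolding R_def
  proof (safe)
    fix B :: "'g set" assume B: "B \<in> sets borel"
    have "emeasure \<mu> {x. x \<star> a \<in> {y. y \<star> (- a) \<in> B}} = emeasure \<mu> {y. y \<star> (- a) \<in> B}"
      using that borel_right[OF B] unfolding R_def by blast
    then show "emeasure \<mu> {x. x \<star> (- a) \<in> B} = emeasure \<mu> B" by (simp add: assoc)
  qed
  have zeroR: "0 \<in> R" by (simp add: R_def)
  have prdR: "prd p Xs (\<lambda>_. 1) \<in> R" if "\<forall>i<p. Xs i \<in> V1" for p Xs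
    using that by (induction p) (use V1R mulR zeroR in auto)
  obtain X where X: "X \<in> V1" "X \<noteq> 0"
    using nontrivial subspace_0[OF subspace_V1] by blast
  obtain p U where U: "open U" "real p *\<^sub>R X \<in> U" "U \<subseteq> reach p X 1"
    using openness[OF X] zero_less_one by meson
  then have UR: "U \<subseteq> R" using prdR unfolding reach_def by blast
  let ?V = "{x. (real p *\<^sub>R X) \<star> x \<in> U}"
  have "open ?V"
    using open_vimage[OF U(1), of "\<lambda>x. (real p *\<^sub>R X) \<star> x"]
    by (simp add: vimage_def continuous_on_mul)
  moreover have "0 \<in> ?V" using U by simp
  ultimately obtain e where e: "e > 0" "ball 0 e \<subseteq> ?V" using open_contains_ball by blast
  have ballR: "x \<in> R" if "x \<in> ball 0 e" for x
  proof -
    have "(real p *\<^sub>R X) \<star> x \<in> R" "real p *\<^sub>R X \<in> R"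
      using that e(2) UR U(2) by auto
    from mulR[OF minusR[OF this(2)] this(1)]
    have "- (real p *\<^sub>R X) \<star> ((real p *\<^sub>R X) \<star> x) \<in> R" .
    then show ?thesis by simp
  qed
  obtain n :: nat where n: "norm u / e < real n"
    using reals_Archimedean2 by blast
  moreover have "0 \<le> norm u / e" using e(1) by simp
  ultimately have n0: "n > 0" by (metis le_less_trans of_nat_0_less_iff)
  have "(real k / real n) *\<^sub>R u \<in> R" for k
  proof (induction k)
    case (Suc k)
    have "norm ((1 / real n) *\<^sub>R u) < e"
      using n n0 e(1) by (simp add: field_simps)
    then have "((real k / real n) *\<^sub>R u) \<star> ((1 / real n) *\<^sub>R u) \<in> R"
      using Suc mulR ballR by simp
    then show ?case by (simp add: one_param add_divide_distrib add.commute)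
  qed (simp add: zeroR)
  from this[of n] have "u \<in> R" using n0 by simp
  then show ?thesis using assms by (simp add: R_def)
qed

section \<open>Null sets, laws of endpoints and small translations\<close>

lemma AE_right:
  assumes "AE x in \<mu>. P x"
  shows "AE x in \<mu>. P (x \<star> a)"
proof -
  obtain N where N: "{x. \<not> P x} \<subseteq> N" "emeasure \<mu> N = 0" "N \<in> sets \<mu>"
    using assms by (auto elim!: AE_E)
  have "{x. x \<star> a \<in> N} \<in> null_sets \<mu>"
    using right_inv[of N a] borel_right[of N a] N by (auto simp: sets_mu null_sets_def)
  then show ?thesis by (rule AE_I') (use N in auto)
qed

lemma borel_mul [measurable (raw)]:
  assumes "f \<in> M \<rightarrow>\<^sub>M borel" "g \<in> M \<rightarrow>\<^sub>M borel"
  shows "(\<lambda>x. f x \<star> g x) \<in> M \<rightarrow>\<^sub>M borel"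
proof -
  have "(\<lambda>z. fst z \<star> snd z) \<in> borel \<rightarrow>\<^sub>M borel"
    using continuous_mul by (rule borel_measurable_continuous_onI)
  then have "(\<lambda>z. fst z \<star> snd z) \<in> borel \<Otimes>\<^sub>M borel \<rightarrow>\<^sub>M borel" by (simp add: borel_prod)
  from measurable_compose[OF measurable_Pair[OF assms] this] show ?thesis by simp
qed

lemma pred_mul:
  assumes "f \<in> M \<rightarrow>\<^sub>M borel" "g \<in> M \<rightarrow>\<^sub>M borel" "B \<in> sets borel"
  shows "Measurable.pred M (\<lambda>x. f x \<star> g x \<in> B)"
  by (rule pred_sets2[OF assms(3) borel_mul[OF assms(1,2)]])

text \<open>By right invariance, for each \<open>u\<close> almost every \<open>g\<close> has
  \<open>g \<star> u\<close> outside \<open>B\<close>. Fubini provides one \<open>g\<close> for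
  which this holds for Lebesgue-almost every \<open>u\<close>, and \<open>B\<close> is the image of
  the exceptional set under the smooth left translation by \<open>g\<close>.\<close>

lemma null_imp_negligible:
  assumes B: "B \<in> sets borel" "emeasure \<mu> B = 0"
  shows "negligible B"
proof -
  interpret P: pair_sigma_finite \<mu> lborel ..
  have [measurable_cong]: "sets \<mu> = sets borel" by (rule sets_mu)
  have "AE u in lborel. AE g in \<mu>. g \<star> u \<notin> B"
  proof (rule AE_I2)
    fix u :: 'g
    have "{x. x \<star> u \<in> B} \<in> null_sets \<mu>"
      using right_inv[of B u] borel_right[of B u] B by (auto simp: sets_mu null_sets_def)
    then show "AE g in \<mu>. g \<star> u \<notin> B" by (rule AE_I') auto
  qed
  moreover have "Measurable.pred (\<mu> \<Otimes>\<^sub>M lborel) (\<lambda>z. fst z \<star> snd z \<notin> B)"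
    by (rule pred_intros_logic(2)[OF pred_mul[OF _ _ B(1)]]; measurable)
  ultimately have ae: "AE g in \<mu>. AE u in lborel. g \<star> u \<notin> B"
    using P.AE_commute[of "\<lambda>g u. g \<star> u \<notin> B"] unfolding pred_def by simp
  have nb: "\<not> (AE g in \<mu>. False)"
    using pos_open[of UNIV] by (simp add: eventually_const_iff ae_filter_eq_bot_iff)
  have "\<exists>g. AE u in lborel. g \<star> u \<notin> B"
  proof (rule ccontr)
    assume neg: "\<not> ?thesis"
    from ae have "AE g in \<mu>. False" by (rule eventually_mono) (use neg in blast)
    with nb show False ..
  qed
  then obtain g where g: "AE u in lborel. g \<star> u \<notin> B" ..
  have "{u. g \<star> u \<in> B} \<in> null_sets lborel"
    using AE_iff_null_sets[of "{u. g \<star> u \<in> B}" lborel] g borel_left[OF B(1), of g] by simp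
  then have "negligible {u. g \<star> u \<in> B}"
    by (simp add: negligible_iff_null_sets null_sets_completionI)
  then have "negligible ((\<lambda>u. g \<star> u) ` {u. g \<star> u \<in> B})"
    by (rule negligible_differentiable_image_negligible[OF order_refl])
      (use left_differentiable in \<open>auto simp: differentiable_on_def intro: differentiable_at_withinI\<close>)
  moreover have "B \<subseteq> (\<lambda>u. g \<star> u) ` {u. g \<star> u \<in> B}"
  proof
    fix b assume "b \<in> B"
    then show "b \<in> (\<lambda>u. g \<star> u) ` {u. g \<star> u \<in> B}" by (intro image_eqI[of _ _ "- g \<star> b"]) auto
  qed
  ultimately show ?thesis by (rule negligible_subset)
qed

text \<open>Otherwise there are sets of \<open>\<mu>\<close>-measure below \<open>(1/2)^k\<close>
  whose law is at least \<open>e\<close>. By Borel-Cantelli their limsup is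
  \<open>\<mu>\<close>-null, so its law vanishes; but the law is a finite measure, so continuity
  from above keeps it at least \<open>e\<close>.\<close>

lemma law_absolutely_continuous:
  fixes \<Phi> :: "'g \<Rightarrow> 'g"
  assumes \<Phi>: "continuous_on UNIV \<Phi>" "\<And>N. negligible N \<Longrightarrow> negligible {u \<in> ball 0 r. \<Phi> u \<in> N}"
    and e: "0 < (e::real)"
  shows "\<exists>\<delta>>0. \<forall>N\<in>sets borel. emeasure \<mu> N < ennreal \<delta> \<longrightarrow> measure lborel {u \<in> ball 0 r. \<Phi> u \<in> N} < e"
proof (rule ccontr)
  define K where "K = distr (restrict_space lborel (ball 0 r)) borel \<Phi>"
  have meas: "\<Phi> \<in> restrict_space lborel (ball 0 r) \<rightarrow>\<^sub>M borel"
    using \<Phi>(1) by (intro measurable_restrict_space1) (simp add: borel_measurable_continuous_onI)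
  have K: "emeasure K N = emeasure lborel {u \<in> ball 0 r. \<Phi> u \<in> N}" if "N \<in> sets borel" for N
    unfolding K_def using that meas
    by (simp add: emeasure_distr emeasure_restrict_space space_restrict_space)
      (auto intro!: arg_cong2[where f = emeasure])
  have spK: "space K = UNIV" by (simp add: K_def)
  have "emeasure K (space K) = emeasure lborel (ball (0::'g) r)"
    unfolding spK by (subst K) (auto intro!: arg_cong2[where f = emeasure])
  then interpret K: finite_measure K
    using emeasure_lborel_ball_finite[of "0::'g" r] by (intro finite_measureI) auto
  have mK: "measure K N = measure lborel {u \<in> ball 0 r. \<Phi> u \<in> N}" if "N \<in> sets borel" for N
    using K[OF that] by (simp add: measure_def)
  have sK [simp]: "sets K = sets borel" by (simp add: K_def)
  assume neg: "\<not> ?thesis"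
  have "\<exists>N. N \<in> sets borel \<and> emeasure \<mu> N < ennreal ((1/2)^k) \<and> e \<le> measure K N" for k :: nat
  proof -
    have "(0::real) < (1/2)^k" by simp
    with neg obtain N where "N \<in> sets borel" "emeasure \<mu> N < ennreal ((1/2)^k)"
      "\<not> measure lborel {u \<in> ball 0 r. \<Phi> u \<in> N} < e"
      by blast
    then show ?thesis using mK[of N] by (intro exI[of _ N]) auto
  qed
  then have "\<forall>k::nat. \<exists>N. N \<in> sets borel \<and> emeasure \<mu> N < ennreal ((1/2)^k) \<and> e \<le> measure K N" ..
  from choice[OF this] obtain N where
    N': "\<forall>k::nat. N k \<in> sets borel \<and> emeasure \<mu> (N k) < ennreal ((1/2)^k) \<and> e \<le> measure K (N k)" ..
  have N: "N k \<in> sets borel" "emeasure \<mu> (N k) < ennreal ((1/2)^k)" "e \<le> measure K (N k)" for k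
    using N'[rule_format, of k] by simp_all
  have "limsup N \<in> null_sets \<mu>"
  proof (rule borel_cantelli_limsup1)
    show "emeasure \<mu> (N n) < \<infinity>" for n using N(2)[of n] by (auto intro: less_trans)
    have "measure \<mu> (N n) \<le> (1/2)^n" for n
      using N(2)[of n] by (simp add: measure_def enn2real_leI less_imp_le)
    then show "summable (\<lambda>n. measure \<mu> (N n))"
      by (intro summable_comparison_test'[OF summable_geometric[of "1/2"]]) auto
  qed (use N sets_mu in auto)
  then have lim: "limsup N \<in> sets borel" "emeasure \<mu> (limsup N) = 0"
    by (auto simp: null_sets_def sets_mu)
  then have "negligible {u \<in> ball 0 r. \<Phi> u \<in> limsup N}"
    by (intro \<Phi>(2) null_imp_negligible)
  moreover have "{u \<in> ball 0 r. \<Phi> u \<in> limsup N} \<in> sets borel"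
    by (rule borel_vimage_ball[OF \<Phi>(1) lim(1)])
  ultimately have "{u \<in> ball 0 r. \<Phi> u \<in> limsup N} \<in> null_sets lborel"
    by (simp only: negligible_iff_null_sets) (subst (asm) null_sets_completion_iff; simp)
  then have "measure K (limsup N) = 0"
    unfolding mK[OF lim(1)] by (simp add: measure_def null_setsD1)
  have "(\<lambda>n. measure K (\<Union>k\<in>{n..}. N k)) \<longlonglongrightarrow> measure K (\<Inter>n. \<Union>k\<in>{n..}. N k)"
  proof (rule K.finite_Lim_measure_decseq)
    show "decseq (\<lambda>n. \<Union>k\<in>{n..}. N k)"
      unfolding decseq_def by (intro allI impI UN_mono) auto
  qed (use N(1) in auto)
  moreover have "e \<le> measure K (\<Union>k\<in>{n..}. N k)" for n
    by (rule order_trans[OF N(3)[of n]], rule K.finite_measure_mono) (use N(1) in auto)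
  ultimately have "e \<le> measure K (limsup N)"
    unfolding limsup_INF_SUP by (intro LIMSEQ_le_const) auto
  with \<open>measure K (limsup N) = 0\<close> e show False by simp
qed

lemma tube_mul:
  assumes "compact K" "open U" "continuous_on UNIV h" "\<And>y. y \<in> K \<Longrightarrow> h (g0, y) \<in> (U :: 'g set)"
  shows "\<exists>V. open V \<and> (g0 :: 'g) \<in> V \<and> (\<forall>g\<in>V. \<forall>y\<in>(K :: 'g set). h (g, y) \<in> U)"
proof -
  have "open (h -` U)" using open_vimage[OF assms(2,3)] .
  moreover have "{g0} \<times> K \<subseteq> h -` U" using assms(4) by auto
  ultimately obtain V where "g0 \<in> V" "open V" "V \<times> K \<subseteq> h -` U"
    using Elementary_Topology.tube_lemma[OF assms(1), of "h -` U" g0] by blast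
  then show ?thesis by (intro exI[of _ V]) auto
qed

lemma law_fmeasurable:
  fixes \<Phi> :: "'g \<Rightarrow> 'g"
  assumes "continuous_on UNIV \<Phi>" "S \<in> sets borel"
  shows "{u \<in> ball 0 r. x \<star> \<Phi> u \<in> S} \<in> fmeasurable lborel"
proof (rule fmeasurableI2)
  show "ball (0::'g) r \<in> fmeasurable lborel"
    using emeasure_lborel_ball_finite[of "0::'g" r] by (intro fmeasurableI) auto
  have "continuous_on UNIV (\<lambda>u. x \<star> \<Phi> u)"
    by (intro continuous_on_mul continuous_on_const assms(1))
  from borel_vimage_ball[OF this assms(2)] show "{u \<in> ball 0 r. x \<star> \<Phi> u \<in> S} \<in> sets lborel"
    by (simp only: sets_lborel)
qed auto

text \<open>\<open>S\<close> is squeezed between a compact \<open>C\<close> and an open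
  \<open>U\<close> with small difference. For \<open>x\<close> near \<open>x0\<close>, an endpoint
  from \<open>x\<close> in \<open>C\<close> moves to one from \<open>x0\<close> in \<open>U\<close>.
  What remains are endpoints in small sets; by left invariance their probability is small uniformly
  in the starting point.\<close>

lemma law_upper_semicontinuous:
  fixes \<Phi> :: "'g \<Rightarrow> 'g"
  assumes \<Phi>: "continuous_on UNIV \<Phi>" "\<And>N. negligible N \<Longrightarrow> negligible {u \<in> ball 0 r. \<Phi> u \<in> N}"
    and S: "S \<in> sets borel" and e: "0 < (e::real)"
  shows "\<exists>U. open U \<and> x0 \<in> U \<and> (\<forall>x\<in>U. measure lborel {u \<in> ball 0 r. x \<star> \<Phi> u \<in> S}
           < measure lborel {u \<in> ball 0 r. x0 \<star> \<Phi> u \<in> S} + e)"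
proof -
  define k where "k = (\<lambda>x S. measure lborel {u \<in> ball 0 r. x \<star> \<Phi> u \<in> S})"
  note meas = law_fmeasurable[OF \<Phi>(1)]
  obtain \<delta> where \<delta>: "\<delta> > 0" "\<And>N. N \<in> sets borel \<Longrightarrow> emeasure \<mu> N < ennreal \<delta> \<Longrightarrow> measure lborel {u \<in> ball 0 r. \<Phi> u \<in> N} < e/2"
    using law_absolutely_continuous[OF \<Phi>, of "e/2"] e by auto
  have small: "k x T < e/2" if "T \<in> sets borel" "emeasure \<mu> T < ennreal \<delta>" for x T
    using \<delta>(2)[of "{y. x \<star> y \<in> T}"] left_inv[OF that(1), of x] borel_left[OF that(1), of x] that by (simp add: k_def)
  \<comment> \<open>A compact set containing the endpoints from all starting points within distance
    1 of \<open>x0\<close>; cutting \<open>S\<close> with it makes regularity applicable.\<close>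
  define C0 where "C0 = (\<lambda>z. fst z \<star> snd z) ` (cball x0 1 \<times> \<Phi> ` cball 0 r)"
  have "compact C0"
    unfolding C0_def using continuous_on_subset[OF \<Phi>(1)] continuous_on_subset[OF continuous_mul]
    by (intro compact_continuous_image compact_Times compact_cball) auto
  then have S1: "S \<inter> C0 \<in> sets borel" "bounded (S \<inter> C0)"
    using S compact_imp_bounded by (auto simp: compact_imp_closed intro: bounded_Int)
  obtain C U where CU: "compact C" "open U" "C \<subseteq> S \<inter> C0" "S \<inter> C0 \<subseteq> U" "emeasure \<mu> (U - C) < \<delta>"
    by (rule borel_measure_regular[OF sets_mu fin_compact S1 \<delta>(1)])
  have "continuous_on UNIV (\<lambda>z. x0 \<star> ((- fst z) \<star> snd z))"
    by (intro continuous_on_mul continuous_intros)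
  from tube_mul[OF CU(1,2) this, of x0] obtain V where
    V: "open V" "x0 \<in> V" "\<forall>x\<in>V. \<forall>y\<in>C. x0 \<star> ((- x) \<star> y) \<in> U"
    using CU(3,4) by auto
  have bU: "U - C \<in> sets borel" "S \<inter> C0 - C \<in> sets borel" "U - S \<inter> C0 \<in> sets borel"
    using CU(1,2) S1 by (auto simp: compact_imp_closed)
  have le: "emeasure \<mu> (S \<inter> C0 - C) \<le> emeasure \<mu> (U - C)" "emeasure \<mu> (U - S \<inter> C0) \<le> emeasure \<mu> (U - C)"
    using CU bU by (auto intro!: emeasure_mono simp: sets_mu)
  have sm: "k x (S \<inter> C0 - C) < e/2" "k x (U - S \<inter> C0) < e/2" for x
    using small[OF bU(2) le_less_trans[OF le(1) CU(5)]] small[OF bU(3) le_less_trans[OF le(2) CU(5)]] .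
  show ?thesis
  proof (intro exI[of _ "V \<inter> ball x0 1"] conjI ballI)
    fix x assume x: "x \<in> V \<inter> ball x0 1"
    let ?A = "{u \<in> ball 0 r. x \<star> \<Phi> u \<in> S}" and ?B = "{u \<in> ball 0 r. x0 \<star> \<Phi> u \<in> S}"
    let ?C = "{u \<in> ball 0 r. x \<star> \<Phi> u \<in> S \<inter> C0 - C}" and ?D = "{u \<in> ball 0 r. x0 \<star> \<Phi> u \<in> U - S \<inter> C0}"
    have sub: "?A \<subseteq> (?B \<union> ?C) \<union> ?D"
    proof
      fix u assume u: "u \<in> ?A"
      have "x \<in> cball x0 1" "\<Phi> u \<in> \<Phi> ` cball 0 r" using x u by auto
      then have "x \<star> \<Phi> u \<in> C0" unfolding C0_def by force
      show "u \<in> (?B \<union> ?C) \<union> ?D"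
      proof (cases "x \<star> \<Phi> u \<in> C")
        case True
        then have "x0 \<star> ((- x) \<star> (x \<star> \<Phi> u)) \<in> U" using V(3) x by blast
        then show ?thesis using u by auto
      next
        case False
        then show ?thesis using u \<open>x \<star> \<Phi> u \<in> C0\<close> by auto
      qed
    qed
    have m: "?A \<in> fmeasurable lborel" "?B \<in> fmeasurable lborel" "?C \<in> fmeasurable lborel" "?D \<in> fmeasurable lborel"
      by (rule meas, use S bU in blast)+
    have "measure lborel ?A \<le> measure lborel ((?B \<union> ?C) \<union> ?D)"
      by (intro measure_mono_fmeasurable[OF sub] fmeasurable.Un fmeasurableD m)
    also have "\<dots> \<le> measure lborel (?B \<union> ?C) + measure lborel ?D"
      by (intro measure_Un_le sets.Un fmeasurableD m)
    also have "\<dots> \<le> (measure lborel ?B + measure lborel ?C) + measure lborel ?D"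
      by (intro add_right_mono measure_Un_le fmeasurableD m)
    also have "\<dots> < measure lborel ?B + e"
      using sm(1)[of x] sm(2)[of x0] unfolding k_def by linarith
    finally show "measure lborel ?A < measure lborel ?B + e" .
  qed (use V in auto)
qed

text \<open>For small \<open>g\<close> the translate of \<open>K\<close> stays in an open
  \<open>U\<close> barely larger than \<open>K\<close>. The points of \<open>K\<close> that do not
  return to \<open>K\<close> are mapped into \<open>U - K\<close>, and right invariance bounds their
  measure.\<close>

lemma translate_overlap:
  assumes K: "compact K" and e: "0 < (e::real)"
  shows "\<exists>V. open V \<and> 0 \<in> V \<and> (\<forall>g\<in>V. emeasure \<mu> K \<le> emeasure \<mu> {x \<in> K. x \<star> g \<in> K} + ennreal e)"
proof -
  have bK: "K \<in> sets borel" using K by (simp add: compact_imp_closed)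
  obtain C U where CU: "compact C" "open U" "C \<subseteq> K" "K \<subseteq> U" "emeasure \<mu> (U - C) < e"
    using borel_measure_regular[OF sets_mu fin_compact bK compact_imp_bounded[OF K] e] .
  have "continuous_on UNIV (\<lambda>z. snd z \<star> fst z)"
    by (intro continuous_on_mul continuous_intros)
  from tube_mul[OF K CU(2) this, of 0] obtain V where
    V: "open V" "0 \<in> V" "\<forall>g\<in>V. \<forall>y\<in>K. y \<star> g \<in> U"
    using CU(4) by auto
  have "emeasure \<mu> K \<le> emeasure \<mu> {x \<in> K. x \<star> g \<in> K} + ennreal e" if g: "g \<in> V" for g
  proof -
    have b: "U - K \<in> sets borel" "U - C \<in> sets borel" using CU bK by (auto simp: compact_imp_closed)
    have m: "{x \<in> K. x \<star> g \<in> K} \<in> sets \<mu>" "{x. x \<star> g \<in> U - K} \<in> sets \<mu>"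
      using borel_right[OF bK, of g] borel_right[OF b(1), of g] bK
      by (auto simp: sets_mu Collect_conj_eq)
    have "emeasure \<mu> K \<le> emeasure \<mu> ({x \<in> K. x \<star> g \<in> K} \<union> {x. x \<star> g \<in> U - K})"
      using V(3) g m by (intro emeasure_mono sets.Un) auto
    also have "\<dots> \<le> emeasure \<mu> {x \<in> K. x \<star> g \<in> K} + emeasure \<mu> {x. x \<star> g \<in> U - K}"
      by (rule emeasure_subadditive[OF m])
    also have "emeasure \<mu> {x. x \<star> g \<in> U - K} \<le> emeasure \<mu> (U - C)"
      unfolding right_inv[OF b(1)] using CU b by (intro emeasure_mono) (auto simp: sets_mu)
    finally show ?thesis using CU(5) by (meson add_left_mono less_imp_le order_trans)
  qed
  with V show ?thesis by blast
qed

end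

section \<open>The boundary of a monotone set is null\<close>

text \<open>\<open>Q\<close> stands for the directions in which almost every line is monotone; the
  vanishing integral over the sphere makes them dense among the horizontal ones.\<close>

locale carnot_monotone = carnot_haar mul V1 ad \<mu>
  for mul :: "'g::euclidean_space \<Rightarrow> 'g \<Rightarrow> 'g" (infixl "\<star>" 70) and V1 ad \<mu> +
  fixes Q :: "'g set"
  assumes Q: "Q \<subseteq> V1" "V1 \<subseteq> closure Q"
begin

text \<open>Monotonicity of the indicator of \<open>E\<close> on almost every line with direction in \<open>Q\<close>, stated with three
  points of the line at fixed distances. In this form the invariance of \<open>\<mu>\<close> under right translations
  replaces Fubini's theorem along the lines.\<close>

definition line_mono :: "'g set \<Rightarrow> bool" where
  "line_mono E \<longleftrightarrow> E \<in> sets borel \<and>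
     (\<forall>X\<in>Q. \<forall>s>0. \<forall>t>0. AE x in \<mu>.
        (x \<in> E \<and> x \<star> ((s + t) *\<^sub>R X) \<in> E \<longrightarrow> x \<star> (s *\<^sub>R X) \<in> E) \<and>
        (x \<notin> E \<and> x \<star> ((s + t) *\<^sub>R X) \<notin> E \<longrightarrow> x \<star> (s *\<^sub>R X) \<notin> E))"

lemma line_mono_compl: "line_mono E \<Longrightarrow> line_mono (- E)"
  unfolding line_mono_def by (simp add: conj_commute borel_comp)

lemma line_monoD:
  assumes "line_mono E" "X \<in> Q" "0 < s" "0 < t"
  shows "AE x in \<mu>. x \<in> E \<and> x \<star> ((s + t) *\<^sub>R X) \<in> E \<longrightarrow> x \<star> (s *\<^sub>R X) \<in> E"
    "AE x in \<mu>. x \<notin> E \<and> x \<star> ((s + t) *\<^sub>R X) \<notin> E \<longrightarrow> x \<star> (s *\<^sub>R X) \<notin> E"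
  using assms unfolding line_mono_def by (auto elim!: eventually_mono)

lemma line_mono_borel: "line_mono E \<Longrightarrow> E \<in> sets borel"
  by (simp add: line_mono_def)

lemma span_Q: "V1 \<subseteq> span Q"
  using Q(2) closure_minimal[OF span_superset[of Q] closed_span] by blast

section \<open>Measure-theoretic support and interior in coordinates\<close>

definition msupp :: "'g set \<Rightarrow> 'g set" where
  "msupp S = {x. \<forall>U. open U \<and> x \<in> U \<longrightarrow> 0 < emeasure \<mu> (S \<inter> U)}"

definition mint :: "'g set \<Rightarrow> 'g set" where
  "mint S = - msupp (- S)"

lemma mint_iff: "x \<in> mint S \<longleftrightarrow> (\<exists>U. open U \<and> x \<in> U \<and> emeasure \<mu> (U - S) = 0)"
  unfolding mint_def msupp_def by (auto simp: Diff_eq Int_commute zero_less_iff_neq_zero)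

lemma mintI: "open U \<Longrightarrow> x \<in> U \<Longrightarrow> emeasure \<mu> (U - S) = 0 \<Longrightarrow> x \<in> mint S"
  using mint_iff by blast

lemma open_mint: "open (mint S)"
  unfolding open_subopen[of "mint S"]
proof
  fix x assume "x \<in> mint S"
  then obtain U where "open U" "x \<in> U" "emeasure \<mu> (U - S) = 0" using mint_iff by blast
  then show "\<exists>T. open T \<and> x \<in> T \<and> T \<subseteq> mint S"
    by (intro exI[of _ U]) (auto intro: mintI)
qed

lemma msupp_eq: "msupp S = - mint (- S)"
  by (simp add: mint_def)

text \<open>By Lindelof, countably many of the open sets in which \<open>S\<close> has full measure
  already cover \<open>mint S\<close>.\<close>

lemma mint_diff_null:
  assumes "S \<in> sets borel"
  shows "mint S - S \<in> null_sets \<mu>"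
proof -
  define F where "F = {U. open U \<and> emeasure \<mu> (U - S) = 0}"
  obtain F' where F': "F' \<subseteq> F" "countable F'" "\<Union>F' = \<Union>F"
    using Lindelof[of F] by (auto simp: F_def)
  have "\<Union>F = mint S" by (auto simp: F_def mint_iff)
  then have "mint S - S = (\<Union>U\<in>F'. U - S)" using F'(3) by auto
  moreover have "(\<Union>U\<in>F'. U - S) \<in> null_sets \<mu>"
    using F'(1) assms by (intro null_sets_UN'[OF F'(2)]) (auto simp: F_def null_sets_def sets_mu)
  ultimately show ?thesis by simp
qed

lemma AE_mint: "S \<in> sets borel \<Longrightarrow> AE x in \<mu>. x \<in> mint S \<longrightarrow> x \<in> S"
  by (rule AE_I'[OF mint_diff_null]) auto

lemma AE_imp_mint:
  assumes "open V" "x \<in> V" "S \<in> sets borel" "AE y in \<mu>. y \<in> V \<longrightarrow> y \<in> S"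
  shows "x \<in> mint S"
proof (rule mintI[OF assms(1,2)])
  have "V - S \<in> null_sets \<mu>"
    using assms by (subst AE_iff_null_sets) (auto simp: sets_mu elim!: eventually_mono)
  then show "emeasure \<mu> (V - S) = 0" by auto
qed

lemma mint_disjoint:
  assumes "S \<in> sets borel"
  shows "mint S \<inter> mint (- S) = {}"
proof (rule ccontr)
  assume ne: "mint S \<inter> mint (- S) \<noteq> {}"
  have "AE x in \<mu>. x \<notin> mint S \<inter> mint (- S)"
    using AE_mint[OF assms] AE_mint[OF borel_comp[OF assms]] by eventually_elim auto
  then have "emeasure \<mu> (mint S \<inter> mint (- S)) = 0"
    using open_mint by (subst (asm) AE_iff_null_sets[symmetric]) (auto simp: sets_mu)
  with pos_open[OF open_Int[OF open_mint open_mint] ne] show False by simp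
qed

lemma mint_convex:
  assumes E: "line_mono E" and X: "X \<in> V1" and r: "0 < r" and s: "0 < s"
    and x: "x \<in> mint E" "x \<star> ((r + s) *\<^sub>R X) \<in> mint E"
  shows "x \<star> (r *\<^sub>R X) \<in> mint E"
proof -
  define z where "z = x \<star> (r *\<^sub>R X)"
  \<comment> \<open>The two outer points seen from the middle point and the direction. Both remain
    in the open set \<open>mint E\<close> when the middle point moves in \<open>V\<close> and the
    direction in \<open>N\<close>, so the direction can be taken in \<open>Q\<close>.\<close>
  define h where "h = (\<lambda>p. (fst p \<star> (- (r *\<^sub>R snd p)), fst p \<star> (s *\<^sub>R snd p)))"
  have "continuous_on UNIV h"
    unfolding h_def by (intro continuous_intros)
  then have "open (h -` (mint E \<times> mint E))"
    by (intro open_vimage open_Times open_mint)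
  moreover have "h (z, X) = (x, x \<star> ((r + s) *\<^sub>R X))"
    by (simp add: h_def z_def assoc one_param scaleR_minus_left[symmetric] del: scaleR_minus_left)
  then have "(z, X) \<in> h -` (mint E \<times> mint E)" using x by simp
  ultimately obtain V N where VN: "open V" "open N" "z \<in> V" "X \<in> N" "V \<times> N \<subseteq> h -` (mint E \<times> mint E)"
    by (rule open_prod_elim) auto
  obtain Y where Y: "Y \<in> Q" "Y \<in> N"
    using X Q(2) VN(2,4) by (metis closure_iff_nhds_not_empty disjoint_iff order_refl subsetD)
  have Eb: "E \<in> sets borel" using E by (rule line_mono_borel)
  have "AE w in \<mu>. w \<in> E \<and> w \<star> ((r + s) *\<^sub>R Y) \<in> E \<longrightarrow> w \<star> (r *\<^sub>R Y) \<in> E"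
    by (rule line_monoD(1)[OF E Y(1) r s])
  \<comment> \<open>The translation recentres the statement at the middle point, which then runs
    through almost all of \<open>V\<close>.\<close>
  from AE_right[OF this, of "- (r *\<^sub>R Y)"]
  have "AE v in \<mu>. v \<star> (- (r *\<^sub>R Y)) \<in> E \<and> v \<star> (s *\<^sub>R Y) \<in> E \<longrightarrow> v \<in> E"
    by (simp add: assoc one_param scaleR_minus_left[symmetric] del: scaleR_minus_left)
  moreover note AE_right[OF AE_mint[OF Eb], of "- (r *\<^sub>R Y)"] AE_right[OF AE_mint[OF Eb], of "s *\<^sub>R Y"]
  ultimately have "AE v in \<mu>. v \<in> V \<longrightarrow> v \<in> E"
    by eventually_elim (use VN(5) Y(2) in \<open>auto simp: h_def subset_iff\<close>)
  from AE_imp_mint[OF VN(1,3) Eb this] show ?thesis by (simp add: z_def)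
qed

section \<open>Walks with random signs\<close>

lemma two_sided:
  assumes E: "line_mono E" and X: "X \<in> Q"
  shows "AE x in \<mu>. x \<in> E \<longrightarrow> x \<star> (t *\<^sub>R X) \<in> E \<or> x \<star> ((- t) *\<^sub>R X) \<in> E"
proof -
  have pos: "AE x in \<mu>. x \<in> E \<longrightarrow> x \<star> (t *\<^sub>R X) \<in> E \<or> x \<star> ((- t) *\<^sub>R X) \<in> E" if t: "0 < t" for t
  proof -
    have "AE w in \<mu>. w \<notin> E \<and> w \<star> ((t + t) *\<^sub>R X) \<notin> E \<longrightarrow> w \<star> (t *\<^sub>R X) \<notin> E"
      by (rule line_monoD(2)[OF E X t t])
    from AE_right[OF this, of "(- t) *\<^sub>R X"] show ?thesis
      by (simp only: assoc one_param) (auto elim!: eventually_mono)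
  qed
  consider "t > 0" | "t = 0" | "t < 0" by linarith
  then show ?thesis
  proof cases
    case 3
    then show ?thesis using pos[of "- t"] by (auto elim!: eventually_mono)
  qed (use pos in auto)
qed

definition signs :: "nat \<Rightarrow> (nat \<Rightarrow> real) set" where
  "signs p = PiE {..<p} (\<lambda>_. {1, -1})"

lemma finite_signs: "finite (signs p)"
  unfolding signs_def by (intro finite_PiE) auto

text \<open>The point reached after \<open>p\<close> steps is the right translate of
  \<open>x\<close> by a fixed element, so the null set excluded by \<open>two_sided\<close> stays
  null when pulled back. There are finitely many sign patterns to pull back along.\<close>

lemma word_stays:
  assumes E: "line_mono E" and Z: "\<forall>i<p. Z i \<in> Q"
  shows "AE x in \<mu>. x \<in> E \<longrightarrow> (\<exists>\<eta>\<in>signs p. x \<star> prd p Z (\<lambda>i. \<eta> i * t i) \<in> E)"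
  using Z
proof (induction p)
  case 0
  then show ?case by (simp add: signs_def)
next
  case (Suc p)
  have "AE x in \<mu>. \<forall>\<eta>\<in>signs p. x \<star> prd p Z (\<lambda>i. \<eta> i * t i) \<in> E \<longrightarrow>
     x \<star> prd p Z (\<lambda>i. \<eta> i * t i) \<star> (t p *\<^sub>R Z p) \<in> E \<or> x \<star> prd p Z (\<lambda>i. \<eta> i * t i) \<star> ((- t p) *\<^sub>R Z p) \<in> E"
    using Suc.prems by (intro AE_finite_allI finite_signs AE_right[OF two_sided[OF E]]) auto
  moreover have "AE x in \<mu>. x \<in> E \<longrightarrow> (\<exists>\<eta>\<in>signs p. x \<star> prd p Z (\<lambda>i. \<eta> i * t i) \<in> E)"
    using Suc by auto
  ultimately show ?case
  proof eventually_elim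
    case (elim x)
    show ?case
    proof
      assume "x \<in> E"
      with elim obtain \<eta> where \<eta>: "\<eta> \<in> signs p" "x \<star> prd p Z (\<lambda>i. \<eta> i * t i) \<in> E" by blast
      let ?y = "x \<star> prd p Z (\<lambda>i. \<eta> i * t i)"
      have "?y \<star> (t p *\<^sub>R Z p) \<in> E \<or> ?y \<star> ((- t p) *\<^sub>R Z p) \<in> E"
        using elim(1) \<eta> by blast
      then have "\<exists>\<sigma>. (\<sigma> = 1 \<or> \<sigma> = - 1) \<and> ?y \<star> ((\<sigma> * t p) *\<^sub>R Z p) \<in> E"
      proof
        assume "?y \<star> (t p *\<^sub>R Z p) \<in> E"
        then show ?thesis by (intro exI[of _ 1]) simp
      next
        assume "?y \<star> ((- t p) *\<^sub>R Z p) \<in> E"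
        then show ?thesis by (intro exI[of _ "- 1"]) simp
      qed
      then obtain \<sigma> :: real where \<sigma>: "\<sigma> = 1 \<or> \<sigma> = - 1" "?y \<star> ((\<sigma> * t p) *\<^sub>R Z p) \<in> E"
        by blast
      have "\<eta>(p := \<sigma>) \<in> signs (Suc p)"
        using \<eta>(1) \<sigma>(1) unfolding signs_def by (auto simp: PiE_iff extensional_def)
      moreover have "prd p Z (\<lambda>i. (\<eta>(p := \<sigma>)) i * t i) = prd p Z (\<lambda>i. \<eta> i * t i)"
        by (rule prd_cong) auto
      ultimately show "\<exists>\<eta>\<in>signs (Suc p). x \<star> prd (Suc p) Z (\<lambda>i. \<eta> i * t i) \<in> E"
        using \<sigma>(2) by (intro bexI[of _ "\<eta>(p := \<sigma>)"]) (simp_all add: assoc)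
    qed
  qed
qed

text \<open>The parameters of a word: fixed values \<open>s\<close>, to which the coordinates of \<open>u\<close> are added at the
  positions \<open>J b\<close>.\<close>

definition coords :: "('g \<Rightarrow> nat) \<Rightarrow> (nat \<Rightarrow> real) \<Rightarrow> 'g \<Rightarrow> nat \<Rightarrow> real" where
  "coords J s u k = s k + (\<Sum>b\<in>Basis. if J b = k then u \<bullet> b else 0)"

abbreviation word :: "nat \<Rightarrow> (nat \<Rightarrow> 'g) \<Rightarrow> ('g \<Rightarrow> nat) \<Rightarrow> (nat \<Rightarrow> real) \<Rightarrow> (nat \<Rightarrow> real) \<Rightarrow> 'g \<Rightarrow> 'g" where
  "word p Z J s \<eta> u \<equiv> prd p Z (\<lambda>i. \<eta> i * coords J s u i)"

lemma Ck_word: "Ck_on k UNIV (word p Z J s \<eta>)"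
proof (rule Ck_prd)
  have lin: "bounded_linear (\<lambda>u. \<Sum>b\<in>Basis. if J b = i then u \<bullet> b else 0)" for i
  proof (rule bounded_linear_sum)
    show "bounded_linear (\<lambda>u. if J b = i then u \<bullet> b else 0)" for b
      by (cases "J b = i") (simp_all add: bounded_linear_inner_left)
  qed
  have "Ck_on k UNIV (\<lambda>u. \<eta> i * (s i + (\<Sum>b\<in>Basis. if J b = i then u \<bullet> b else 0)))" for i
    by (intro Ck_on_mult Ck_on_add Ck_on_const open_UNIV Ck_on_bounded_linear lin)
  then show "Ck_on k UNIV (\<lambda>u. \<eta> i * coords J s u i)" for i
    by (simp add: coords_def)
qed simp

text \<open>Moving \<open>u\<close> along \<open>b\<close> changes only the parameter at position
  \<open>J b\<close>. So the derivative along \<open>b\<close> is \<open>dL\<close>, at the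
  endpoint, of the vector \<open>W\<close> at that position, up to the factor
  \<open>\<eta> (J b)\<close>; as \<open>dL\<close> is injective, independence of these vectors is
  injectivity.\<close>

lemma inj_word_derivative:
  assumes J: "\<And>b. b \<in> Basis \<Longrightarrow> J b < p" and \<eta>: "\<And>i. i < p \<Longrightarrow> \<eta> i \<noteq> 0"
    and ind: "\<And>c b. (\<Sum>b\<in>Basis. c b *\<^sub>R W p Z (\<lambda>i. \<eta> i * s i) (J b)) = 0 \<Longrightarrow> b \<in> Basis \<Longrightarrow> c b = 0"
  shows "inj (frechet_derivative (word p Z J s \<eta>) (at 0))"
proof -
  define \<Phi> where "\<Phi> = (word p Z J s \<eta>)"
  have der: "(\<Phi> has_derivative frechet_derivative \<Phi> (at 0)) (at 0)"
    using Ck_on_Suc_derivative[OF Ck_word] unfolding \<Phi>_def by blast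
  have lin: "linear (frechet_derivative \<Phi> (at 0))"
    using der has_derivative_linear by blast
  let ?t = "\<lambda>i. \<eta> i * s i"
  have c0: "coords J s 0 = s"
    unfolding coords_def by (intro ext) (auto intro!: sum.neutral)
  have D: "frechet_derivative \<Phi> (at 0) b = \<eta> (J b) *\<^sub>R dL (\<Phi> 0) (W p Z ?t (J b))" if b: "b \<in> Basis" for b
  proof -
    obtain \<omega> where \<omega>: "\<omega> 0 = 0" "(\<omega> has_vector_derivative W p Z ?t (J b)) (at 0)"
      "\<forall>\<sigma>. prd p Z (?t(J b := ?t (J b) + \<sigma>)) = prd p Z ?t \<star> \<omega> \<sigma>"
      using prd_perturb[OF J[OF b], of Z ?t] by blast
    have "coords J s (\<sigma> *\<^sub>R b) k = s k + (if J b = k then \<sigma> else 0)" for \<sigma> k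
    proof -
      have "(\<Sum>b'\<in>Basis. if J b' = k then (\<sigma> *\<^sub>R b) \<bullet> b' else 0) = (\<Sum>b'\<in>Basis. if b' = b then (if J b = k then \<sigma> else 0) else 0)"
        using b by (intro sum.cong) (auto simp: inner_Basis)
      then show ?thesis using b by (simp add: coords_def)
    qed
    then have "(\<lambda>i. \<eta> i * coords J s (\<sigma> *\<^sub>R b) i) = ?t(J b := ?t (J b) + \<eta> (J b) * \<sigma>)" for \<sigma>
      by (auto simp: fun_eq_iff algebra_simps)
    then have eq: "\<Phi> (\<sigma> *\<^sub>R b) = \<Phi> 0 \<star> \<omega> (\<eta> (J b) * \<sigma>)" for \<sigma>
      using \<omega>(3) by (simp only: \<Phi>_def c0)
    have "((\<lambda>\<sigma>. \<eta> (J b) * \<sigma>) has_vector_derivative \<eta> (J b)) (at 0)"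
      by (auto intro!: derivative_eq_intros simp: has_vector_derivative_def mult.commute)
    moreover have "(\<omega> has_vector_derivative W p Z ?t (J b)) (at (\<eta> (J b) * 0))"
      using \<omega>(2) by simp
    ultimately have "(\<omega> \<circ> (\<lambda>\<sigma>. \<eta> (J b) * \<sigma>) has_vector_derivative \<eta> (J b) *\<^sub>R W p Z ?t (J b)) (at 0)"
      by (rule vector_diff_chain_at)
    from dL_curve[OF this, of "\<Phi> 0"] \<omega>(1)
    have v1: "((\<lambda>\<sigma>. \<Phi> (\<sigma> *\<^sub>R b)) has_vector_derivative dL (\<Phi> 0) (\<eta> (J b) *\<^sub>R W p Z ?t (J b))) (at 0)"
      by (simp add: eq)
    have "((\<lambda>\<sigma>. \<sigma> *\<^sub>R b) has_vector_derivative b) (at 0)"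
      by (auto intro!: derivative_eq_intros simp: has_vector_derivative_def)
    moreover have "(\<Phi> has_derivative frechet_derivative \<Phi> (at 0)) (at (0 *\<^sub>R b))"
      using der by simp
    ultimately have "(\<Phi> \<circ> (\<lambda>\<sigma>. \<sigma> *\<^sub>R b) has_derivative frechet_derivative \<Phi> (at 0) \<circ> (\<lambda>h. h *\<^sub>R b)) (at 0)"
      unfolding has_vector_derivative_def by (rule diff_chain_at)
    then have v2: "((\<lambda>\<sigma>. \<Phi> (\<sigma> *\<^sub>R b)) has_vector_derivative frechet_derivative \<Phi> (at 0) b) (at 0)"
      by (simp add: has_vector_derivative_def o_def linear_scale[OF lin])
    show ?thesis
      using vector_derivative_unique_at[OF v2 v1] by (simp add: linear_scale[OF linear_dL])
  qed
  have "w = 0" if w: "frechet_derivative \<Phi> (at 0) w = 0" for w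
  proof -
    have "frechet_derivative \<Phi> (at 0) w = frechet_derivative \<Phi> (at 0) (\<Sum>b\<in>Basis. (w \<bullet> b) *\<^sub>R b)"
      by (simp add: euclidean_representation)
    also have "\<dots> = (\<Sum>b\<in>Basis. (w \<bullet> b) *\<^sub>R (\<eta> (J b) *\<^sub>R dL (\<Phi> 0) (W p Z ?t (J b))))"
      by (simp add: linear_sum[OF lin] linear_scale[OF lin] D)
    also have "\<dots> = dL (\<Phi> 0) (\<Sum>b\<in>Basis. ((w \<bullet> b) * \<eta> (J b)) *\<^sub>R W p Z ?t (J b))"
      by (simp add: linear_sum[OF linear_dL] linear_scale[OF linear_dL])
    finally have "(\<Sum>b\<in>Basis. ((w \<bullet> b) * \<eta> (J b)) *\<^sub>R W p Z ?t (J b)) = 0"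
      using w inj_dL linear_0[OF linear_dL] by (metis injD)
    from ind[OF this] have "w \<bullet> b = 0" if "b \<in> Basis" for b
      using that \<eta>[OF J[OF that]] by fastforce
    then show "w = 0" using euclidean_all_zero_iff by blast
  qed
  then show ?thesis
    using linear_injective_0[OF lin] unfolding \<Phi>_def by blast
qed

end

context carnot_monotone
begin

lemma finite_uniform_radius:
  assumes "finite A" "\<And>a. a \<in> A \<Longrightarrow> \<exists>r>0. P a r" "\<And>a r r'. P a r \<Longrightarrow> 0 < r' \<Longrightarrow> r' \<le> r \<Longrightarrow> P a (r'::real)"
  shows "\<exists>r>0. \<forall>a\<in>A. P a r"
  using assms(1,2)
proof (induction A rule: finite_induct)
  case empty
  then show ?case by (intro exI[of _ 1]) auto
next
  case (insert a A)
  then obtain r where r: "r > 0" "\<forall>a\<in>A. P a r" by auto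
  obtain r' where r': "r' > 0" "P a r'" using insert.prems[of a] by auto
  show ?case
  proof (intro exI[of _ "min r r'"] conjI ballI)
    fix b assume "b \<in> insert a A"
    then show "P b (min r r')" using r r' assms(3) by (metis insertE min.cobounded1 min.cobounded2 min_less_iff_conj)
  qed (use r r' in auto)
qed

lemma signs_values: "\<eta> \<in> signs p \<Longrightarrow> i < p \<Longrightarrow> \<eta> i = 1 \<or> \<eta> i = - 1"
  unfolding signs_def by (auto dest: PiE_mem)

lemma signs_nonempty: "signs p \<noteq> {}"
  unfolding signs_def by (simp add: PiE_eq_empty_iff)

definition word_ok :: "nat \<Rightarrow> (nat \<Rightarrow> 'g) \<Rightarrow> ('g \<Rightarrow> nat) \<Rightarrow> 'g set \<Rightarrow> (nat \<Rightarrow> real) \<Rightarrow> real \<Rightarrow> bool" where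
  "word_ok p Z J V s r \<longleftrightarrow> 0 < r \<and> (\<forall>\<eta>\<in>signs p.
       (\<forall>u\<in>ball 0 r. word p Z J s \<eta> u \<in> V) \<and>
       (\<forall>N. negligible N \<longrightarrow> negligible {u \<in> ball 0 r. word p Z J s \<eta> u \<in> N}))"

text \<open>Only the centre \<open>s\<close> and the radius \<open>r\<close> depend on
  \<open>V\<close>. That \<open>p\<close> is chosen before the scale bounds the number of sign
  patterns uniformly, on which the contradiction at the boundary rests.\<close>

lemma good_word:
  obtains p Z J where "\<forall>i<p. Z i \<in> Q"
    "\<forall>V. open V \<longrightarrow> 0 \<in> V \<longrightarrow> (\<exists>s r. word_ok p Z J V s r)"
proof -
  obtain p Z J d where Z: "\<And>i. i < p \<Longrightarrow> Z i \<in> Q" and J: "\<And>b. b \<in> (Basis :: 'g set) \<Longrightarrow> J b < p"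
    and d: "d \<in> sep_poly p" "\<exists>a. d a \<noteq> 0"
    and ind: "\<And>t c b. d t \<noteq> 0 \<Longrightarrow> (\<Sum>b\<in>(Basis :: 'g set). c b *\<^sub>R W p Z t (J b)) = 0 \<Longrightarrow> b \<in> Basis \<Longrightarrow> c b = 0"
    by (rule generic_word[OF Q(1) span_Q]) (rule that)
  have "\<exists>s r. word_ok p Z J V s r"
    if V: "open V" "0 \<in> V" for V
  proof -
    obtain \<rho> where \<rho>: "\<rho> > 0" "\<And>t. (\<forall>i<p. \<bar>t i\<bar> < \<rho>) \<Longrightarrow> prd p Z t \<in> V"
      using prd_small[OF V, of p Z] by blast
    define D where "D = (\<lambda>\<eta> t. d (\<lambda>i. \<eta> i * t i)) ` signs p"
    have "\<exists>a. f a \<noteq> 0" if "f \<in> D" for f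
    proof -
      obtain \<eta> where \<eta>: "\<eta> \<in> signs p" "f = (\<lambda>t. d (\<lambda>i. \<eta> i * t i))" using \<open>f \<in> D\<close> D_def by blast
      obtain a where a: "d a \<noteq> 0" using d(2) by blast
      \<comment> \<open>Signs square to 1, so applying the pattern \<open>\<eta>\<close> to a good
        point for \<open>d\<close> gives a good point for the rescaled function.\<close>
      have "d (\<lambda>i. \<eta> i * (\<eta> i * a i)) = d a"
        using signs_values[OF \<eta>(1)] by (intro sep_polyD(2)[OF d(1)]) fastforce
      then show ?thesis using a \<eta>(2) by (intro exI[of _ "\<lambda>i. \<eta> i * a i"]) simp
    qed
    moreover have "finite D" "D \<subseteq> sep_poly p"
      unfolding D_def using finite_signs sep_poly_scale[OF d(1)] by auto
    ultimately obtain s where s: "\<And>i. \<bar>s i\<bar> < \<rho>/2" "\<And>f. f \<in> D \<Longrightarrow> f s \<noteq> 0"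
      using sep_poly_common_nonzero[of D p "\<rho>/2"] \<rho>(1) by (metis half_gt_zero)
    have "\<exists>r>0. \<forall>\<eta>\<in>signs p. \<forall>N. negligible N \<longrightarrow> negligible {u \<in> ball 0 r. word p Z J s \<eta> u \<in> N}"
    proof (rule finite_uniform_radius[OF finite_signs])
      fix \<eta> assume \<eta>: "\<eta> \<in> signs p"
      have "d (\<lambda>i. \<eta> i * s i) \<noteq> 0" using s(2) \<eta> unfolding D_def by blast
      then have "inj (frechet_derivative (word p Z J s \<eta>) (at 0))"
        using signs_values[OF \<eta>] by (intro inj_word_derivative J ind) fastforce+
      from Ck_on_1_local_diffeo_null[OF Ck_word this]
      show "\<exists>r>0. \<forall>N. negligible N \<longrightarrow> negligible {u \<in> ball 0 r. word p Z J s \<eta> u \<in> N}"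
        by metis
    next
      fix \<eta> and r r' :: real
      assume "\<forall>N. negligible N \<longrightarrow> negligible {u \<in> ball 0 r. word p Z J s \<eta> u \<in> N}" "r' \<le> r"
      note * = this
      show "\<forall>N. negligible N \<longrightarrow> negligible {u \<in> ball 0 r'. word p Z J s \<eta> u \<in> N}"
      proof (intro allI impI)
        fix N :: "'g set" assume "negligible N"
        with *(1) have "negligible {u \<in> ball 0 r. word p Z J s \<eta> u \<in> N}" by simp
        then show "negligible {u \<in> ball 0 r'. word p Z J s \<eta> u \<in> N}"
          by (rule negligible_subset) (use *(2) in auto)
      qed
    qed
    then obtain r where r: "r > 0" "\<And>\<eta> N. \<eta> \<in> signs p \<Longrightarrow> negligible N \<Longrightarrow>
        negligible {u \<in> ball 0 r. word p Z J s \<eta> u \<in> N}" by blast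
    \<comment> \<open>Each parameter moves by at most \<open>DIM('g) * norm u\<close>, which is
      below \<open>\<rho>/2\<close>; the other half of \<open>\<rho>\<close> was reserved for
      \<open>s\<close>.\<close>
    define r' where "r' = min r (\<rho> / (2 * DIM('g)))"
    have r': "r' > 0" "r' \<le> r" using r(1) \<rho>(1) by (auto simp: r'_def)
    show ?thesis
      unfolding word_ok_def
    proof (intro exI[of _ s] exI[of _ r'] conjI ballI allI impI r'(1))
      fix \<eta> and u :: 'g assume \<eta>: "\<eta> \<in> signs p" and u: "u \<in> ball 0 r'"
      have small: "\<bar>\<eta> i * coords J s u i\<bar> < \<rho>" if "i < p" for i
      proof -
        have "\<bar>\<Sum>b\<in>Basis. if J b = i then u \<bullet> b else 0\<bar> \<le> (\<Sum>b\<in>(Basis :: 'g set). norm u)"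
          by (rule order_trans[OF sum_abs], rule sum_mono) (auto simp: Basis_le_norm)
        also have "\<dots> = DIM('g) * norm u" by simp
        also have "\<dots> < \<rho>/2"
          using u by (simp add: r'_def field_simps)
        finally have "\<bar>coords J s u i\<bar> < \<rho>"
          using s(1)[of i] unfolding coords_def by linarith
        then show ?thesis using signs_values[OF \<eta> that] by (auto simp: abs_mult)
      qed
      show "word p Z J s \<eta> u \<in> V"
        by (intro \<rho>(2) allI impI small)
    next
      fix \<eta> N assume "\<eta> \<in> signs p" "negligible (N :: 'g set)"
      from r(2)[OF this] show "negligible {u \<in> ball 0 r'. word p Z J s \<eta> u \<in> N}"
        by (rule negligible_subset) (use r'(2) in auto)
    qed
  qed
  with Z show thesis using that by blast
qed

text \<open>The bound holds at almost every point of \<open>E\<close> by the walk argument; since the laws are absolutely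
  continuous, it passes to the support.\<close>

lemma support_lower_bound:
  fixes J s Z p r
  defines "\<Phi> \<equiv> word p Z J s"
  assumes E: "line_mono E" and Z: "\<forall>i<p. Z i \<in> Q"
    and null: "\<And>\<eta> N. \<eta> \<in> signs p \<Longrightarrow> negligible N \<Longrightarrow> negligible {u \<in> ball 0 r. \<Phi> \<eta> u \<in> N}"
    and x: "x \<in> msupp E"
  shows "measure lborel (ball (0::'g) r) \<le> (\<Sum>\<eta>\<in>signs p. measure lborel {u \<in> ball 0 r. x \<star> \<Phi> \<eta> u \<in> E})"
    (is "?L \<le> ?F x")
proof -
  interpret P: pair_sigma_finite \<mu> lborel ..
  have Eb: "E \<in> sets borel" using E by (rule line_mono_borel)
  have cont: "continuous_on UNIV (\<Phi> \<eta>)" for \<eta>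
    unfolding \<Phi>_def using Ck_word Ck_on_imp_continuous_on by blast
  have fm: "{u \<in> ball 0 r. x \<star> \<Phi> \<eta> u \<in> E} \<in> fmeasurable lborel" for x \<eta>
    by (rule law_fmeasurable[OF cont Eb])
  \<comment> \<open>\<open>word_stays\<close> excludes a null set of points \<open>x\<close> for
    each fixed \<open>u\<close>; Fubini exchanges the two.\<close>
  have "AE u in lborel. AE x in \<mu>. x \<in> E \<longrightarrow> (\<exists>\<eta>\<in>signs p. x \<star> \<Phi> \<eta> u \<in> E)"
    unfolding \<Phi>_def by (intro AE_I2 word_stays[OF E Z])
  moreover have "Measurable.pred (\<mu> \<Otimes>\<^sub>M lborel) (\<lambda>z. fst z \<in> E \<longrightarrow> (\<exists>\<eta>\<in>signs p. fst z \<star> \<Phi> \<eta> (snd z) \<in> E))"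
  proof (intro pred_intros_logic pred_intros_finite finite_signs pred_mul Eb)
    have f: "fst \<in> \<mu> \<Otimes>\<^sub>M lborel \<rightarrow>\<^sub>M borel"
      using measurable_fst[of \<mu> lborel] measurable_cong_sets[OF refl sets_mu] by blast
    show "fst \<in> \<mu> \<Otimes>\<^sub>M lborel \<rightarrow>\<^sub>M borel" by (rule f)
    show "Measurable.pred (\<mu> \<Otimes>\<^sub>M lborel) (\<lambda>z. fst z \<in> E)"
      by (rule pred_sets2[OF Eb f])
    show "(\<lambda>z. \<Phi> \<eta> (snd z)) \<in> \<mu> \<Otimes>\<^sub>M lborel \<rightarrow>\<^sub>M borel" for \<eta>
      by (rule measurable_compose[OF measurable_snd]) (simp add: borel_measurable_continuous_onI cont)
  qed
  ultimately have "AE x in \<mu>. AE u in lborel. x \<in> E \<longrightarrow> (\<exists>\<eta>\<in>signs p. x \<star> \<Phi> \<eta> u \<in> E)"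
    using P.AE_commute[of "\<lambda>x u. x \<in> E \<longrightarrow> (\<exists>\<eta>\<in>signs p. x \<star> \<Phi> \<eta> u \<in> E)"] unfolding pred_def by simp
  then have ae: "AE x in \<mu>. x \<in> E \<longrightarrow> ?L \<le> ?F x"
  proof eventually_elim
    case (elim x)
    show ?case
    proof
      assume "x \<in> E"
      with elim have "AE u in lborel. u \<in> ball 0 r \<longleftrightarrow> u \<in> (\<Union>\<eta>\<in>signs p. {u \<in> ball 0 r. x \<star> \<Phi> \<eta> u \<in> E})"
        by (auto elim!: eventually_mono)
      then have "?L = measure lborel (\<Union>\<eta>\<in>signs p. {u \<in> ball 0 r. x \<star> \<Phi> \<eta> u \<in> E})"
        using fmeasurableD[OF fm] by (intro measure_eq_AE sets.finite_UN finite_signs) auto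
      also have "\<dots> \<le> ?F x"
        by (intro measure_UNION_le finite_signs fmeasurableD[OF fm])
      finally show "?L \<le> ?F x" .
    qed
  qed
  show ?thesis
  proof (rule ccontr)
    assume "\<not> ?L \<le> ?F x"
    then have less: "?F x < ?L" by simp
    define m where "m = card (signs p)"
    have m: "m > 0" using finite_signs signs_nonempty by (simp add: m_def card_gt_0_iff)
    \<comment> \<open>The deficit at \<open>x\<close> is shared equally among the \<open>m\<close>
      sign patterns, so the sum of the laws remains below \<open>?L\<close> in a neighbourhood, and
      \<open>E\<close> would be null there.\<close>
    define e where "e = (?L - ?F x) / m"
    have e: "e > 0" using less m by (simp add: e_def)
    have "\<forall>\<eta>\<in>signs p. \<exists>U. open U \<and> x \<in> U \<and> (\<forall>y\<in>U. measure lborel {u \<in> ball 0 r. y \<star> \<Phi> \<eta> u \<in> E}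
           < measure lborel {u \<in> ball 0 r. x \<star> \<Phi> \<eta> u \<in> E} + e)"
      by (intro ballI law_upper_semicontinuous cont null Eb e)
    from bchoice[OF this] obtain U where U: "\<forall>\<eta>\<in>signs p. open (U \<eta>) \<and> x \<in> U \<eta> \<and> (\<forall>y\<in>U \<eta>. measure lborel {u \<in> ball 0 r. y \<star> \<Phi> \<eta> u \<in> E}
           < measure lborel {u \<in> ball 0 r. x \<star> \<Phi> \<eta> u \<in> E} + e)" ..
    define V where "V = (\<Inter>\<eta>\<in>signs p. U \<eta>)"
    have V: "open V" "x \<in> V" unfolding V_def using U finite_signs by (auto intro!: open_INT)
    have "?F y < ?L" if "y \<in> V" for y
    proof -
      have "?F y < (\<Sum>\<eta>\<in>signs p. measure lborel {u \<in> ball 0 r. x \<star> \<Phi> \<eta> u \<in> E} + e)"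
        using U that by (intro sum_strict_mono finite_signs signs_nonempty) (auto simp: V_def)
      also have "\<dots> = ?L" using m by (simp add: sum.distrib m_def[symmetric] e_def)
      finally show ?thesis .
    qed
    then have "AE y in \<mu>. y \<notin> E \<inter> V"
      using ae by (auto elim!: eventually_mono simp: not_le[symmetric])
    then have "emeasure \<mu> (E \<inter> V) = 0"
      using Eb V(1) by (subst (asm) AE_iff_null_sets[symmetric]) (auto simp: sets_mu)
    with x V show False by (auto simp: msupp_def)
  qed
qed

lemma closed_msupp: "closed (msupp S)"
  unfolding msupp_eq using open_mint by (rule closed_Compl)

text \<open>On a compact subset \<open>K\<close> of the boundary inside \<open>E\<close>, a definite proportion of all short walks ends
  outside \<open>E\<close>, whereas most translates of \<open>K\<close> by small elements overlap \<open>K\<close>, which lies in \<open>E\<close>.\<close>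

lemma boundary_null_half:
  assumes E: "line_mono E"
  shows "emeasure \<mu> (msupp E \<inter> msupp (- E) \<inter> E) = 0"
proof (rule ccontr)
  define D where "D = msupp E \<inter> msupp (- E) \<inter> E"
  have Eb: "E \<in> sets borel" using E by (rule line_mono_borel)
  have Db: "D \<in> sets borel" unfolding D_def by (intro sets.Int Eb borel_closed[OF closed_msupp])
  assume "emeasure \<mu> (msupp E \<inter> msupp (- E) \<inter> E) \<noteq> 0"
  then have D: "emeasure \<mu> D \<noteq> 0" by (simp add: D_def)
  have "\<exists>n::nat. emeasure \<mu> (D \<inter> cball 0 (real n)) \<noteq> 0"
  proof (rule ccontr)
    assume neg: "\<not> ?thesis"
    have "D = (\<Union>n::nat. D \<inter> cball 0 (real n))" using real_arch_simple by auto
    moreover have "emeasure \<mu> (\<Union>n::nat. D \<inter> cball 0 (real n)) = 0"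
      using neg Db by (intro emeasure_UN_eq_0) (auto simp: sets_mu)
    ultimately show False using D by simp
  qed
  then obtain n :: nat where n: "emeasure \<mu> (D \<inter> cball 0 (real n)) \<noteq> 0" by blast
  define S where "S = D \<inter> cball 0 (real n)"
  have Sb: "S \<in> sets borel" "bounded S" using Db by (auto simp: S_def)
  have "emeasure \<mu> S \<le> emeasure \<mu> (cball 0 (real n))"
    by (rule emeasure_mono) (auto simp: S_def sets_mu)
  then have Sfin: "emeasure \<mu> S \<noteq> \<infinity>"
    using fin_compact[OF compact_cball, of "0::'g" "real n"] by (auto simp: top_unique)
  then have Sm: "emeasure \<mu> S = ennreal (measure \<mu> S)"
    by (simp add: emeasure_eq_ennreal_measure)
  then have S0: "0 < measure \<mu> S"
    using n by (metis S_def ennreal_0 zero_less_measure_iff)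
  obtain K U where KU: "compact K" "open U" "K \<subseteq> S" "S \<subseteq> U" "emeasure \<mu> (U - K) < measure \<mu> S"
    by (rule borel_measure_regular[OF sets_mu fin_compact Sb S0])
  have Kb: "K \<in> sets borel" using KU(1) by (simp add: compact_imp_closed)
  have "emeasure \<mu> S \<le> emeasure \<mu> (K \<union> (U - K))"
    using KU Kb by (intro emeasure_mono) (auto simp: sets_mu)
  also have "\<dots> \<le> emeasure \<mu> K + emeasure \<mu> (U - K)"
    using KU Kb by (intro emeasure_subadditive) (auto simp: sets_mu)
  finally have "emeasure \<mu> K \<noteq> 0" using KU(5) Sm by auto
  define k where "k = measure \<mu> K"
  have Kk: "emeasure \<mu> K = ennreal k"
    unfolding k_def using fin_compact[OF KU(1)] by (simp add: emeasure_eq_ennreal_measure)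
  have k: "k > 0" using \<open>emeasure \<mu> K \<noteq> 0\<close> Kk by (metis ennreal_0 k_def zero_less_measure_iff)
  obtain p Z J where Z: "\<forall>i<p. Z i \<in> Q" and
    gw: "\<forall>V. open V \<longrightarrow> 0 \<in> V \<longrightarrow> (\<exists>s r. word_ok p Z J V s r)"
    by (rule good_word)
  define m where "m = card (signs p)"
  have m: "m > 0" using finite_signs signs_nonempty by (simp add: m_def card_gt_0_iff)
  \<comment> \<open>Comparing the two counts of walks from \<open>K\<close> to \<open>E\<close>
    below gives \<open>m * (k - \<epsilon>) \<le> (m - 1) * k\<close>, that is
    \<open>k \<le> m * \<epsilon>\<close>; this value of \<open>\<epsilon>\<close> makes the
    right-hand side \<open>k / 2\<close>.\<close>
  define \<epsilon> where "\<epsilon> = k / (2 * real m)"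
  have \<epsilon>: "\<epsilon> > 0" using k m by (simp add: \<epsilon>_def)
  have \<epsilon>k: "\<epsilon> \<le> k" using k m by (simp add: \<epsilon>_def field_simps)
  obtain V where V: "open V" "0 \<in> V" "\<forall>g\<in>V. emeasure \<mu> K \<le> emeasure \<mu> {x \<in> K. x \<star> g \<in> K} + ennreal \<epsilon>"
    using translate_overlap[OF KU(1) \<epsilon>] by blast
  obtain s r where r: "0 < r" and sr: "\<forall>\<eta>\<in>signs p.
       (\<forall>u\<in>ball 0 r. word p Z J s \<eta> u \<in> V) \<and>
       (\<forall>N. negligible N \<longrightarrow> negligible {u \<in> ball 0 r. word p Z J s \<eta> u \<in> N})"
    using gw V(1,2) unfolding word_ok_def by blast
  define \<Phi> where "\<Phi> = word p Z J s"
  have \<Phi>V: "\<Phi> \<eta> u \<in> V" if "\<eta> \<in> signs p" "u \<in> ball 0 r" for \<eta> u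
    using sr that by (simp add: \<Phi>_def)
  have null: "negligible {u \<in> ball 0 r. \<Phi> \<eta> u \<in> N}" if "\<eta> \<in> signs p" "negligible N" for \<eta> N
    using sr that by (simp add: \<Phi>_def)
  have cont: "continuous_on UNIV (\<Phi> \<eta>)" for \<eta>
    unfolding \<Phi>_def using Ck_word Ck_on_imp_continuous_on by blast
  define L where "L = measure lborel (ball (0::'g) r)"
  have Lfm: "ball (0::'g) r \<in> fmeasurable lborel"
    using emeasure_lborel_ball_finite[of "0::'g" r] by (intro fmeasurableI) auto
  have Le: "emeasure lborel (ball (0::'g) r) = ennreal L"
    unfolding L_def using Lfm by (simp add: emeasure_eq_measure2)
  have "0 < L"
    unfolding L_def using r content_ball_pos[of r "0::'g"] by (simp add: measure_completion)
  define \<kappa> where "\<kappa> = (\<lambda>\<eta> x S. measure lborel {u \<in> ball 0 r. x \<star> \<Phi> \<eta> u \<in> S})"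
  have fm: "{u \<in> ball 0 r. x \<star> \<Phi> \<eta> u \<in> S} \<in> fmeasurable lborel" if "S \<in> sets borel" for x \<eta> S
    by (rule law_fmeasurable[OF cont that])
  have \<kappa>_add: "\<kappa> \<eta> x E + \<kappa> \<eta> x (- E) = L" for \<eta> x
  proof -
    have "L = measure lborel ({u \<in> ball 0 r. x \<star> \<Phi> \<eta> u \<in> E} \<union> {u \<in> ball 0 r. x \<star> \<Phi> \<eta> u \<in> - E})"
      unfolding L_def by (rule arg_cong[where f = "measure lborel"]) auto
    also have "\<dots> = \<kappa> \<eta> x E + \<kappa> \<eta> x (- E)"
      unfolding \<kappa>_def using fmeasurableD[OF fm[OF Eb]] fmeasurableD[OF fm[OF borel_comp[OF Eb]]]
        fmeasurableD2[OF fm[OF Eb]] fmeasurableD2[OF fm[OF borel_comp[OF Eb]]]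
      by (intro measure_Union) (simp_all only: infinity_ennreal_def, auto)
    finally show ?thesis by simp
  qed
  \<comment> \<open>Walks ending outside \<open>E\<close> have total mass at least \<open>L\<close>,
    since \<open>x\<close> is in the support of the complement, out of a mass \<open>m * L\<close>
    over all sign patterns.\<close>
  have upper: "(\<Sum>\<eta>\<in>signs p. \<kappa> \<eta> x E) \<le> (real m - 1) * L" if x: "x \<in> K" for x
  proof -
    have "x \<in> msupp (- E)" using x KU(3) by (auto simp: S_def D_def)
    from support_lower_bound[OF line_mono_compl[OF E] Z null[unfolded \<Phi>_def] this]
    have "L \<le> (\<Sum>\<eta>\<in>signs p. \<kappa> \<eta> x (- E))"
      by (simp add: L_def \<kappa>_def \<Phi>_def)
    moreover have "(\<Sum>\<eta>\<in>signs p. \<kappa> \<eta> x E) + (\<Sum>\<eta>\<in>signs p. \<kappa> \<eta> x (- E)) = real m * L"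
      by (simp add: sum.distrib[symmetric] \<kappa>_add m_def)
    ultimately show ?thesis by (simp add: algebra_simps)
  qed
  interpret P: pair_sigma_finite \<mu> lborel ..
  define G where "G = (\<lambda>\<eta>. {z. fst z \<in> K \<and> snd z \<in> ball 0 r \<and> fst z \<star> \<Phi> \<eta> (snd z) \<in> E})"
  have Gm: "G \<eta> \<in> sets (\<mu> \<Otimes>\<^sub>M lborel)" for \<eta>
  proof -
    have f: "fst \<in> \<mu> \<Otimes>\<^sub>M lborel \<rightarrow>\<^sub>M borel"
      using measurable_fst[of \<mu> lborel] measurable_cong_sets[OF refl sets_mu] by blast
    have g: "snd \<in> \<mu> \<Otimes>\<^sub>M lborel \<rightarrow>\<^sub>M borel" by simp
    have "(\<lambda>z. \<Phi> \<eta> (snd z)) \<in> \<mu> \<Otimes>\<^sub>M lborel \<rightarrow>\<^sub>M borel"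
      by (rule measurable_compose[OF measurable_snd]) (simp add: borel_measurable_continuous_onI cont)
    then have "Measurable.pred (\<mu> \<Otimes>\<^sub>M lborel) (\<lambda>z. fst z \<in> K \<and> snd z \<in> ball 0 r \<and> fst z \<star> \<Phi> \<eta> (snd z) \<in> E)"
      by (intro pred_intros_logic pred_mul Eb f pred_sets2[OF Kb f] pred_sets2[OF _ g]) auto
    then show ?thesis by (simp add: pred_def G_def space_pair_measure)
  qed
  have fibre: "emeasure lborel (Pair x -` G \<eta>) = ennreal (\<kappa> \<eta> x E) * indicator K x" for \<eta> x
  proof (cases "x \<in> K")
    case True
    then have "Pair x -` G \<eta> = {u \<in> ball 0 r. x \<star> \<Phi> \<eta> u \<in> E}" by (auto simp: G_def)
    then show ?thesis using True fm[OF Eb, of x \<eta>] by (simp add: \<kappa>_def emeasure_eq_measure2)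
  qed (simp add: G_def)
  have Gx: "emeasure (\<mu> \<Otimes>\<^sub>M lborel) (G \<eta>) = (\<integral>\<^sup>+x. ennreal (\<kappa> \<eta> x E) * indicator K x \<partial>\<mu>)" for \<eta>
    unfolding fibre[symmetric] by (rule lborel.emeasure_pair_measure_alt[OF Gm])
  have Gu: "ennreal ((k - \<epsilon>) * L) \<le> emeasure (\<mu> \<Otimes>\<^sub>M lborel) (G \<eta>)" if \<eta>: "\<eta> \<in> signs p" for \<eta>
  proof -
    \<comment> \<open>For a fixed displacement, the points of \<open>K\<close> that return to
      \<open>K\<close> are counted, which is a subset of \<open>E\<close>; integration over
      \<open>u\<close> gives the lower bound.\<close>
    have le: "ennreal (k - \<epsilon>) * indicator (ball 0 r) u \<le> emeasure \<mu> ((\<lambda>x. (x, u)) -` G \<eta>)" for u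
    proof (cases "u \<in> ball 0 r")
      case True
      have "ennreal k \<le> emeasure \<mu> {x \<in> K. x \<star> \<Phi> \<eta> u \<in> K} + ennreal \<epsilon>"
        using V(3) \<Phi>V[OF \<eta> True] Kk by auto
      then have "ennreal k - ennreal \<epsilon> \<le> emeasure \<mu> {x \<in> K. x \<star> \<Phi> \<eta> u \<in> K}"
        by (simp add: ennreal_minus_le_iff add.commute)
      also have "\<dots> \<le> emeasure \<mu> ((\<lambda>x. (x, u)) -` G \<eta>)"
      proof (rule emeasure_mono)
        show "{x \<in> K. x \<star> \<Phi> \<eta> u \<in> K} \<subseteq> (\<lambda>x. (x, u)) -` G \<eta>"
          using KU(3) True by (auto simp: G_def S_def D_def)
        show "(\<lambda>x. (x, u)) -` G \<eta> \<in> sets \<mu>" by (rule sets_Pair2[OF Gm])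
      qed
      finally show ?thesis using True \<epsilon> by (simp add: ennreal_minus)
    qed simp
    have "(\<integral>\<^sup>+u. ennreal (k - \<epsilon>) * indicator (ball (0::'g) r) u \<partial>lborel) \<le> (\<integral>\<^sup>+u. emeasure \<mu> ((\<lambda>x. (x, u)) -` G \<eta>) \<partial>lborel)"
      by (intro nn_integral_mono le)
    also have "\<dots> = emeasure (\<mu> \<Otimes>\<^sub>M lborel) (G \<eta>)"
      by (rule P.emeasure_pair_measure_alt2[OF Gm, symmetric])
    finally have "(\<integral>\<^sup>+u. ennreal (k - \<epsilon>) * indicator (ball (0::'g) r) u \<partial>lborel) \<le> emeasure (\<mu> \<Otimes>\<^sub>M lborel) (G \<eta>)" .
    moreover have "(\<integral>\<^sup>+u. ennreal (k - \<epsilon>) * indicator (ball (0::'g) r) u \<partial>lborel) = ennreal (k - \<epsilon>) * ennreal L"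
      by (subst nn_integral_cmult_indicator) (simp_all add: Le)
    moreover have "ennreal ((k - \<epsilon>) * L) = ennreal (k - \<epsilon>) * ennreal L"
      using \<epsilon>k \<open>0 < L\<close> by (intro ennreal_mult) auto
    ultimately show ?thesis by simp
  qed
  have mble: "(\<lambda>x. ennreal (\<kappa> \<eta> x E) * indicator K x) \<in> borel_measurable \<mu>" for \<eta>
    unfolding fibre[symmetric] by (rule lborel.measurable_emeasure_Pair[OF Gm])
  have "ennreal (real m * ((k - \<epsilon>) * L)) = (\<Sum>\<eta>\<in>signs p. ennreal ((k - \<epsilon>) * L))"
    using \<epsilon>k \<open>0 < L\<close> by (simp add: m_def ennreal_mult ennreal_of_nat_eq_real_of_nat)
  also have "\<dots> \<le> (\<Sum>\<eta>\<in>signs p. emeasure (\<mu> \<Otimes>\<^sub>M lborel) (G \<eta>))"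
    by (intro sum_mono Gu)
  also have "\<dots> = (\<integral>\<^sup>+x. (\<Sum>\<eta>\<in>signs p. ennreal (\<kappa> \<eta> x E) * indicator K x) \<partial>\<mu>)"
    unfolding Gx by (rule nn_integral_sum[symmetric]) (rule mble)
  also have "\<dots> \<le> (\<integral>\<^sup>+x. ennreal ((real m - 1) * L) * indicator K x \<partial>\<mu>)"
  proof (intro nn_integral_mono)
    fix x
    show "(\<Sum>\<eta>\<in>signs p. ennreal (\<kappa> \<eta> x E) * indicator K x) \<le> ennreal ((real m - 1) * L) * indicator K x"
    proof (cases "x \<in> K")
      case True
      have "(\<Sum>\<eta>\<in>signs p. ennreal (\<kappa> \<eta> x E)) = ennreal (\<Sum>\<eta>\<in>signs p. \<kappa> \<eta> x E)"
        by (rule sum_ennreal) (simp add: \<kappa>_def)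
      then show ?thesis using True upper[OF True] by (simp add: ennreal_leI)
    qed simp
  qed
  also have "\<dots> = ennreal ((real m - 1) * L * k)"
    using Kb \<open>0 < L\<close> m k by (simp add: nn_integral_cmult_indicator sets_mu Kk ennreal_mult)
  finally have "real m * ((k - \<epsilon>) * L) \<le> (real m - 1) * L * k"
    using m \<open>0 < L\<close> k by (subst (asm) ennreal_le_iff) auto
  then have "(real m * (k - \<epsilon>)) * L \<le> ((real m - 1) * k) * L" by (simp add: algebra_simps)
  then have "real m * (k - \<epsilon>) \<le> (real m - 1) * k" using \<open>0 < L\<close> by simp
  then have "k \<le> real m * \<epsilon>" by (simp add: algebra_simps)
  also have "real m * \<epsilon> = k / 2" using m by (simp add: \<epsilon>_def)
  finally show False using k by simp
qed

lemma AE_mint_or: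
  assumes E: "line_mono E"
  shows "AE x in \<mu>. x \<in> mint E \<or> x \<in> mint (- E)"
proof -
  have Eb: "E \<in> sets borel" using E by (rule line_mono_borel)
  have b: "msupp E \<inter> msupp (- E) \<inter> E \<in> sets \<mu>" "msupp (- E) \<inter> msupp E \<inter> - E \<in> sets \<mu>"
    using Eb closed_msupp by (auto simp: sets_mu)
  have "AE x in \<mu>. x \<notin> msupp E \<inter> msupp (- E) \<inter> E" "AE x in \<mu>. x \<notin> msupp (- E) \<inter> msupp E \<inter> - E"
    using boundary_null_half[OF E] boundary_null_half[OF line_mono_compl[OF E]] b
    by (subst AE_iff_null_sets[symmetric]; auto simp: null_sets_def)+
  then show ?thesis by eventually_elim (auto simp: msupp_eq)
qed

end

section \<open>Precise monotonicity\<close>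

context carnot_monotone
begin

text \<open>Near the claimed point there is no point of \<open>mint E\<close>, since
  \<open>mint_convex\<close> would then put a point of \<open>mint (- E)\<close> into
  \<open>mint E\<close>. As the boundary is null, an open set without points of
  \<open>mint E\<close> lies almost everywhere in the complement of \<open>E\<close>.\<close>

lemma mint_beyond:
  assumes E: "line_mono E" and X: "X \<in> V1" and r: "0 < r" and s: "0 < s"
    and x: "x \<in> mint E" "x \<star> (r *\<^sub>R X) \<in> mint (- E)"
  shows "x \<star> ((r + s) *\<^sub>R X) \<in> mint (- E)"
proof -
  have Eb: "E \<in> sets borel" using E by (rule line_mono_borel)
  define V where "V = (\<lambda>v. v \<star> (- (r + s)) *\<^sub>R X) -` mint E \<inter> (\<lambda>v. v \<star> (- s) *\<^sub>R X) -` mint (- E)"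
  have "open V"
    unfolding V_def by (intro open_Int open_vimage open_mint continuous_on_mul continuous_on_id continuous_on_const)
  moreover have "x \<star> ((r + s) *\<^sub>R X) \<in> V"
    using x by (simp only: V_def Int_iff vimage_eq assoc one_param) simp
  moreover have "v \<notin> mint E" if v: "v \<in> V" for v
  proof
    assume "v \<in> mint E"
    then have "(v \<star> (- (r + s)) *\<^sub>R X) \<star> ((r + s) *\<^sub>R X) \<in> mint E"
      by (simp only: assoc one_param) simp
    moreover have "v \<star> (- (r + s)) *\<^sub>R X \<in> mint E" using v by (simp only: V_def Int_iff vimage_eq)
    ultimately have "(v \<star> (- (r + s)) *\<^sub>R X) \<star> (r *\<^sub>R X) \<in> mint E"
      by (intro mint_convex[OF E X r s])
    then have "v \<star> ((- s) *\<^sub>R X) \<in> mint E"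
      by (simp only: assoc one_param) simp
    moreover have "v \<star> ((- s) *\<^sub>R X) \<in> mint (- E)" using v by (simp add: V_def)
    ultimately show False using mint_disjoint[OF Eb] by blast
  qed
  moreover have "AE v in \<mu>. v \<notin> mint E \<longrightarrow> v \<in> - E"
    using AE_mint_or[OF E] AE_mint[OF borel_comp[OF Eb]] by eventually_elim auto
  then have "AE v in \<mu>. v \<in> V \<longrightarrow> v \<in> - E"
    by eventually_elim (use calculation(3) in auto)
  ultimately show ?thesis
    using AE_imp_mint[OF _ _ borel_comp[OF Eb]] by blast
qed

lemma walk_continuous:
  assumes "open O'" "x \<star> (real k *\<^sub>R X) \<in> O'"
  shows "\<exists>N \<delta>. open N \<and> x \<in> N \<and> 0 < \<delta> \<and>
    (\<forall>x'\<in>N. \<forall>Xs. (\<forall>i<k. dist (Xs i) X < \<delta>) \<longrightarrow> x' \<star> prd k Xs (\<lambda>_. 1) \<in> O')"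
  using assms
proof (induction k arbitrary: O')
  case 0
  then show ?case by (intro exI[of _ O'] exI[of _ 1]) auto
next
  case (Suc k)
  have "continuous_on UNIV (\<lambda>z. fst z \<star> snd z)" by (rule continuous_mul)
  then have "open ((\<lambda>z. fst z \<star> snd z) -` O')" by (rule open_vimage[OF Suc.prems(1)])
  moreover have "(x \<star> (real k *\<^sub>R X), X) \<in> (\<lambda>z. fst z \<star> snd z) -` O'"
    using Suc.prems(2) one_param[of "real k" X 1] by (simp add: assoc add.commute)
  ultimately obtain A B where AB: "open A" "open B" "x \<star> (real k *\<^sub>R X) \<in> A" "X \<in> B" "A \<times> B \<subseteq> (\<lambda>z. fst z \<star> snd z) -` O'"
    by (rule open_prod_elim) auto
  obtain N \<delta> where N: "open N" "x \<in> N" "0 < \<delta>"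
    "\<forall>x'\<in>N. \<forall>Xs. (\<forall>i<k. dist (Xs i) X < \<delta>) \<longrightarrow> x' \<star> prd k Xs (\<lambda>_. 1) \<in> A"
    using Suc.IH[OF AB(1,3)] by blast
  obtain \<delta>' where \<delta>': "0 < \<delta>'" "ball X \<delta>' \<subseteq> B" using AB(2,4) open_contains_ball by blast
  have "x' \<star> prd (Suc k) Xs (\<lambda>_. 1) \<in> O'" if "x' \<in> N" "\<forall>i<Suc k. dist (Xs i) X < min \<delta> \<delta>'" for x' Xs
  proof -
    have "x' \<star> prd k Xs (\<lambda>_. 1) \<in> A" using N(4) that by simp
    moreover have "Xs k \<in> B" using \<delta>'(2) that(2) by (auto simp: subset_iff dist_commute)
    ultimately show ?thesis using AB(5) by (auto simp: assoc)
  qed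
  then show ?case using N(1-3) \<delta>'(1) by (intro exI[of _ N] exI[of _ "min \<delta> \<delta>'"]) auto
qed

text \<open>From a point of the interior near \<open>x\<close>, walk backwards in directions close to \<open>- X\<close>. Each point
  of the walk lies in the interior of \<open>E\<close>, since the line through it in the direction of the next step
  meets the interior of the complement near \<open>x \<star> X\<close>. Openness makes the reached set uniformly large.\<close>

lemma mint_backward:
  assumes E: "line_mono E" and X: "X \<in> V1" "X \<noteq> 0" and x: "x \<in> msupp E" "x \<star> X \<in> mint (- E)"
  shows "\<exists>p::nat. p \<ge> 1 \<and> x \<star> (real p *\<^sub>R (- X)) \<in> mint E"
proof -
  have Eb: "E \<in> sets borel" using E by (rule line_mono_borel)
  have X': "- X \<in> V1" "- X \<noteq> 0" using X subspace_neg[OF subspace_V1] by auto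
  obtain p where p: "p \<ge> 1" "\<forall>\<delta>>0. \<exists>U. open U \<and> real p *\<^sub>R (- X) \<in> U \<and> U \<subseteq> reach p (- X) \<delta>"
    using openness[OF X'] by blast
  \<comment> \<open>Pairs of a point and a direction such that \<open>k + 1\<close> steps back lead
    into \<open>mint (- E)\<close>. From \<open>x \<star> (real k *\<^sub>R (- X))\<close> with
    direction \<open>- X\<close> they lead to \<open>x \<star> X\<close>, so \<open>G k\<close> is a
    neighbourhood of this pair.\<close>
  define G where "G = (\<lambda>k::nat. (\<lambda>z. fst z \<star> ((- real (k + 1)) *\<^sub>R snd z)) -` mint (- E))"
  have "\<exists>N \<delta>. open N \<and> x \<in> N \<and> 0 < \<delta> \<and> (\<forall>x'\<in>N. \<forall>Xs. (\<forall>i\<le>k. dist (Xs i) (- X) < \<delta>) \<longrightarrow> (x' \<star> prd k Xs (\<lambda>_. 1), Xs k) \<in> G k)" for k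
  proof -
    have "open (G k)"
      unfolding G_def by (intro open_vimage open_mint continuous_on_mul continuous_intros)
    moreover have "(x \<star> (real k *\<^sub>R (- X)), - X) \<in> G k"
    proof -
      have "x \<star> (real k *\<^sub>R (- X)) \<star> ((- real (k + 1)) *\<^sub>R (- X)) = x \<star> X"
        unfolding assoc one_param by (simp add: scaleR_left_distrib scaleR_diff_left)
      then show ?thesis using x(2) by (simp only: G_def vimage_eq fst_conv snd_conv)
    qed
    ultimately obtain A B where AB: "open A" "open B" "x \<star> (real k *\<^sub>R (- X)) \<in> A" "- X \<in> B" "A \<times> B \<subseteq> G k"
      by (rule open_prod_elim) auto
    obtain N \<delta> where N: "open N" "x \<in> N" "0 < \<delta>"
      "\<forall>x'\<in>N. \<forall>Xs. (\<forall>i<k. dist (Xs i) (- X) < \<delta>) \<longrightarrow> x' \<star> prd k Xs (\<lambda>_. 1) \<in> A"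
      using walk_continuous[OF AB(1,3)] by blast
    obtain \<delta>' where \<delta>': "0 < \<delta>'" "ball (- X) \<delta>' \<subseteq> B" using AB(2,4) open_contains_ball by blast
    have "(x' \<star> prd k Xs (\<lambda>_. 1), Xs k) \<in> G k" if "x' \<in> N" "\<forall>i\<le>k. dist (Xs i) (- X) < min \<delta> \<delta>'" for x' Xs
    proof -
      have "x' \<star> prd k Xs (\<lambda>_. 1) \<in> A" using N(4) that by simp
      moreover have "Xs k \<in> ball (- X) \<delta>'" using that(2) by (simp add: dist_commute)
      ultimately show ?thesis using AB(5) \<delta>'(2) by blast
    qed
    then show ?thesis using N(1-3) \<delta>'(1) by (intro exI[of _ N] exI[of _ "min \<delta> \<delta>'"]) auto
  qed
  then have "\<forall>k. \<exists>c. open (fst c) \<and> x \<in> fst c \<and> 0 < snd c \<and> (\<forall>x'\<in>fst c. \<forall>Xs. (\<forall>i\<le>k. dist (Xs i) (- X) < snd c) \<longrightarrow> (x' \<star> prd k Xs (\<lambda>_. 1), Xs k) \<in> G k)"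
    by simp
  from choice[OF this] obtain c where c: "\<forall>k. open (fst (c k)) \<and> x \<in> fst (c k) \<and> 0 < snd (c k) \<and>
     (\<forall>x'\<in>fst (c k). \<forall>Xs. (\<forall>i\<le>k. dist (Xs i) (- X) < snd (c k)) \<longrightarrow> (x' \<star> prd k Xs (\<lambda>_. 1), Xs k) \<in> G k)" ..
  define N where "N = (\<Inter>k<p. fst (c k))"
  define \<delta> where "\<delta> = Min ((\<lambda>k. snd (c k)) ` {..<p})"
  have N: "open N" "x \<in> N" unfolding N_def using c by (auto intro!: open_INT)
  have ne: "(\<lambda>k. snd (c k)) ` {..<p} \<noteq> {}" using p(1) by (auto simp: lessThan_empty_iff)
  have \<delta>: "0 < \<delta>" "\<And>k. k < p \<Longrightarrow> \<delta> \<le> snd (c k)"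
    unfolding \<delta>_def using c p(1) ne by (auto simp: Min_gr_iff)
  have walk: "x' \<star> prd k Xs (\<lambda>_. 1) \<in> mint E"
    if x': "x' \<in> N" "x' \<in> mint E" and Xs: "\<forall>i<p. Xs i \<in> V1 \<and> dist (Xs i) (- X) < \<delta>" and "k \<le> p" for x' Xs k
    using \<open>k \<le> p\<close>
  proof (induction k)
    case (Suc k)
    let ?y = "x' \<star> prd k Xs (\<lambda>_. 1)" and ?Y = "Xs k"
    \<comment> \<open>\<open>mint_beyond\<close> is used with \<open>E\<close> and its complement
      exchanged: starting \<open>k + 1\<close> steps behind in \<open>mint (- E)\<close>, passing
      \<open>?y\<close> in \<open>mint E\<close>, and arriving one step further.\<close>
    have y: "?y \<in> mint (- (- E))" using Suc by simp
    have "(?y, ?Y) \<in> G k"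
    proof -
      have "x' \<in> fst (c k)" using x'(1) Suc.prems by (auto simp: N_def)
      moreover have "\<forall>i\<le>k. dist (Xs i) (- X) < snd (c k)"
        using Xs \<delta>(2)[of k] Suc.prems by (meson le_less_trans less_le_trans Suc_le_eq)
      ultimately show ?thesis using c by blast
    qed
    then have b: "?y \<star> ((- real (k + 1)) *\<^sub>R ?Y) \<in> mint (- E)" by (simp only: G_def vimage_eq fst_conv snd_conv)
    have "?y \<star> ((- real (k + 1)) *\<^sub>R ?Y) \<star> (real (k + 1) *\<^sub>R ?Y) \<in> mint (- (- E))"
      unfolding assoc one_param using y by simp
    from mint_beyond[OF line_mono_compl[OF E] _ _ zero_less_one b this]
    have "?y \<star> ((- real (k + 1)) *\<^sub>R ?Y) \<star> ((real (k + 1) + 1) *\<^sub>R ?Y) \<in> mint E"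
      using Xs Suc.prems by simp
    then show ?case unfolding assoc one_param by (simp add: algebra_simps assoc)
  qed (use x' in simp)
  obtain U where U: "open U" "real p *\<^sub>R (- X) \<in> U" "U \<subseteq> reach p (- X) \<delta>" using p(2) \<delta>(1) by blast
  \<comment> \<open>Starting points \<open>y\<close> from which the target is reached by a
    displacement in \<open>U\<close>. For \<open>y = x\<close> this displacement is
    \<open>real p *\<^sub>R (- X)\<close>, so \<open>x\<close> itself qualifies.\<close>
  define N' where "N' = N \<inter> (\<lambda>y. (- y) \<star> (x \<star> (real p *\<^sub>R (- X)))) -` U"
  have N': "open N'" "x \<in> N'"
    unfolding N'_def using N U(1,2)
    by (auto intro!: open_Int open_vimage continuous_on_mul continuous_intros)
  \<comment> \<open>\<open>E\<close> has positive measure in every neighbourhood of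
    \<open>x\<close>, and almost all of \<open>E\<close> lies in \<open>mint E\<close> because the
    boundary is null.\<close>
  have "\<exists>y. y \<in> N' \<inter> mint E"
  proof (rule ccontr)
    assume neg: "\<not> ?thesis"
    have "AE y in \<mu>. y \<notin> E \<inter> N'"
      using AE_mint_or[OF E] AE_mint[OF borel_comp[OF Eb]]
    proof eventually_elim
      case (elim y)
      with neg show ?case by blast
    qed
    then have "emeasure \<mu> (E \<inter> N') = 0"
      using Eb N'(1) by (subst (asm) AE_iff_null_sets[symmetric]) (auto simp: sets_mu)
    with x(1) N' show False by (auto simp: msupp_def)
  qed
  then obtain y where y: "y \<in> N" "y \<in> mint E" "(- y) \<star> (x \<star> (real p *\<^sub>R (- X))) \<in> reach p (- X) \<delta>"
    using U(3) by (auto simp: N'_def)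
  then obtain Xs where Xs: "\<forall>i<p. Xs i \<in> V1 \<and> dist (Xs i) (- X) < \<delta>"
    "(- y) \<star> (x \<star> (real p *\<^sub>R (- X))) = prd p Xs (\<lambda>_. 1)"
    unfolding reach_def by blast
  have "y \<star> prd p Xs (\<lambda>_. 1) \<in> mint E" by (rule walk[OF y(1,2) Xs(1) order_refl])
  then have "x \<star> (real p *\<^sub>R (- X)) \<in> mint E" unfolding Xs(2)[symmetric] by simp
  with p(1) show ?thesis by blast
qed

text \<open>\<open>mint_backward\<close> supplies a point of \<open>mint E\<close> on the same line
  behind \<open>x\<close>, and \<open>mint_beyond\<close> starts from there.\<close>

lemma msupp_beyond:
  assumes E: "line_mono E" and X: "X \<in> V1" "X \<noteq> 0" and r: "0 < r" and s: "0 < s"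
    and x: "x \<in> msupp E" "x \<star> (r *\<^sub>R X) \<in> mint (- E)"
  shows "x \<star> ((r + s) *\<^sub>R X) \<in> mint (- E)"
proof -
  have rX: "r *\<^sub>R X \<in> V1" "r *\<^sub>R X \<noteq> 0" using X r subspace_scale[OF subspace_V1] by auto
  obtain p :: nat where p: "p \<ge> 1" "x \<star> (real p *\<^sub>R (- (r *\<^sub>R X))) \<in> mint E"
    using mint_backward[OF E rX x] by blast
  have eq: "real p *\<^sub>R (- (r *\<^sub>R X)) = (- (p * r)) *\<^sub>R X" by simp
  have "x \<star> ((- (p * r)) *\<^sub>R X) \<star> ((p * r + r) *\<^sub>R X) \<in> mint (- E)"
    using x(2) by (simp only: assoc one_param) simp
  moreover have "0 < real p * r + r" using p(1) r by (intro add_nonneg_pos) auto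
  ultimately have "x \<star> ((- (p * r)) *\<^sub>R X) \<star> ((p * r + r + s) *\<^sub>R X) \<in> mint (- E)"
    using p(2) unfolding eq by (intro mint_beyond[OF E X(1) _ s]) auto
  then show ?thesis by (simp only: assoc one_param) simp
qed

definition line_convex :: "'g set \<Rightarrow> bool" where
  "line_convex S \<longleftrightarrow> (\<forall>X\<in>V1 - {0}. \<forall>x r s. 0 < r \<longrightarrow> 0 < s \<longrightarrow> x \<in> S \<longrightarrow> x \<star> ((r + s) *\<^sub>R X) \<in> S \<longrightarrow> x \<star> (r *\<^sub>R X) \<in> S)"

lemma line_convexD:
  assumes "line_convex S" "X \<in> V1 - {0}" "0 < r" "0 < s" "x \<in> S" "x \<star> ((r + s) *\<^sub>R X) \<in> S"
  shows "x \<star> (r *\<^sub>R X) \<in> S"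
  by (rule assms(1)[unfolded line_convex_def, THEN bspec, THEN spec, THEN spec, THEN spec,
        THEN mp, THEN mp, THEN mp, THEN mp, OF assms(2-6)])

lemma line_convex_mint: "line_mono E \<Longrightarrow> line_convex (mint E)"
  unfolding line_convex_def using mint_convex by blast

lemma line_convex_msupp:
  assumes E: "line_mono E"
  shows "line_convex (msupp E)"
  unfolding line_convex_def
proof (intro ballI allI impI)
  fix X x and r s :: real
  assume a: "X \<in> V1 - {0}" "0 < r" "0 < s" "x \<in> msupp E" "x \<star> ((r + s) *\<^sub>R X) \<in> msupp E"
  show "x \<star> (r *\<^sub>R X) \<in> msupp E"
    using msupp_beyond[OF E _ _ a(2,3,4)] a(1,5) unfolding msupp_eq by blast
qed

theorem line_mono_representatives:
  assumes E: "line_mono E"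
  shows "line_convex (mint E)" "line_convex (- mint E)" "line_convex (msupp E)" "line_convex (- msupp E)"
    and "AE x in \<mu>. x \<in> mint E \<longleftrightarrow> x \<in> E" "AE x in \<mu>. x \<in> msupp E \<longleftrightarrow> x \<in> E"
proof -
  have Eb: "E \<in> sets borel" using E by (rule line_mono_borel)
  note C = line_mono_compl[OF E]
  show "line_convex (mint E)" "line_convex (msupp E)"
    using line_convex_mint[OF E] line_convex_msupp[OF E] .
  show "line_convex (- mint E)" "line_convex (- msupp E)"
    using line_convex_msupp[OF C] line_convex_mint[OF C] by (simp_all add: msupp_eq)
  show "AE x in \<mu>. x \<in> mint E \<longleftrightarrow> x \<in> E" "AE x in \<mu>. x \<in> msupp E \<longleftrightarrow> x \<in> E"
    using AE_mint_or[OF E] AE_mint[OF Eb] AE_mint[OF borel_comp[OF Eb]]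
    by (eventually_elim; auto simp: msupp_eq)+
qed

end

section \<open>Exponential coordinates on a Carnot group\<close>

lemma Ck_directional_derivative:
  fixes g :: "'x::euclidean_space \<Rightarrow> real"
  assumes "Ck_on (Suc 0) UNIV g"
  shows "((\<lambda>s. g (z + s *\<^sub>R w)) has_real_derivative frechet_derivative g (at z) w) (at 0)"
proof -
  have g: "(g has_derivative frechet_derivative g (at z)) (at (z + 0 *\<^sub>R w))"
    using Ck_on_Suc_derivative[OF assms] by simp
  have lin: "linear (frechet_derivative g (at z))" using g has_derivative_linear by blast
  have "((\<lambda>s. z + s *\<^sub>R w) has_derivative (\<lambda>h. h *\<^sub>R w)) (at 0)"
    by (auto intro!: derivative_eq_intros)
  from diff_chain_at[OF this g] show ?thesis
    by (simp add: has_field_derivative_def o_def linear_scale[OF lin] mult.commute[of _ "frechet_derivative g (at z) w"])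
qed

locale carnot_structure =
  fixes G :: "('a::{second_countable_topology, t2_space}, 'e::euclidean_space, 'g::euclidean_space) carnot_data"
  assumes carnot: "carnot_group G"
begin

abbreviation ex :: "'g \<Rightarrow> 'a" where "ex \<equiv> exp_map G"

definition lg :: "'a \<Rightarrow> 'g" where "lg = inv_into UNIV ex"

definition mul :: "'g \<Rightarrow> 'g \<Rightarrow> 'g" (infixl "\<star>" 70) where
  "u \<star> v = lg (ex u \<otimes>\<^bsub>G\<^esub> ex v)"

lemma lie: "lie_group G" and liealg: "lie_algebra_of G" and strat: "stratification G"
  and expo: "exponential_map G" and bij_ex: "bij ex"
  and smooth_ex: "smooth_map euclidean_atlas (charts G) ex"
  and smooth_lg: "smooth_map (charts G) euclidean_atlas lg"
  using carnot by (auto simp: carnot_group_def lg_def)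

lemma group_G: "group G" and carrier_G [simp]: "carrier G = UNIV"
  and atlas_G: "smooth_atlas (charts G)"
  and smooth_mult: "smooth_map (prod_atlas (charts G) (charts G)) (charts G) (\<lambda>(x, y). x \<otimes>\<^bsub>G\<^esub> y)"
  using lie by (auto simp: lie_group_def)

sublocale group G by (rule group_G)

lemma lg_ex [simp]: "lg (ex u) = u"
  unfolding lg_def using bij_ex by (simp add: bij_is_inj)

lemma ex_lg [simp]: "ex (lg x) = x"
  unfolding lg_def using bij_ex by (simp add: bij_is_surj surj_f_inv_f)

lemma continuous_ex: "continuous_on S ex" and continuous_lg: "continuous_on S' lg"
  using smooth_ex smooth_lg continuous_on_subset by (auto simp: smooth_map_def)

lemma ex_mul [simp]: "ex (u \<star> v) = ex u \<otimes>\<^bsub>G\<^esub> ex v"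
  by (simp add: mul_def)

lemma ex_add: "ex ((s + t) *\<^sub>R X) = ex (s *\<^sub>R X) \<otimes>\<^bsub>G\<^esub> ex (t *\<^sub>R X)"
  using expo by (simp add: exponential_map_def)

lemma ex_0 [simp]: "ex 0 = \<one>\<^bsub>G\<^esub>"
  using ex_add[of 0 0 0] by (simp add: l_cancel_one')

lemma chart_open:
  assumes "(U, \<phi>) \<in> charts G"
  shows "open U" "open (\<phi> ` U)" "x \<in> U \<Longrightarrow> inv_into U \<phi> (\<phi> x) = x" "inj_on \<phi> U"
proof -
  have "homeomorphism U (\<phi> ` U) \<phi> (inv_into U \<phi>)" "open U" "open (\<phi> ` U)"
    using atlas_G assms unfolding smooth_atlas_def by auto
  then show "open U" "open (\<phi> ` U)" "x \<in> U \<Longrightarrow> inv_into U \<phi> (\<phi> x) = x" "inj_on \<phi> U"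
    by (auto simp: homeomorphism_def inj_on_def) metis
qed

lemma chart_at: obtains U \<phi> where "(U, \<phi>) \<in> charts G" "x \<in> U"
proof -
  have "x \<in> (\<Union>(U, \<phi>)\<in>charts G. U)" using atlas_G unfolding smooth_atlas_def by simp
  then show thesis using that by auto
qed

lemma Ck_chart_ex:
  assumes "(V, \<psi>) \<in> charts G"
  shows "Ck_on k (ex -` V) (\<lambda>u. \<psi> (ex u))"
  using smooth_ex assms by (force simp: smooth_map_def euclidean_atlas_def smooth_on_def o_def)

lemma Ck_lg_chart:
  assumes "(U, \<phi>) \<in> charts G"
  shows "Ck_on k (\<phi> ` U) (\<lambda>y. lg (inv_into U \<phi> y))"
  using smooth_lg assms by (force simp: smooth_map_def euclidean_atlas_def smooth_on_def o_def)

text \<open>Near each pair there are charts around both factors and around the product. On the open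
  set \<open>T\<close> where all three apply, the law is a composition of the chart expressions of
  \<open>ex\<close>, of the multiplication and of \<open>lg\<close>.\<close>

lemma Ck_mul_coords: "Ck_on k UNIV (\<lambda>z. fst z \<star> snd z)"
proof (rule Ck_on_locally)
  fix z :: "'g \<times> 'g"
  obtain u v where z: "z = (u, v)" by fastforce
  obtain U1 \<phi>1 where 1: "(U1, \<phi>1) \<in> charts G" "ex u \<in> U1" by (rule chart_at)
  obtain U2 \<phi>2 where 2: "(U2, \<phi>2) \<in> charts G" "ex v \<in> U2" by (rule chart_at)
  obtain V \<psi> where 3: "(V, \<psi>) \<in> charts G" "ex u \<otimes>\<^bsub>G\<^esub> ex v \<in> V" by (rule chart_at)
  let ?m = "\<lambda>(x, y). x \<otimes>\<^bsub>G\<^esub> y"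
  let ?h = "\<lambda>z. (ex (fst z), ex (snd z))"
  let ?S = "U1 \<times> U2 \<inter> ?m -` V"
  define T where "T = ?h -` ?S"
  have contm: "continuous_on UNIV ?m" using smooth_mult by (simp add: smooth_map_def)
  have conth: "continuous_on UNIV ?h"
    by (intro continuous_on_Pair continuous_on_compose2[OF continuous_ex[of UNIV]] continuous_on_fst continuous_on_snd continuous_on_id) auto
  have "open T"
    unfolding T_def using chart_open(1)[OF 1(1)] chart_open(1)[OF 2(1)] chart_open(1)[OF 3(1)]
    by (intro open_vimage[OF _ conth] open_Int open_Times open_vimage[OF _ contm])
  moreover have "z \<in> T" using 1 2 3 by (simp add: T_def z)
  moreover have "Ck_on k T (\<lambda>z. fst z \<star> snd z)"
  proof -
    have "(U1 \<times> U2, map_prod \<phi>1 \<phi>2) \<in> prod_atlas (charts G) (charts G)"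
      using 1 2 unfolding prod_atlas_def by blast
    with smooth_mult 3(1)
    have sm: "Ck_on k (map_prod \<phi>1 \<phi>2 ` ?S) (\<psi> \<circ> ?m \<circ> inv_into (U1 \<times> U2) (map_prod \<phi>1 \<phi>2))"
      unfolding smooth_map_def smooth_on_def by blast
    have "Ck_on k T (\<lambda>z. \<phi>1 (ex (fst z)))"
      by (rule Ck_on_compose[OF \<open>open T\<close> _ Ck_on_bounded_linear[OF bounded_linear_fst \<open>open T\<close>] Ck_chart_ex[OF 1(1)]])
        (auto simp: T_def)
    moreover have "Ck_on k T (\<lambda>z. \<phi>2 (ex (snd z)))"
      by (rule Ck_on_compose[OF \<open>open T\<close> _ Ck_on_bounded_linear[OF bounded_linear_snd \<open>open T\<close>] Ck_chart_ex[OF 2(1)]])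
        (auto simp: T_def)
    ultimately have p: "Ck_on k T (\<lambda>z. (\<phi>1 (ex (fst z)), \<phi>2 (ex (snd z))))"
      by (rule Ck_on_Pair[OF \<open>open T\<close>])
    have "Ck_on k T (\<lambda>z. (\<psi> \<circ> ?m \<circ> inv_into (U1 \<times> U2) (map_prod \<phi>1 \<phi>2)) (\<phi>1 (ex (fst z)), \<phi>2 (ex (snd z))))"
      by (rule Ck_on_compose[OF \<open>open T\<close> _ p sm]) (force simp: T_def)
    moreover have "(\<psi> \<circ> ?m \<circ> inv_into (U1 \<times> U2) (map_prod \<phi>1 \<phi>2)) (\<phi>1 (ex (fst z)), \<phi>2 (ex (snd z)))
        = \<psi> (ex (fst z) \<otimes>\<^bsub>G\<^esub> ex (snd z))" if "z \<in> T" for z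
    proof -
      have inj: "inj_on (map_prod \<phi>1 \<phi>2) (U1 \<times> U2)"
        using chart_open(4)[OF 1(1)] chart_open(4)[OF 2(1)] by (rule map_prod_inj_on)
      have "(ex (fst z), ex (snd z)) \<in> U1 \<times> U2" using that by (simp add: T_def)
      from inv_into_f_f[OF inj this] show ?thesis by simp
    qed
    ultimately have c: "Ck_on k T (\<lambda>z. \<psi> (ex (fst z) \<otimes>\<^bsub>G\<^esub> ex (snd z)))"
      by (rule Ck_on_cong[OF \<open>open T\<close>, rotated])
    have "Ck_on k T (\<lambda>z. lg (inv_into V \<psi> (\<psi> (ex (fst z) \<otimes>\<^bsub>G\<^esub> ex (snd z)))))"
      by (rule Ck_on_compose[OF \<open>open T\<close> _ c Ck_lg_chart[OF 3(1)]]) (auto simp: T_def)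
    then show ?thesis
      by (rule Ck_on_cong[OF \<open>open T\<close>, rotated]) (use chart_open(3)[OF 3(1)] in \<open>auto simp: T_def mul_def\<close>)
  qed
  ultimately show "\<exists>T. open T \<and> z \<in> T \<and> Ck_on k T (\<lambda>z. fst z \<star> snd z)" by blast
qed

sublocale L: exp_group mul
proof
  show "a \<star> b \<star> c = a \<star> (b \<star> c)" for a b c
    unfolding mul_def by (simp add: m_assoc)
  show "0 \<star> a = a" for a by (simp add: mul_def)
  show "(s *\<^sub>R a) \<star> (t *\<^sub>R a) = (s + t) *\<^sub>R a" for s t a
    by (simp add: mul_def ex_add[symmetric])
  show "smooth_on UNIV (\<lambda>z. fst z \<star> snd z)"
    unfolding smooth_on_def using Ck_mul_coords by blast
qed

text \<open>The exponential map is a diffeomorphism and so acts as one global chart; from here on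
  the atlas can be forgotten.\<close>

lemma smooth_functions_iff: "f \<in> smooth_functions G \<longleftrightarrow> (\<forall>k. Ck_on k UNIV (\<lambda>u. f (ex u)))"
proof
  assume "f \<in> smooth_functions G"
  then have f: "Ck_on k (\<phi> ` U) (\<lambda>y. f (inv_into U \<phi> y))" if "(U, \<phi>) \<in> charts G" for U \<phi> k
    using that by (force simp: smooth_functions_def smooth_map_def euclidean_atlas_def smooth_on_def o_def)
  show "\<forall>k. Ck_on k UNIV (\<lambda>u. f (ex u))"
  proof (intro allI Ck_on_locally)
    fix k and u :: 'g
    obtain U \<phi> where U: "(U, \<phi>) \<in> charts G" "ex u \<in> U" by (rule chart_at)
    have o: "open (ex -` U)" using chart_open(1)[OF U(1)] by (rule open_vimage[OF _ continuous_ex])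
    have "Ck_on k (ex -` U) (\<lambda>u. f (inv_into U \<phi> (\<phi> (ex u))))"
      by (rule Ck_on_compose[OF o _ Ck_chart_ex[OF U(1)] f[OF U(1)]]) auto
    then have "Ck_on k (ex -` U) (\<lambda>u. f (ex u))"
      by (rule Ck_on_cong[OF o, rotated]) (use chart_open(3)[OF U(1)] in auto)
    then show "\<exists>T. open T \<and> u \<in> T \<and> Ck_on k T (\<lambda>u. f (ex u))" using o U(2) by blast
  qed
next
  assume f: "\<forall>k. Ck_on k UNIV (\<lambda>u. f (ex u))"
  have "continuous_on UNIV (\<lambda>u. f (ex u))" using f Ck_on_imp_continuous_on by blast
  from continuous_on_compose2[OF this continuous_lg[of UNIV]] have "continuous_on UNIV f" by simp
  moreover have "Ck_on k (\<phi> ` U) (\<lambda>y. f (inv_into U \<phi> y))" if U: "(U, \<phi>) \<in> charts G" for U \<phi> k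
    using Ck_on_compose[OF chart_open(2)[OF U] subset_UNIV Ck_lg_chart[OF U] f[rule_format]] by simp
  ultimately show "f \<in> smooth_functions G"
    by (auto simp: smooth_functions_def smooth_map_def euclidean_atlas_def smooth_on_def o_def)
qed

lemma smooth_functions_add: "f \<in> smooth_functions G \<Longrightarrow> g \<in> smooth_functions G \<Longrightarrow> (\<lambda>x. f x + g x) \<in> smooth_functions G"
  and smooth_functions_mult: "f \<in> smooth_functions G \<Longrightarrow> g \<in> smooth_functions G \<Longrightarrow> (\<lambda>x. f x * g x) \<in> smooth_functions G"
  and smooth_functions_const: "(\<lambda>x. c) \<in> smooth_functions G"
  by (auto simp: smooth_functions_iff intro: Ck_on_add Ck_on_mult Ck_on_const)

lemma smooth_functions_diff: "f \<in> smooth_functions G \<Longrightarrow> g \<in> smooth_functions G \<Longrightarrow> (\<lambda>x. f x - g x) \<in> smooth_functions G"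
  using smooth_functions_add[OF _ smooth_functions_mult[OF smooth_functions_const[of "-1"]], of f g] by simp

lemma smooth_functions_left: "f \<in> smooth_functions G \<Longrightarrow> (\<lambda>x. f (a \<otimes>\<^bsub>G\<^esub> x)) \<in> smooth_functions G"
  unfolding smooth_functions_iff
proof
  fix k assume f: "\<forall>k. Ck_on k UNIV (\<lambda>u. f (ex u))"
  have "Ck_on k UNIV (\<lambda>u. f (ex (lg a \<star> u)))"
    by (rule Ck_on_compose[OF open_UNIV subset_UNIV L.Ck_left f[rule_format]])
  then show "Ck_on k UNIV (\<lambda>u. f (a \<otimes>\<^bsub>G\<^esub> ex u))" by simp
qed

definition coord :: "'g \<Rightarrow> 'a \<Rightarrow> real" where "coord b x = lg x \<bullet> b"

lemma coord_smooth: "coord b \<in> smooth_functions G"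
  by (auto simp: smooth_functions_iff coord_def intro: Ck_on_bounded_linear bounded_linear_inner_left)

abbreviation fld :: "'g \<Rightarrow> ('a \<Rightarrow> real) \<Rightarrow> 'a \<Rightarrow> real" where "fld \<equiv> field_of G"

lemma fld_in: "fld X \<in> left_invariant_fields G"
  using liealg unfolding lie_algebra_of_def bij_betw_def by blast

lemma fld_smooth: "f \<in> smooth_functions G \<Longrightarrow> fld X f \<in> smooth_functions G"
  and fld_add: "f \<in> smooth_functions G \<Longrightarrow> g \<in> smooth_functions G \<Longrightarrow> fld X (\<lambda>x. f x + g x) = (\<lambda>x. fld X f x + fld X g x)"
  and fld_scale: "f \<in> smooth_functions G \<Longrightarrow> fld X (\<lambda>x. c * f x) = (\<lambda>x. c * fld X f x)"
  and fld_mult: "f \<in> smooth_functions G \<Longrightarrow> g \<in> smooth_functions G \<Longrightarrow> fld X (\<lambda>x. f x * g x) = (\<lambda>x. fld X f x * g x + f x * fld X g x)"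
  and fld_left: "f \<in> smooth_functions G \<Longrightarrow> fld X (\<lambda>x. f (a \<otimes>\<^bsub>G\<^esub> x)) = (\<lambda>x. fld X f (a \<otimes>\<^bsub>G\<^esub> x))"
  and fld_out: "f \<notin> smooth_functions G \<Longrightarrow> fld X f = (\<lambda>x. 0)"
  using fld_in[of X] unfolding left_invariant_fields_def by blast+

lemma fld_zero: "fld X (\<lambda>x. 0) = (\<lambda>x. 0)"
  using fld_scale[OF smooth_functions_const[of 0], of X 0] by simp

lemma fld_linear: "fld (X + Y) f x = fld X f x + fld Y f x" "fld (c *\<^sub>R X) f x = c * fld X f x"
  using liealg unfolding lie_algebra_of_def by blast+

lemma fld_inject: "(\<And>f x. fld X f x = fld Y f x) \<Longrightarrow> X = Y"
proof -
  assume "\<And>f x. fld X f x = fld Y f x"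
  then have "fld X = fld Y" by blast
  then show "X = Y" using liealg unfolding lie_algebra_of_def bij_betw_def by (meson UNIV_I injD)
qed

lemma fld_derivative:
  assumes f: "f \<in> smooth_functions G"
  shows "((\<lambda>t. f (x \<otimes>\<^bsub>G\<^esub> ex (t *\<^sub>R X))) has_real_derivative fld X f x) (at 0)"
proof -
  have "((\<lambda>t. f (x \<otimes>\<^bsub>G\<^esub> ex (t *\<^sub>R X))) has_real_derivative fld X (\<lambda>y. f (x \<otimes>\<^bsub>G\<^esub> y)) \<one>\<^bsub>G\<^esub>) (at 0)"
    by (rule expo[unfolded exponential_map_def, THEN conjunct2, rule_format, OF smooth_functions_left[OF f]])
  then show ?thesis by (simp add: fld_left[OF f])
qed

abbreviation bracket :: "'g \<Rightarrow> 'g \<Rightarrow> 'g" where "bracket \<equiv> lie_bracket G"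

lemma commutator_in: "(\<lambda>f x. fld X (fld Y f) x - fld Y (fld X f) x) \<in> left_invariant_fields G"
proof -
  have "(\<lambda>x. fld X (fld Y f) x - fld Y (fld X f) x) \<in> smooth_functions G" if "f \<in> smooth_functions G" for f
    using that by (intro smooth_functions_diff fld_smooth)
  moreover have "fld X (fld Y (\<lambda>x. f x * g x)) x - fld Y (fld X (\<lambda>x. f x * g x)) x
      = (fld X (fld Y f) x - fld Y (fld X f) x) * g x + f x * (fld X (fld Y g) x - fld Y (fld X g) x)"
    if f: "f \<in> smooth_functions G" and g: "g \<in> smooth_functions G" for f g x
  proof -
    \<comment> \<open>The products of first derivatives are symmetric in \<open>A\<close> and
      \<open>B\<close> and cancel in the commutator.\<close>
    have *: "fld A (fld B (\<lambda>x. f x * g x)) = (\<lambda>x. (fld A (fld B f) x * g x + fld B f x * fld A g x) + (fld A f x * fld B g x + f x * fld A (fld B g) x))" for A B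
      using f g by (simp add: fld_mult fld_add fld_smooth smooth_functions_mult)
    show ?thesis unfolding * by (simp add: algebra_simps)
  qed
  ultimately show ?thesis
    unfolding left_invariant_fields_def
    by (auto simp: fld_add fld_scale fld_smooth fld_left fld_out fld_zero algebra_simps)
qed

lemma fld_bracket: "fld (bracket X Y) f x = fld X (fld Y f) x - fld Y (fld X f) x"
proof -
  have "fld (bracket X Y) = (\<lambda>f x. fld X (fld Y f) x - fld Y (fld X f) x)"
    unfolding lie_bracket_def using commutator_in liealg
    by (intro f_inv_into_f) (auto simp: lie_algebra_of_def bij_betw_def)
  then show ?thesis by simp
qed

lemma bracket_add_left: "bracket (X + Y) Z = bracket X Z + bracket Y Z"
proof (rule fld_inject)
  fix f x
  show "fld (bracket (X + Y) Z) f x = fld (bracket X Z + bracket Y Z) f x"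
  proof (cases "f \<in> smooth_functions G")
    case True
    have "fld (X + Y) f = (\<lambda>x. fld X f x + fld Y f x)" by (simp add: fld_linear fun_eq_iff)
    then show ?thesis using True by (simp add: fld_bracket fld_linear fld_add fld_smooth)
  qed (simp add: fld_out)
qed

lemma bracket_scale_left: "bracket (c *\<^sub>R X) Z = c *\<^sub>R bracket X Z"
proof (rule fld_inject)
  fix f x
  show "fld (bracket (c *\<^sub>R X) Z) f x = fld (c *\<^sub>R bracket X Z) f x"
  proof (cases "f \<in> smooth_functions G")
    case True
    have "fld (c *\<^sub>R X) f = (\<lambda>x. c * fld X f x)" by (simp add: fld_linear fun_eq_iff)
    then show ?thesis using True by (simp add: fld_bracket fld_linear fld_scale fld_smooth algebra_simps)
  qed (simp add: fld_out)
qed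

lemma bracket_swap: "bracket X Y = (- 1) *\<^sub>R bracket Y X"
  by (rule fld_inject) (simp only: fld_bracket fld_linear, simp)

lemma linear_bracket_left: "linear (\<lambda>X. bracket X Z)"
  by (rule linearI) (simp_all add: bracket_add_left bracket_scale_left)

lemma linear_bracket: "linear (bracket X)"
proof -
  have eq: "bracket X = (\<lambda>Y. (- 1) *\<^sub>R bracket Y X)" using bracket_swap by blast
  show ?thesis unfolding eq by (rule linear_compose_scale_right[OF linear_bracket_left])
qed

text \<open>This identifies the bracket of vector fields with the derivative of \<open>Ad\<close>.
  Let \<open>q (t, u)\<close> be the derivative at \<open>s = 0\<close> of a coordinate of \<open>(t
  *\<^sub>R Z) \<star> (s *\<^sub>R v) \<star> (u *\<^sub>R Z)\<close>. Along \<open>u = - t\<close>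
  it is that coordinate of \<open>Ad\<close>; its partial derivatives at the origin are
  \<open>Z\<close> after \<open>v\<close> and \<open>v\<close> after \<open>Z\<close> applied to the
  coordinate, so the chain rule yields their difference.\<close>

lemma Ad_derivative: "((\<lambda>t. L.Ad (t *\<^sub>R Z) v) has_vector_derivative bracket Z v) (at 0)"
proof -
  have comp: "((\<lambda>t. L.Ad (t *\<^sub>R Z) v \<bullet> b) has_real_derivative bracket Z v \<bullet> b) (at 0)" for b
  proof -
    define P where "P = (\<lambda>z :: real \<times> real \<times> real. ((fst (snd z) *\<^sub>R Z) \<star> (fst z *\<^sub>R v) \<star> (snd (snd z) *\<^sub>R Z)) \<bullet> b)"
    have ckP: "Ck_on k UNIV P" for k
      unfolding P_def
      by (intro Ck_on_linear_compose[OF bounded_linear_inner_left open_UNIV] L.Ck_mul open_UNIV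
          Ck_on_bounded_linear bounded_linear_scaleR_const bounded_linear_fst bounded_linear_fst_comp
          bounded_linear_snd_comp bounded_linear_snd)
    define q where "q = (\<lambda>w :: real \<times> real. frechet_derivative P (at (0, w)) (1, 0, 0))"
    have ckq: "Ck_on k UNIV q" for k
    proof -
      have "Ck_on k UNIV (\<lambda>z. frechet_derivative P (at z) (1, 0, 0))"
        using ckP[of "Suc k"] by simp
      moreover have "Ck_on k UNIV (\<lambda>w :: real \<times> real. (0 :: real, w))"
        by (intro Ck_on_Pair Ck_on_const Ck_on_bounded_linear bounded_linear_ident open_UNIV)
      ultimately show ?thesis
        unfolding q_def using Ck_on_compose[OF open_UNIV subset_UNIV] by blast
    qed
    have qd: "((\<lambda>s. ((t *\<^sub>R Z) \<star> (s *\<^sub>R v) \<star> (u *\<^sub>R Z)) \<bullet> b) has_real_derivative q (t, u)) (at 0)" for t u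
      using Ck_directional_derivative[OF ckP, of "(0, t, u)" "(1, 0, 0)"] by (simp add: P_def q_def)
    have q_Ad: "q (t, - t) = L.Ad (t *\<^sub>R Z) v \<bullet> b" for t
    proof -
      have "((\<lambda>s. s *\<^sub>R v) has_vector_derivative v) (at 0)"
        by (auto intro!: derivative_eq_intros simp: has_vector_derivative_def)
      from L.Ad_curve[OF this, of "t *\<^sub>R Z"]
      have "((\<lambda>s. (t *\<^sub>R Z) \<star> (s *\<^sub>R v) \<star> ((- t) *\<^sub>R Z)) has_vector_derivative L.Ad (t *\<^sub>R Z) v) (at 0)"
        by simp
      from bounded_linear.has_vector_derivative[OF bounded_linear_inner_left this, of b]
      show ?thesis using DERIV_unique[OF qd[of t "- t"]] by (simp add: has_real_derivative_iff_has_vector_derivative)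
    qed
    have q_fld: "q (t, 0) = fld v (coord b) (ex (t *\<^sub>R Z))" for t
      using DERIV_unique[OF qd[of t 0]] fld_derivative[OF coord_smooth, of b "ex (t *\<^sub>R Z)" v]
      by (simp add: coord_def mul_def)
    have D: "(q has_derivative frechet_derivative q (at (0, 0))) (at (0, 0))"
      using Ck_on_Suc_derivative[OF ckq] by blast
    then have lin: "linear (frechet_derivative q (at (0, 0)))" using has_derivative_linear by blast
    have D1: "frechet_derivative q (at (0, 0)) (1, 0) = fld Z (fld v (coord b)) \<one>\<^bsub>G\<^esub>"
    proof -
      have "((\<lambda>t. q (t, 0)) has_real_derivative frechet_derivative q (at (0, 0)) (1, 0)) (at 0)"
        using Ck_directional_derivative[OF ckq, of "(0, 0)" "(1, 0)"] by simp
      moreover have "((\<lambda>t. q (t, 0)) has_real_derivative fld Z (fld v (coord b)) \<one>\<^bsub>G\<^esub>) (at 0)"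
        using fld_derivative[OF fld_smooth[OF coord_smooth], of v b "\<one>\<^bsub>G\<^esub>" Z] by (simp add: q_fld)
      ultimately show ?thesis by (rule DERIV_unique)
    qed
    have D2: "frechet_derivative q (at (0, 0)) (0, 1) = fld v (fld Z (coord b)) \<one>\<^bsub>G\<^esub>"
    proof -
      \<comment> \<open>\<open>q (0, u)\<close> differentiates in \<open>s\<close> first, whereas
        the field \<open>v\<close> has to be applied last; symmetry of the mixed partials of
        \<open>\<phi>\<close> exchanges the order.\<close>
      define \<phi> where "\<phi> = (\<lambda>z :: real \<times> real. ((fst z *\<^sub>R v) \<star> (snd z *\<^sub>R Z)) \<bullet> b)"
      have ck\<phi>: "Ck_on k UNIV \<phi>" for k
        unfolding \<phi>_def
        by (intro Ck_on_linear_compose[OF bounded_linear_inner_left open_UNIV] L.Ck_mul open_UNIV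
            Ck_on_bounded_linear bounded_linear_scaleR_const bounded_linear_fst bounded_linear_snd)
      have ck1: "Ck_on k UNIV (\<lambda>z. frechet_derivative \<phi> (at z) w)" for k w
        using ck\<phi>[of "Suc k"] by (cases w) simp
      have ds: "frechet_derivative \<phi> (at (0, u)) (1, 0) = q (0, u)" for u
        using DERIV_unique[OF Ck_directional_derivative[OF ck\<phi>, of "(0, u)" "(1, 0)"]] qd[of 0 u]
        by (simp add: \<phi>_def)
      have du: "frechet_derivative \<phi> (at (s, 0)) (0, 1) = fld Z (coord b) (ex (s *\<^sub>R v))" for s
        using DERIV_unique[OF Ck_directional_derivative[OF ck\<phi>, of "(s, 0)" "(0, 1)"]]
          fld_derivative[OF coord_smooth, of b "ex (s *\<^sub>R v)" Z]
        by (simp add: \<phi>_def coord_def mul_def)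
      have "frechet_derivative q (at (0, 0)) (0, 1) = frechet_derivative (\<lambda>z. frechet_derivative \<phi> (at z) (1, 0)) (at 0) (0, 1)"
        using DERIV_unique[OF Ck_directional_derivative[OF ckq, of "(0, 0)" "(0, 1)"]]
          Ck_directional_derivative[OF ck1[of "Suc 0" "(1, 0)"], of "(0, 0)" "(0, 1)"]
        by (simp add: ds zero_prod_def)
      also have "\<dots> = frechet_derivative (\<lambda>z. frechet_derivative \<phi> (at z) (0, 1)) (at 0) (1, 0)"
        using ck\<phi> by (rule mixed_partials_commute_real)
      also have "\<dots> = fld v (fld Z (coord b)) \<one>\<^bsub>G\<^esub>"
        using DERIV_unique[OF Ck_directional_derivative[OF ck1[of "Suc 0" "(0, 1)"], of "(0, 0)" "(1, 0)"]]
          fld_derivative[OF fld_smooth[OF coord_smooth], of Z b "\<one>\<^bsub>G\<^esub>" v]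
        by (simp add: du zero_prod_def)
      finally show ?thesis .
    qed
    \<comment> \<open>A coordinate is linear along a ray from the origin, so a field applied to it
      at the neutral element returns the coordinate of the field.\<close>
    have b0: "fld (bracket Z v) (coord b) \<one>\<^bsub>G\<^esub> = bracket Z v \<bullet> b"
    proof -
      have "((\<lambda>t. (t *\<^sub>R bracket Z v) \<bullet> b) has_real_derivative bracket Z v \<bullet> b) (at 0)"
        by (auto intro!: derivative_eq_intros)
      moreover have "((\<lambda>t. (t *\<^sub>R bracket Z v) \<bullet> b) has_real_derivative fld (bracket Z v) (coord b) \<one>\<^bsub>G\<^esub>) (at 0)"
        using fld_derivative[OF coord_smooth, of b "\<one>\<^bsub>G\<^esub>" "bracket Z v"] by (simp add: coord_def)
      ultimately show ?thesis using DERIV_unique by blast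
    qed
    have "((\<lambda>t. (t, - t)) has_derivative (\<lambda>h. (h, - h))) (at (0::real))"
      by (auto intro!: derivative_eq_intros)
    moreover have "(q has_derivative frechet_derivative q (at (0, 0))) (at (0, - 0))" using D by simp
    ultimately have "((\<lambda>t. q (t, - t)) has_derivative (\<lambda>h. frechet_derivative q (at (0, 0)) (h, - h))) (at 0)"
      using diff_chain_at[of "\<lambda>t. (t, - t)" "\<lambda>h. (h, - h)" 0 q] by (simp add: o_def)
    moreover have "frechet_derivative q (at (0, 0)) (h, - h) = (bracket Z v \<bullet> b) * h" for h
    proof -
      have "(h, - h) = h *\<^sub>R ((1, 0) - (0, 1 :: real))" by simp
      then have "frechet_derivative q (at (0, 0)) (h, - h) = h * (frechet_derivative q (at (0, 0)) (1, 0) - frechet_derivative q (at (0, 0)) (0, 1))"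
        by (simp only: linear_scale[OF lin] linear_diff[OF lin] real_scaleR_def)
      then show ?thesis unfolding D1 D2 by (simp add: fld_bracket[symmetric] b0)
    qed
    ultimately show ?thesis by (simp add: has_field_derivative_def q_Ad)
  qed
  show ?thesis
    unfolding has_vector_derivative_def
  proof (subst has_derivative_componentwise_within, intro ballI)
    fix b :: 'g
    have "(\<lambda>x. x *\<^sub>R bracket Z v \<bullet> b) = (*) (bracket Z v \<bullet> b)" by (auto simp: fun_eq_iff)
    then show "((\<lambda>x. L.Ad (x *\<^sub>R Z) v \<bullet> b) has_derivative (\<lambda>x. x *\<^sub>R bracket Z v \<bullet> b)) (at 0)"
      using comp[of b] unfolding has_field_derivative_def by simp
  qed
qed

section \<open>Consequences of the stratification\<close>

abbreviation V1 :: "'g set" where "V1 \<equiv> layer G 1"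

lemma subspace_layer: "1 \<le> i \<Longrightarrow> subspace (layer G i)"
  and layer_decomposition: "\<exists>!Y. Y \<in> (\<Pi>\<^sub>E i\<in>{1..step G}. layer G i) \<and> X = (\<Sum>i=1..step G. Y i)"
  and layer_Suc: "i \<in> {1..step G} \<Longrightarrow> span {bracket X Y | X Y. X \<in> V1 \<and> Y \<in> layer G i} = layer G (i + 1)"
  and layer_last: "1 \<le> step G" "layer G (step G) \<noteq> {0}"
  and layer_above: "i > step G \<Longrightarrow> layer G i = {0}"
  using strat unfolding stratification_def by auto

lemma bracket_layer:
  assumes "Z \<in> V1" "1 \<le> i" "v \<in> layer G i"
  shows "bracket Z v \<in> layer G (i + 1)"
proof (cases "i \<le> step G")
  case True
  then have eq: "layer G (i + 1) = span {bracket X Y | X Y. X \<in> V1 \<and> Y \<in> layer G i}"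
    using layer_Suc[of i] assms(2) by simp
  have "bracket Z v \<in> {bracket X Y | X Y. X \<in> V1 \<and> Y \<in> layer G i}" using assms by blast
  then show ?thesis unfolding eq by (rule span_base)
next
  case False
  then show ?thesis using assms layer_above[of i] layer_above[of "i + 1"] linear_0[OF linear_bracket] by auto
qed

lemma bracket_power_layer:
  assumes "Z \<in> V1" "1 \<le> i" "v \<in> layer G i"
  shows "(bracket Z ^^ k) v \<in> layer G (i + k)"
  using bracket_layer[OF assms(1)] assms(2,3) by (induction k) auto

lemma linear_bracket_power: "linear (bracket Z ^^ k)"
proof (induction k)
  case (Suc k)
  then show ?case unfolding funpow.simps by (rule linear_compose[OF _ linear_bracket])
qed (simp add: linear_iff)

text \<open>Every application raises the layer by one, so after \<open>step G\<close> of them each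
  component has left the stratification.\<close>

lemma bracket_nilpotent:
  assumes "Z \<in> V1"
  shows "(bracket Z ^^ step G) v = 0"
proof -
  obtain Y where Y: "Y \<in> (\<Pi>\<^sub>E i\<in>{1..step G}. layer G i)" "v = (\<Sum>i=1..step G. Y i)"
    using layer_decomposition[of v] by blast
  have "(bracket Z ^^ step G) (Y i) = 0" if i: "i \<in> {1..step G}" for i
    using bracket_power_layer[OF assms, of i "Y i" "step G"] layer_above[of "i + step G"] i Y(1) by (auto dest: PiE_mem)
  then show ?thesis unfolding Y(2) by (simp add: linear_sum[OF linear_bracket_power])
qed

lemma bracket_generates:
  assumes S: "subspace S" "V1 \<subseteq> S" "\<And>Z v. Z \<in> V1 \<Longrightarrow> v \<in> S \<Longrightarrow> bracket Z v \<in> S"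
  shows "S = UNIV"
proof -
  have L: "layer G (Suc i) \<subseteq> S" if "i < step G" for i
    using that
  proof (induction i)
    case (Suc i)
    have "layer G (Suc i + 1) = span {bracket X Y | X Y. X \<in> V1 \<and> Y \<in> layer G (Suc i)}"
      using layer_Suc[of "Suc i"] Suc.prems by simp
    also have "\<dots> \<subseteq> S"
      by (rule span_minimal[OF _ S(1)]) (use Suc S(3) in auto)
    finally show ?case by simp
  qed (use S(2) in simp)
  have "v \<in> S" for v
  proof -
    obtain Y where Y: "Y \<in> (\<Pi>\<^sub>E i\<in>{1..step G}. layer G i)" "v = (\<Sum>i=1..step G. Y i)"
      using layer_decomposition[of v] by blast
    have "Y i \<in> S" if i: "i \<in> {1..step G}" for i
    proof -
      have "Y i \<in> layer G (Suc (i - 1))" using PiE_mem[OF Y(1) i] i by simp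
      moreover have "i - 1 < step G" using i by auto
      ultimately show ?thesis using L by blast
    qed
    then show ?thesis unfolding Y(2) by (intro subspace_sum[OF S(1)])
  qed
  then show ?thesis by blast
qed

lemma V1_nontrivial: "V1 \<noteq> {0}"
proof
  assume V1: "V1 = {0}"
  have "layer G (Suc i) = {0}" if "i < step G" for i
  proof (cases i)
    case (Suc j)
    have "{bracket X Y | X Y. X \<in> V1 \<and> Y \<in> layer G (Suc j)} \<subseteq> {0}"
      using V1 linear_0[OF linear_bracket_left] by auto
    then have "span {bracket X Y | X Y. X \<in> V1 \<and> Y \<in> layer G (Suc j)} \<subseteq> {0}"
      by (rule span_minimal[OF _ subspace_single_0])
    then have "layer G (Suc j + 1) \<subseteq> {0}" using layer_Suc[of "Suc j"] that Suc by simp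
    then show ?thesis using subspace_0[OF subspace_layer[of "Suc i"]] Suc by auto
  qed (use V1 in simp)
  from this[of "step G - 1"] layer_last show False by simp
qed

sublocale L: carnot_law mul V1 bracket
proof (intro carnot_law.intro carnot_law_axioms.intro)
  show "exp_group mul" by (rule L.exp_group_axioms)
  show "subspace V1" by (rule subspace_layer) simp
  show "\<exists>n. \<forall>Z\<in>V1. \<forall>v. (bracket Z ^^ n) v = 0" using bracket_nilpotent by blast
  show "linear (\<lambda>Z. bracket Z v)" for v by (rule linear_bracket_left)
  show "S = UNIV" if "subspace S" "V1 \<subseteq> S" "\<And>Z v. Z \<in> V1 \<Longrightarrow> v \<in> S \<Longrightarrow> bracket Z v \<in> S" for S
    using that by (rule bracket_generates)
qed (rule Ad_derivative)

end

section \<open>Measurability of the line parameters\<close>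

text \<open>Images of closed sets are countable unions of compact sets. Injectivity makes images
  commute with differences, so the property passes through the generation of the Borel sets by
  closed ones.\<close>

lemma borel_injective_image:
  fixes f :: "'x::euclidean_space \<Rightarrow> 'y::euclidean_space"
  assumes S: "closed S" and f: "continuous_on S f" "inj_on f S" and A: "A \<in> sets borel"
  shows "f ` (A \<inter> S) \<in> sets borel"
proof -
  have cl: "f ` (C \<inter> S) \<in> sets borel" if "closed C" for C
  proof -
    have "C \<inter> S = (\<Union>n::nat. C \<inter> S \<inter> cball 0 (real n))" using real_arch_simple by auto
    then have "f ` (C \<inter> S) = (\<Union>n::nat. f ` (C \<inter> S \<inter> cball 0 (real n)))"
      by (metis image_UN)
    moreover have "compact (f ` (C \<inter> S \<inter> cball 0 (real n)))" for n
      using that S by (intro compact_continuous_image continuous_on_subset[OF f(1)] closed_Int_compact) auto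
    then have "f ` (C \<inter> S \<inter> cball 0 (real n)) \<in> sets borel" for n
      by (intro borel_closed compact_imp_closed)
    ultimately show ?thesis
      by (simp only:) (intro sets.countable_UN, auto)
  qed
  have "A \<in> sigma_sets UNIV (Collect closed)"
    using A by (simp add: borel_eq_closed)
  then show ?thesis
  proof induction
    case (Basic a)
    then show ?case using cl by simp
  next
    case (Compl a)
    have "f ` ((UNIV - a) \<inter> S) = f ` (UNIV \<inter> S) - f ` (a \<inter> S)"
      using inj_on_image_set_diff[OF f(2), of S "a \<inter> S"] by (simp add: Diff_Int_distrib2 Diff_Int)
    then show ?case using cl[of UNIV] Compl by simp
  next
    case (Union a)
    have "f ` (\<Union>(range a) \<inter> S) = (\<Union>i. f ` (a i \<inter> S))" by blast
    then show ?case using Union by simp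
  qed simp
qed

lemma AE_lborel_shift:
  fixes a :: real
  assumes "AE t in lborel. P t"
  shows "AE t in lborel. P (t + a)"
proof -
  obtain N where N: "{t. \<not> P t} \<subseteq> N" "emeasure lborel N = 0" "N \<in> sets borel"
    using assms by (auto elim!: AE_E)
  have "emeasure (distr lborel borel ((+) a)) N = emeasure lborel ((+) a -` N)"
    using N(3) by (subst emeasure_distr) auto
  then have "emeasure lborel ((+) a -` N) = 0" using N(2) by (simp add: lborel_distr_plus)
  moreover have "(+) a -` N \<in> sets lborel"
    using measurable_sets[of "(+) a" borel borel N] N(3) by simp
  ultimately have "(+) a -` N \<in> null_sets lborel" by (simp add: null_sets_def)
  then show ?thesis by (rule AE_I') (use N(1) in \<open>auto simp: add.commute\<close>)
qed

lemma orthonormal_basis_props: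
  fixes V :: "'g::euclidean_space set"
  assumes "subspace V"
  shows "orthonormal_basis V \<subseteq> V" "\<And>b. b \<in> orthonormal_basis V \<Longrightarrow> norm b = 1"
    "span (orthonormal_basis V) = V" "finite (orthonormal_basis V)"
proof -
  define P where "P = (\<lambda>B. B \<subseteq> V \<and> pairwise orthogonal B \<and> (\<forall>b\<in>B. norm b = 1) \<and> span B = V)"
  obtain B where "P B" unfolding P_def using orthonormal_basis_subspace[OF assms] by metis
  then have "P (orthonormal_basis V)"
    unfolding orthonormal_basis_def P_def[symmetric] by (rule someI)
  then show "orthonormal_basis V \<subseteq> V" and n: "\<And>b. b \<in> orthonormal_basis V \<Longrightarrow> norm b = 1"
    and "span (orthonormal_basis V) = V"
    by (auto simp: P_def)
  have o: "pairwise orthogonal (orthonormal_basis V)"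
    using \<open>P (orthonormal_basis V)\<close> by (simp add: P_def)
  have "0 \<notin> orthonormal_basis V" using n by force
  then show "finite (orthonormal_basis V)"
    using pairwise_orthogonal_independent[OF o] independent_imp_finite by blast
qed

lemma subspace_lborel_pos:
  fixes V :: "'g::euclidean_space set"
  assumes V: "subspace V" and x: "x \<in> V" and r: "0 < r"
  shows "0 < emeasure (subspace_lborel V) (ball x r \<inter> V)"
proof -
  let ?B = "orthonormal_basis V"
  note B = orthonormal_basis_props[OF V]
  interpret product_sigma_finite "\<lambda>_::'g. lborel :: real measure" ..
  have "x \<in> span ?B" using x B(3) by simp
  then obtain c0 where c0: "x = (\<Sum>b\<in>?B. c0 b *\<^sub>R b)"
    unfolding span_finite[OF B(4)] by blast
  \<comment> \<open>The errors of all coordinates add up to \<open>card * \<delta> < r\<close>; the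
    summand 1 also covers the empty basis.\<close>
  define \<delta> where "\<delta> = r / (real (card ?B) + 1)"
  have \<delta>: "\<delta> > 0" using r by (simp add: \<delta>_def)
  let ?f = "\<lambda>c. \<Sum>b\<in>?B. c b *\<^sub>R b"
  have meas: "?f \<in> (\<Pi>\<^sub>M b\<in>?B. lborel) \<rightarrow>\<^sub>M borel" by measurable
  have VB: "ball x r \<inter> V \<in> sets borel" using closed_subspace[OF V] by auto
  let ?P = "PiE ?B (\<lambda>b. {c0 b - \<delta> <..< c0 b + \<delta>})"
  have "?P \<subseteq> ?f -` (ball x r \<inter> V) \<inter> space (\<Pi>\<^sub>M b\<in>?B. lborel)"
  proof
    fix c assume c: "c \<in> ?P"
    have "norm (x - ?f c) = norm (\<Sum>b\<in>?B. (c0 b - c b) *\<^sub>R b)"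
      unfolding c0 by (simp add: sum_subtractf[symmetric] scaleR_left_diff_distrib)
    also have "\<dots> \<le> (\<Sum>b\<in>?B. \<bar>c0 b - c b\<bar>)"
      by (rule order_trans[OF norm_sum]) (simp add: B(2))
    also have "\<dots> \<le> (\<Sum>b\<in>?B. \<delta>)"
      using PiE_mem[OF c] by (intro sum_mono) (auto simp: abs_le_iff less_imp_le algebra_simps)
    also have "\<dots> < r" using r by (simp add: \<delta>_def field_simps)
    finally have "?f c \<in> ball x r" by (simp add: dist_norm)
    moreover have "?f c \<in> V" using B(1) by (intro subspace_sum[OF V] subspace_scale[OF V]) auto
    ultimately show "c \<in> ?f -` (ball x r \<inter> V) \<inter> space (\<Pi>\<^sub>M b\<in>?B. lborel)"
      using c by (auto simp: space_PiM PiE_iff)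
  qed
  then have le: "emeasure (\<Pi>\<^sub>M b\<in>?B. lborel) ?P \<le> emeasure (subspace_lborel V) (ball x r \<inter> V)"
    unfolding subspace_lborel_def
    by (subst emeasure_distr[OF meas VB]) (intro emeasure_mono measurable_sets[OF meas VB])
  have "emeasure (\<Pi>\<^sub>M b\<in>?B. lborel) ?P = (\<Prod>b\<in>?B. emeasure lborel {c0 b - \<delta> <..< c0 b + \<delta>})"
    by (rule emeasure_PiM[OF B(4)]) simp
  also have "\<dots> = ennreal (\<Prod>b\<in>?B. 2 * \<delta>)"
    by (subst prod_ennreal[symmetric]) (use \<delta> in auto)
  finally have eq: "emeasure (\<Pi>\<^sub>M b\<in>?B. lborel) ?P = ennreal (\<Prod>b\<in>?B. 2 * \<delta>)" .
  have "0 < (\<Prod>b\<in>?B. 2 * \<delta>)" using \<delta> by (intro prod_pos) auto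
  then have "0 < ennreal (\<Prod>b\<in>?B. 2 * \<delta>)" by (simp only: ennreal_less_zero_iff)
  then show ?thesis using le unfolding eq by (rule less_le_trans)
qed

text \<open>Radial projection maps a small ball of the subspace around half of \<open>x\<close> into
  the given patch. Hence a set of full measure in the sphere is dense in it.\<close>

lemma sphere_measure_pos:
  fixes V :: "'g::euclidean_space set"
  assumes V: "subspace V" and x: "x \<in> V" "norm x = 1" and e: "0 < e"
  shows "0 < emeasure (sphere_measure V) (ball x e \<inter> {y \<in> V. norm y = 1})"
proof -
  let ?T = "ball x e \<inter> {y \<in> V. norm y = 1}"
  let ?\<pi> = "\<lambda>y :: 'g. y /\<^sub>R norm y"
  let ?g = "\<lambda>y. ennreal (real (dim V)) * indicator (cball 0 1 - {0}) y"
  have sets: "sets (subspace_lborel V) = sets borel" by (simp add: subspace_lborel_def)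
  have Tb: "?T \<in> sets borel"
  proof -
    have "{y \<in> V. norm y = 1} = V \<inter> sphere 0 1" by auto
    then show ?thesis using closed_subspace[OF V] by auto
  qed
  have pm: "?\<pi> \<in> density (subspace_lborel V) ?g \<rightarrow>\<^sub>M borel"
    using sets by (subst measurable_cong_sets[OF sets_density refl]) (subst measurable_cong_sets[OF sets refl], measurable)
  have "continuous_on (- {0}) ?\<pi>" by (intro continuous_intros) auto
  then have o: "open (?\<pi> -` ball x e \<inter> - {0})"
    using continuous_open_preimage[of "- {0}" ?\<pi> "ball x e"] by (simp add: Int_commute open_Compl)
  \<comment> \<open>Half of \<open>x\<close> is interior to the unit ball and away from
    \<open>0\<close>, so the density is the constant \<open>dim V\<close> around it.\<close>
  have hx: "x /\<^sub>R 2 \<in> (?\<pi> -` ball x e \<inter> - {0}) \<inter> ball 0 1"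
    using x e by auto
  have "open ((?\<pi> -` ball x e \<inter> - {0}) \<inter> ball 0 1)" by (rule open_Int[OF o open_ball])
  then have "\<forall>y\<in>(?\<pi> -` ball x e \<inter> - {0}) \<inter> ball 0 1. \<exists>r>0. ball y r \<subseteq> (?\<pi> -` ball x e \<inter> - {0}) \<inter> ball 0 1"
    by (simp only: open_contains_ball)
  from bspec[OF this hx] obtain r where
    r: "r > 0" "ball (x /\<^sub>R 2) r \<subseteq> (?\<pi> -` ball x e \<inter> - {0}) \<inter> ball 0 1"
    by (elim exE conjE) (rule that; assumption)
  have dim: "0 < dim V"
    using x dim_eq_0[of V] by (cases "dim V = 0") auto
  let ?W = "ball (x /\<^sub>R 2) r \<inter> V"
  have Wb: "?W \<in> sets borel" using closed_subspace[OF V] by auto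
  have sub: "?W \<subseteq> ?\<pi> -` ?T"
  proof
    fix y assume y: "y \<in> ?W"
    then have "y \<noteq> 0" "?\<pi> y \<in> ball x e" using r(2) by auto
    moreover have "?\<pi> y \<in> V" using y subspace_scale[OF V] by auto
    ultimately show "y \<in> ?\<pi> -` ?T" by simp
  qed
  have "0 < ennreal (real (dim V)) * emeasure (subspace_lborel V) ?W"
    using subspace_lborel_pos[OF V subspace_scale[OF V x(1), of "inverse 2"] r(1)] dim
    by (simp add: ennreal_zero_less_mult_iff)
  also have "\<dots> = (\<integral>\<^sup>+y. ennreal (real (dim V)) * indicator ?W y \<partial>subspace_lborel V)"
    using Wb sets by (subst nn_integral_cmult_indicator) auto
  also have "\<dots> \<le> (\<integral>\<^sup>+y. ?g y * indicator (?\<pi> -` ?T \<inter> space (density (subspace_lborel V) ?g)) y \<partial>subspace_lborel V)"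
    using sub r(2) sets_eq_imp_space_eq[OF sets]
    by (intro nn_integral_mono) (auto simp: indicator_def subset_iff)
  also have "\<dots> = emeasure (density (subspace_lborel V) ?g) (?\<pi> -` ?T \<inter> space (density (subspace_lborel V) ?g))"
  proof (rule emeasure_density[symmetric])
    show "?g \<in> borel_measurable (subspace_lborel V)"
      by (intro borel_measurable_times_ennreal borel_measurable_const borel_measurable_indicator) (simp add: sets)
    show "?\<pi> -` ?T \<inter> space (density (subspace_lborel V) ?g) \<in> sets (subspace_lborel V)"
      using measurable_sets[OF pm Tb] by simp
  qed
  also have "\<dots> = emeasure (sphere_measure V) ?T"
    unfolding sphere_measure_def by (rule emeasure_distr[OF pm Tb, symmetric])
  finally show ?thesis .
qed

section \<open>Transport of the Haar measure to the Lie algebra\<close>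

locale carnot_problem = carnot_structure G
  for G :: "('a::{second_countable_topology, t2_space}, 'e::euclidean_space, 'g::euclidean_space) carnot_data" +
  fixes \<mu> :: "'a measure" and E :: "'a set"
  assumes haar: "haar_measure G \<mu>"
    and open_hyp: "\<And>X. X \<in> layer G 1 - {0} \<Longrightarrow>
           \<exists>p\<ge>2. open_map_at (layer_power_topology G p) euclidean (Gamma_map G p) (\<lambda>i\<in>{..<p}. X)"
    and mon: "monotone_set G \<mu> E"
begin

lemma sets_mu: "sets \<mu> = sets borel" and space_mu [simp]: "space \<mu> = UNIV"
  using haar by (auto simp: haar_measure_on_def sets_restrict_UNIV)

lemma mu_left: "B \<in> sets borel \<Longrightarrow> emeasure \<mu> ((\<lambda>y. x \<otimes>\<^bsub>G\<^esub> y) ` B) = emeasure \<mu> B"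
  and mu_compact: "compact K \<Longrightarrow> emeasure \<mu> K < \<infinity>"
  and mu_open: "open U \<Longrightarrow> U \<noteq> {} \<Longrightarrow> 0 < emeasure \<mu> U"
  using haar sets_mu by (auto simp: haar_measure_on_def)

lemma lg_borel: "lg \<in> borel \<rightarrow>\<^sub>M borel" and ex_borel: "ex \<in> borel \<rightarrow>\<^sub>M borel"
  by (intro borel_measurable_continuous_onI continuous_lg continuous_ex)+

lemma lg_measurable: "lg \<in> \<mu> \<rightarrow>\<^sub>M borel"
  using lg_borel measurable_cong_sets[OF sets_mu refl] by blast

definition muG :: "'g measure" where "muG = distr \<mu> borel lg"

lemma sets_muG: "sets muG = sets borel" by (simp add: muG_def)

lemma emeasure_muG: "B \<in> sets borel \<Longrightarrow> emeasure muG B = emeasure \<mu> (lg -` B)"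
  unfolding muG_def by (simp add: emeasure_distr[OF lg_measurable])

lemma vimage_lg: "lg -` B = ex ` B"
  by (auto simp: image_iff) (metis ex_lg)

lemma borel_vimage_lg: "B \<in> sets borel \<Longrightarrow> lg -` B \<in> sets borel"
  using measurable_sets[OF lg_borel] by auto

lemma borel_vimage_ex: "B \<in> sets borel \<Longrightarrow> ex -` B \<in> sets borel"
  using measurable_sets[OF ex_borel] by auto

lemma continuous_line: "continuous_on UNIV (\<lambda>t. x \<otimes>\<^bsub>G\<^esub> ex (t *\<^sub>R X))"
proof -
  have "continuous_on UNIV (\<lambda>t. ex (lg x \<star> (t *\<^sub>R X)))"
    by (intro continuous_on_compose2[OF continuous_ex[of UNIV]] L.continuous_on_mul continuous_intros) auto
  then show ?thesis by simp
qed

lemma continuous_right: "continuous_on UNIV (\<lambda>y. y \<otimes>\<^bsub>G\<^esub> ex X)"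
proof -
  have "continuous_on UNIV (\<lambda>y. ex (lg y \<star> X))"
    by (intro continuous_on_compose2[OF continuous_ex[of UNIV]] L.continuous_on_mul continuous_lg continuous_on_const) auto
  then show ?thesis by simp
qed

abbreviation sph :: "'g set" where "sph \<equiv> layer_sphere G"

lemma sphD: "X \<in> sph \<Longrightarrow> X \<in> V1" "X \<in> sph \<Longrightarrow> norm X = 1"
  by (auto simp: layer_sphere_def)

lemma slice:
  assumes nh: "normalized_haar G \<mu> X \<nu>" and C: "C \<in> sets borel"
  shows "emeasure \<mu> C = (\<integral>\<^sup>+x. emeasure lborel {t. x \<otimes>\<^bsub>G\<^esub> ex (t *\<^sub>R X) \<in> C} \<partial>\<nu>)" (is ?eq)
    and "(\<lambda>x. emeasure lborel {t. x \<otimes>\<^bsub>G\<^esub> ex (t *\<^sub>R X) \<in> C}) \<in> borel_measurable \<nu>"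
proof -
  let ?\<theta> = "\<lambda>(x, t). x \<otimes>\<^bsub>G\<^esub> ex (t *\<^sub>R X)"
  have \<theta>: "?\<theta> \<in> \<nu> \<Otimes>\<^sub>M lborel \<rightarrow>\<^sub>M \<mu>" "distr (\<nu> \<Otimes>\<^sub>M lborel) \<mu> ?\<theta> = \<mu>"
    using nh by (auto simp: normalized_haar_def)
  let ?A = "?\<theta> -` C \<inter> space (\<nu> \<Otimes>\<^sub>M lborel)"
  have A: "?A \<in> sets (\<nu> \<Otimes>\<^sub>M lborel)"
    using measurable_sets[OF \<theta>(1)] C sets_mu by blast
  have sec: "Pair x -` ?A = {t. x \<otimes>\<^bsub>G\<^esub> ex (t *\<^sub>R X) \<in> C}" if "x \<in> space \<nu>" for x
    using that by (auto simp: space_pair_measure)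
  have "emeasure \<mu> C = emeasure (distr (\<nu> \<Otimes>\<^sub>M lborel) \<mu> ?\<theta>) C" using \<theta>(2) by simp
  also have "\<dots> = emeasure (\<nu> \<Otimes>\<^sub>M lborel) ?A"
    using C sets_mu by (intro emeasure_distr[OF \<theta>(1)]) simp
  also have "\<dots> = (\<integral>\<^sup>+x. emeasure lborel (Pair x -` ?A) \<partial>\<nu>)"
    by (rule lborel.emeasure_pair_measure_alt[OF A])
  also have "\<dots> = (\<integral>\<^sup>+x. emeasure lborel {t. x \<otimes>\<^bsub>G\<^esub> ex (t *\<^sub>R X) \<in> C} \<partial>\<nu>)"
    by (intro nn_integral_cong) (simp only: sec)
  finally show ?eq .
  have "(\<lambda>x. emeasure lborel (Pair x -` ?A)) \<in> borel_measurable \<nu>"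
    by (rule lborel.measurable_emeasure_Pair[OF A])
  then show "(\<lambda>x. emeasure lborel {t. x \<otimes>\<^bsub>G\<^esub> ex (t *\<^sub>R X) \<in> C}) \<in> borel_measurable \<nu>"
    by (rule measurable_cong[THEN iffD1, rotated]) (simp only: sec)
qed

lemma AE_slice:
  assumes nh: "normalized_haar G \<mu> X \<nu>" and N: "N \<in> sets borel" "emeasure \<mu> N = 0"
  shows "AE x in \<nu>. AE t in lborel. x \<otimes>\<^bsub>G\<^esub> ex (t *\<^sub>R X) \<notin> N"
proof -
  have "AE x in \<nu>. emeasure lborel {t. x \<otimes>\<^bsub>G\<^esub> ex (t *\<^sub>R X) \<in> N} = 0"
    using slice[OF nh N(1)] N(2) by (simp add: nn_integral_0_iff_AE)
  then show ?thesis
  proof eventually_elim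
    case (elim x)
    from measurable_sets[OF borel_measurable_continuous_onI[OF continuous_line] N(1)]
    have "{t. x \<otimes>\<^bsub>G\<^esub> ex (t *\<^sub>R X) \<in> N} \<in> null_sets lborel"
      using elim by (auto simp: vimage_def null_sets_def)
    then show ?case by (rule AE_I') auto
  qed
qed

lemma null_by_slices:
  assumes nh: "normalized_haar G \<mu> X \<nu>" and C: "C \<in> sets borel"
    and ae: "AE x in \<nu>. AE t in lborel. x \<otimes>\<^bsub>G\<^esub> ex (t *\<^sub>R X) \<notin> C"
  shows "emeasure \<mu> C = 0"
proof -
  have "AE x in \<nu>. emeasure lborel {t. x \<otimes>\<^bsub>G\<^esub> ex (t *\<^sub>R X) \<in> C} = 0"
    using ae
  proof eventually_elim
    case (elim x)
    then obtain N where N: "{t. \<not> x \<otimes>\<^bsub>G\<^esub> ex (t *\<^sub>R X) \<notin> C} \<subseteq> N" "emeasure lborel N = 0" "N \<in> sets lborel"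
      by (auto elim!: AE_E)
    then have "emeasure lborel {t. x \<otimes>\<^bsub>G\<^esub> ex (t *\<^sub>R X) \<in> C} \<le> emeasure lborel N"
      by (intro emeasure_mono) auto
    then show ?case using N(2) by simp
  qed
  then show ?thesis using slice[OF nh C] by (simp add: nn_integral_0_iff_AE)
qed

lemma normalized_haar_ex: "\<exists>\<nu>. \<forall>X\<in>sph. normalized_haar G \<mu> X (\<nu> X)"
  using mon unfolding monotone_set_def null_set_of_lines_def by (elim conjE exE) (rule exI)

text \<open>Right translation by \<open>ex X\<close> shifts the time on every line with the
  direction of \<open>X\<close>, and Lebesgue measure on each slice is shift invariant. The slice
  measures are those provided by the monotonicity hypothesis.\<close>

lemma right_inv:
  assumes C: "C \<in> sets borel" and X: "X \<in> V1"
  shows "emeasure \<mu> {y. y \<otimes>\<^bsub>G\<^esub> ex X \<in> C} = emeasure \<mu> C"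
proof (cases "X = 0")
  case False
  obtain \<nu> where nu: "\<forall>X\<in>sph. normalized_haar G \<mu> X (\<nu> X)" using normalized_haar_ex ..
  define Y where "Y = X /\<^sub>R norm X"
  have Y: "Y \<in> sph" "X = norm X *\<^sub>R Y"
    using False X L.subspace_V1 by (auto simp: Y_def layer_sphere_def subspace_scale)
  from measurable_sets[OF borel_measurable_continuous_onI[OF continuous_right] C]
  have D: "{y. y \<otimes>\<^bsub>G\<^esub> ex X \<in> C} \<in> sets borel" by (simp add: vimage_def)
  have "emeasure lborel {t. x \<otimes>\<^bsub>G\<^esub> ex (t *\<^sub>R Y) \<in> {y. y \<otimes>\<^bsub>G\<^esub> ex X \<in> C}} = emeasure lborel {t. x \<otimes>\<^bsub>G\<^esub> ex (t *\<^sub>R Y) \<in> C}" for x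
  proof -
    have "x \<otimes>\<^bsub>G\<^esub> ex (t *\<^sub>R Y) \<otimes>\<^bsub>G\<^esub> ex X = x \<otimes>\<^bsub>G\<^esub> ex ((norm X + t) *\<^sub>R Y)" for t
      by (subst Y(2)) (simp add: m_assoc ex_add[symmetric] add.commute)
    then have eq: "{t. x \<otimes>\<^bsub>G\<^esub> ex (t *\<^sub>R Y) \<in> {y. y \<otimes>\<^bsub>G\<^esub> ex X \<in> C}} = (+) (norm X) -` {t. x \<otimes>\<^bsub>G\<^esub> ex (t *\<^sub>R Y) \<in> C}"
      by auto
    from measurable_sets[OF borel_measurable_continuous_onI[OF continuous_line] C]
    have T: "{t. x \<otimes>\<^bsub>G\<^esub> ex (t *\<^sub>R Y) \<in> C} \<in> sets borel" by (simp add: vimage_def)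
    have "emeasure (distr lborel borel ((+) (norm X))) {t. x \<otimes>\<^bsub>G\<^esub> ex (t *\<^sub>R Y) \<in> C}
        = emeasure lborel ((+) (norm X) -` {t. x \<otimes>\<^bsub>G\<^esub> ex (t *\<^sub>R Y) \<in> C})"
      using T by (subst emeasure_distr) auto
    then show ?thesis unfolding eq by (simp add: lborel_distr_plus)
  qed
  then show ?thesis
    using slice(1)[OF bspec[OF nu Y(1)] D] slice(1)[OF bspec[OF nu Y(1)] C] by simp
qed simp

lemma Gamma_prd: "Gamma_map G p Xs = ex (L.prd p Xs (\<lambda>_. 1))"
  by (induction p) simp_all

lemma prd_const: "L.prd p (\<lambda>_. X) (\<lambda>_. 1) = real p *\<^sub>R X"
proof (induction p)
  case (Suc p)
  then show ?case using L.one_param[of "real p" X 1] by (simp add: add.commute)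
qed simp

lemma reach_open:
  assumes X: "X \<in> V1" "X \<noteq> 0"
  shows "\<exists>p\<ge>1. \<forall>\<delta>>0. \<exists>U. open U \<and> real p *\<^sub>R X \<in> U \<and> U \<subseteq> L.reach p X \<delta>"
proof -
  obtain p where p: "p \<ge> 2" "open_map_at (layer_power_topology G p) euclidean (Gamma_map G p) (\<lambda>i\<in>{..<p}. X)"
    using open_hyp[of X] X by auto
  have "\<exists>U. open U \<and> real p *\<^sub>R X \<in> U \<and> U \<subseteq> L.reach p X \<delta>" if \<delta>: "0 < \<delta>" for \<delta>
  proof -
    let ?O = "PiE {..<p} (\<lambda>_. V1 \<inter> ball X \<delta>)"
    have "openin (layer_power_topology G p) ?O"
      unfolding layer_power_topology_def by (subst openin_PiE) auto
    moreover have "(\<lambda>i\<in>{..<p}. X) \<in> ?O" using X \<delta> by auto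
    ultimately obtain V where V: "open V" "Gamma_map G p (\<lambda>i\<in>{..<p}. X) \<in> V" "V \<subseteq> Gamma_map G p ` ?O"
      using p(2) unfolding open_map_at_def by (metis open_openin)
    have "L.prd p (\<lambda>i\<in>{..<p}. X) (\<lambda>_. 1) = real p *\<^sub>R X"
      unfolding prd_const[symmetric] by (rule L.prd_cong) auto
    then have "real p *\<^sub>R X \<in> ex -` V" using V(2) by (simp add: Gamma_prd)
    moreover have "ex -` V \<subseteq> L.reach p X \<delta>"
    proof
      fix u assume "u \<in> ex -` V"
      then obtain Xs where Xs: "Xs \<in> ?O" "ex u = ex (L.prd p Xs (\<lambda>_. 1))"
        using V(3) by (auto simp: Gamma_prd)
      then have "u = L.prd p Xs (\<lambda>_. 1)" by (metis lg_ex)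
      moreover have "\<forall>i<p. Xs i \<in> V1 \<and> dist (Xs i) X < \<delta>"
        using Xs(1) by (auto simp: PiE_iff dist_commute)
      ultimately show "u \<in> L.reach p X \<delta>" unfolding L.reach_def by blast
    qed
    moreover have "open (ex -` V)" using V(1) by (rule open_vimage[OF _ continuous_ex])
    ultimately show ?thesis by blast
  qed
  with p(1) show ?thesis by (intro exI[of _ p]) auto
qed

lemma left_image: "(\<lambda>y. a \<otimes>\<^bsub>G\<^esub> y) ` B = {y. inv\<^bsub>G\<^esub> a \<otimes>\<^bsub>G\<^esub> y \<in> B}"
proof safe
  fix y assume "inv\<^bsub>G\<^esub> a \<otimes>\<^bsub>G\<^esub> y \<in> B"
  then show "y \<in> (\<lambda>y. a \<otimes>\<^bsub>G\<^esub> y) ` B"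
    by (intro image_eqI[of _ _ "inv\<^bsub>G\<^esub> a \<otimes>\<^bsub>G\<^esub> y"]) (simp_all add: m_assoc[symmetric])
qed (simp add: m_assoc[symmetric])

sublocale H: carnot_haar mul V1 bracket muG
proof (intro carnot_haar.intro carnot_haar_axioms.intro)
  show "carnot_law mul V1 bracket" by (rule L.carnot_law_axioms)
  show "sets muG = sets borel" by (rule sets_muG)
  show "emeasure muG K < \<infinity>" if "compact K" for K
  proof -
    have "compact (ex ` K)" by (rule compact_continuous_image[OF continuous_ex that])
    then show ?thesis using mu_compact that by (simp add: emeasure_muG vimage_lg compact_imp_closed)
  qed
  show "0 < emeasure muG U" if "open U" "U \<noteq> {}" for U
  proof -
    have "open (lg -` U)" by (rule open_vimage[OF that(1) continuous_lg])
    moreover have "lg -` U \<noteq> {}" using that(2) by (auto simp: vimage_lg)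
    ultimately show ?thesis using mu_open that(1) by (simp add: emeasure_muG)
  qed
  show "emeasure muG {x. a \<star> x \<in> B} = emeasure muG B" if B: "B \<in> sets borel" for a B
  proof -
    have b: "{x. a \<star> x \<in> B} \<in> sets borel"
      using measurable_sets[OF borel_measurable_continuous_onI[OF L.continuous_on_mul[OF continuous_on_const continuous_on_id]] B, of a]
      by (simp add: vimage_def)
    have "emeasure \<mu> ((\<lambda>y. inv\<^bsub>G\<^esub> (ex a) \<otimes>\<^bsub>G\<^esub> y) ` (lg -` B)) = emeasure \<mu> (lg -` B)"
      by (rule mu_left[OF borel_vimage_lg[OF B]])
    moreover have "(\<lambda>y. inv\<^bsub>G\<^esub> (ex a) \<otimes>\<^bsub>G\<^esub> y) ` (lg -` B) = lg -` {x. a \<star> x \<in> B}"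
      unfolding left_image by (auto simp: mul_def)
    ultimately show ?thesis using B b by (simp add: emeasure_muG)
  qed
  show "emeasure muG {x. x \<star> X \<in> B} = emeasure muG B" if B: "B \<in> sets borel" and X: "X \<in> V1" for X B
  proof -
    have b: "{x. x \<star> X \<in> B} \<in> sets borel"
      using measurable_sets[OF borel_measurable_continuous_onI[OF L.continuous_on_mul[OF continuous_on_id continuous_on_const]] B, of X]
      by (simp add: vimage_def)
    have "lg -` {x. x \<star> X \<in> B} = {y. y \<otimes>\<^bsub>G\<^esub> ex X \<in> lg -` B}" by (auto simp: mul_def)
    then show ?thesis using right_inv[OF borel_vimage_lg[OF B] X] B b by (simp add: emeasure_muG)
  qed
  show "V1 \<noteq> {0}" by (rule V1_nontrivial)
  show "\<exists>p\<ge>1. \<forall>\<delta>>0. \<exists>U. open U \<and> real p *\<^sub>R X \<in> U \<and> U \<subseteq> L.reach p X \<delta>" if "X \<in> V1" "X \<noteq> 0" for X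
    using that by (rule reach_open)
qed

end

context carnot_problem
begin

section \<open>Uniqueness of the line parameters\<close>

definition V2 :: "'g set" where "V2 = span (\<Union>i\<in>{2..step G}. layer G i)"

lemma perp_space_eq: "perp_space G X = {Y + Z | Y Z. Y \<in> V1 \<and> inner X Y = 0 \<and> Z \<in> V2}"
  by (simp add: perp_space_def V2_def)

text \<open>Such a \<open>w\<close> has two layer decompositions, \<open>A\<close> with the single
  entry \<open>w\<close> in layer 1 and \<open>B\<close> with zero there; uniqueness identifies
  them.\<close>

lemma V1_V2_disjoint:
  assumes "w \<in> V1" "w \<in> V2"
  shows "w = 0"
proof -
  define T where "T = {\<Sum>i\<in>{2..step G}. Y i | Y. \<forall>i\<in>{2..step G}. Y i \<in> layer G i}"
  have sub: "subspace (layer G i)" if "i \<in> {2..step G}" for i using subspace_layer that by auto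
  have "subspace T"
    unfolding subspace_def
  proof (intro conjI ballI allI)
    show "0 \<in> T" unfolding T_def using subspace_0[OF sub] by (intro CollectI exI[of _ "\<lambda>_. 0"]) auto
  next
    fix a b assume "a \<in> T" "b \<in> T"
    then obtain Y Y' where "a = (\<Sum>i\<in>{2..step G}. Y i)" "\<forall>i\<in>{2..step G}. Y i \<in> layer G i"
      "b = (\<Sum>i\<in>{2..step G}. Y' i)" "\<forall>i\<in>{2..step G}. Y' i \<in> layer G i" unfolding T_def by blast
    then show "a + b \<in> T"
      unfolding T_def using subspace_add[OF sub] by (intro CollectI exI[of _ "\<lambda>i. Y i + Y' i"]) (auto simp: sum.distrib)
  next
    fix c :: real and a assume "a \<in> T"
    then obtain Y where "a = (\<Sum>i\<in>{2..step G}. Y i)" "\<forall>i\<in>{2..step G}. Y i \<in> layer G i" unfolding T_def by blast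
    then show "c *\<^sub>R a \<in> T"
      unfolding T_def using subspace_scale[OF sub] by (intro CollectI exI[of _ "\<lambda>i. c *\<^sub>R Y i"]) (auto simp: scaleR_sum_right)
  qed
  moreover have "(\<Union>i\<in>{2..step G}. layer G i) \<subseteq> T"
  proof safe
    fix j v assume j: "j \<in> {2..step G}" and v: "v \<in> layer G j"
    have "v = (\<Sum>i\<in>{2..step G}. if i = j then v else 0)" using j by simp
    moreover have "\<forall>i\<in>{2..step G}. (if i = j then v else 0) \<in> layer G i" using v subspace_0[OF sub] by auto
    ultimately show "v \<in> T" unfolding T_def by blast
  qed
  ultimately have "V2 \<subseteq> T" unfolding V2_def by (intro span_minimal)
  then obtain Y where Y: "w = (\<Sum>i\<in>{2..step G}. Y i)" "\<forall>i\<in>{2..step G}. Y i \<in> layer G i"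
    using assms(2) unfolding T_def by blast
  define A where "A = (\<lambda>i\<in>{1..step G}. if i = 1 then w else 0)"
  define B where "B = (\<lambda>i\<in>{1..step G}. if i = 1 then 0 else Y i)"
  have ins: "{1..step G} = insert 1 {2..step G}" using layer_last(1) by auto
  have "A \<in> (\<Pi>\<^sub>E i\<in>{1..step G}. layer G i)"
    using assms(1) subspace_0[OF subspace_layer] by (auto simp: A_def)
  moreover have "B \<in> (\<Pi>\<^sub>E i\<in>{1..step G}. layer G i)"
    using Y(2) subspace_0[OF subspace_layer] by (auto simp: B_def)
  moreover have "w = (\<Sum>i=1..step G. A i)"
    using layer_last(1) by (simp add: A_def)
  moreover have "(\<Sum>i=1..step G. B i) = (\<Sum>i\<in>{2..step G}. Y i)"
  proof -
    have "B 1 = 0" using layer_last(1) by (simp add: B_def)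
    moreover have "(\<Sum>i\<in>{2..step G}. B i) = (\<Sum>i\<in>{2..step G}. Y i)"
      by (rule sum.cong) (auto simp: B_def)
    moreover have "(\<Sum>i\<in>insert 1 {2..step G}. B i) = B 1 + (\<Sum>i\<in>{2..step G}. B i)"
      by (rule sum.insert) auto
    ultimately show ?thesis unfolding ins by simp
  qed
  then have "w = (\<Sum>i=1..step G. B i)" using Y(1) by simp
  ultimately have "A = B" using layer_decomposition[of w] by blast
  then have "A 1 = B 1" by simp
  moreover have "1 \<in> {1..step G}" using layer_last(1) by auto
  then have "A 1 = w" "B 1 = 0" by (simp_all only: A_def B_def restrict_apply if_True simp_thms)
  ultimately show ?thesis by simp
qed

lemma ex_minus: "ex (- u) = inv\<^bsub>G\<^esub> (ex u)"
proof -
  have "ex (- u) \<otimes>\<^bsub>G\<^esub> ex u = \<one>\<^bsub>G\<^esub>" using ex_mul[of "- u" u] by simp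
  then show ?thesis by (metis inv_equality UNIV_I carrier_G)
qed

text \<open>The quotient of the two base points is \<open>ex ((t' - t) *\<^sub>R X)\<close> and lies
  in \<open>perp_group G X\<close>, a subgroup because it carries the Haar measure
  \<open>\<nu>\<close>. Orthogonality to \<open>X\<close> then forces \<open>t = t'\<close>.\<close>

lemma param_inj:
  assumes nh: "normalized_haar G \<mu> X \<nu>" and X: "X \<in> sph"
    and 1: "Y \<in> V1" "inner X Y = 0" "Z \<in> V2" and 2: "Y' \<in> V1" "inner X Y' = 0" "Z' \<in> V2"
    and eq: "(Y + Z) \<star> (t *\<^sub>R X) = (Y' + Z') \<star> (t' *\<^sub>R X)"
  shows "Y = Y' \<and> Z = Z' \<and> t = t'"
proof -
  have sV2: "subspace V2" by (simp add: V2_def)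
  have sg: "subgroup (perp_group G X) G"
    using nh by (simp add: normalized_haar_def haar_measure_on_def)
  let ?u = "Y + Z" and ?u' = "Y' + Z'"
  have mem: "ex ?u \<in> perp_group G X" "ex ?u' \<in> perp_group G X"
    unfolding perp_group_def perp_space_eq using 1 2 by blast+
  have "- ?u' \<star> ?u = - ?u' \<star> (?u \<star> (t *\<^sub>R X)) \<star> ((- t) *\<^sub>R X)"
    by (simp only: L.assoc L.one_param) simp
  also have "\<dots> = (t' - t) *\<^sub>R X"
    unfolding eq by (simp only: L.minus_left_assoc L.one_param) simp
  finally have d: "- ?u' \<star> ?u = (t' - t) *\<^sub>R X" .
  have "ex ((t' - t) *\<^sub>R X) = inv\<^bsub>G\<^esub> (ex ?u') \<otimes>\<^bsub>G\<^esub> ex ?u"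
    unfolding d[symmetric] by (simp only: ex_mul ex_minus)
  then have "ex ((t' - t) *\<^sub>R X) \<in> perp_group G X"
    using subgroup.m_closed[OF sg subgroup.m_inv_closed[OF sg mem(2)] mem(1)] by simp
  then have "(t' - t) *\<^sub>R X \<in> perp_space G X"
    unfolding perp_group_def using bij_ex by (simp add: inj_image_mem_iff bij_is_inj)
  then obtain A B where AB: "(t' - t) *\<^sub>R X = A + B" "A \<in> V1" "inner X A = 0" "B \<in> V2"
    unfolding perp_space_eq by blast
  have "B = (t' - t) *\<^sub>R X - A" using AB(1) by simp
  then have "B \<in> V1" using AB(2) sphD(1)[OF X] L.subspace_V1 by (simp add: subspace_diff subspace_scale)
  then have "B = 0" using V1_V2_disjoint AB(4) by blast
  then have "inner X ((t' - t) *\<^sub>R X) = 0" using AB by simp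
  then have t: "t = t'" using sphD(2)[OF X] by (auto simp: norm_eq_1)
  have "?u \<star> (t *\<^sub>R X) \<star> ((- t) *\<^sub>R X) = ?u' \<star> (t *\<^sub>R X) \<star> ((- t) *\<^sub>R X)" using eq t by simp
  then have u: "?u = ?u'" by (simp only: L.assoc L.one_param) simp
  then have "Y - Y' = Z' - Z" by (simp add: algebra_simps)
  moreover have "Y - Y' \<in> V1" "Z' - Z \<in> V2"
    using 1 2 L.subspace_V1 sV2 by (auto intro: subspace_diff)
  ultimately have "Y - Y' = 0" using V1_V2_disjoint by metis
  with t u show ?thesis by simp
qed

text \<open>Without measurability of this function the vanishing of the integral in \<^const>\<open>null_set_of_lines\<close>
  (then only a lower integral) would not yield a single direction with null slice.\<close>

lemma slice_measure_borel:
  assumes nu: "\<forall>X\<in>sph. normalized_haar G \<mu> X (\<nu> X)" and B: "B \<in> sets borel"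
  obtains f where "f \<in> borel_measurable borel" "\<And>X. X \<in> sph \<Longrightarrow> f X = emeasure (\<nu> X) {x \<in> perp_group G X. (X, x) \<in> B}"
proof -
  define S where "S = {p :: 'g \<times> 'g \<times> 'g \<times> real. fst p \<in> V1 \<and> norm (fst p) = 1 \<and> fst (snd p) \<in> V1 \<and>
      inner (fst p) (fst (snd p)) = 0 \<and> fst (snd (snd p)) \<in> V2}"
  define \<theta> where "\<theta> = (\<lambda>p :: 'g \<times> 'g \<times> 'g \<times> real. (fst p, (fst (snd p) + fst (snd (snd p))) \<star> (snd (snd (snd p)) *\<^sub>R fst p)))"
  \<comment> \<open>Each parameter in \<open>B\<close> is thickened by a time interval of length 1,
    so the \<open>\<mu>\<close>-measure of the resulting tube is the slice measure of its
    base.\<close>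
  define A where "A = {p :: 'g \<times> 'g \<times> 'g \<times> real. (fst p, ex (fst (snd p) + fst (snd (snd p)))) \<in> B \<and> snd (snd (snd p)) \<in> {0..1}}"
  have cV: "closed V1" "closed V2" using closed_subspace[OF L.subspace_V1] by (auto simp: V2_def)
  have Scl: "closed S"
    unfolding S_def
    by (intro closed_Collect_conj closed_Collect_eq continuous_intros
        closed_vimage[OF cV(1), unfolded vimage_def] closed_vimage[OF cV(2), unfolded vimage_def])
  have \<theta>c: "continuous_on S \<theta>"
    unfolding \<theta>_def by (intro continuous_intros L.continuous_on_mul)
  have \<theta>i: "inj_on \<theta> S"
  proof (rule inj_onI)
    fix p p' assume p: "p \<in> S" and p': "p' \<in> S" and eq: "\<theta> p = \<theta> p'"
    obtain X Y Z t where pp: "p = (X, Y, Z, t)" by (metis prod_cases4)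
    obtain X' Y' Z' t' where pp': "p' = (X', Y', Z', t')" by (metis prod_cases4)
    have X: "X' = X" using eq by (simp add: \<theta>_def pp pp')
    have s: "X \<in> sph" using p by (simp add: S_def pp layer_sphere_def)
    have "Y = Y' \<and> Z = Z' \<and> t = t'"
      using p p' eq X by (intro param_inj[OF bspec[OF nu s] s]) (auto simp: S_def \<theta>_def pp pp')
    then show "p = p'" using X pp pp' by simp
  qed
  have Ab: "A \<in> sets borel"
  proof -
    have "continuous_on UNIV (\<lambda>p :: 'g \<times> 'g \<times> 'g \<times> real. (fst p, ex (fst (snd p) + fst (snd (snd p)))))"
      by (intro continuous_on_Pair continuous_on_compose2[OF continuous_ex[of UNIV]] continuous_intros) auto
    from measurable_sets[OF borel_measurable_continuous_onI[OF this] B]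
    have a: "{p :: 'g \<times> 'g \<times> 'g \<times> real. (fst p, ex (fst (snd p) + fst (snd (snd p)))) \<in> B} \<in> sets borel"
      by (simp add: vimage_def)
    have "closed ((\<lambda>p :: 'g \<times> 'g \<times> 'g \<times> real. snd (snd (snd p))) -` {0..1})"
      by (intro closed_vimage continuous_intros)
    from sets.Int[OF a borel_closed[OF this]] show ?thesis
      by (simp add: A_def vimage_def Int_def)
  qed
  \<comment> \<open>The tubes of all directions together form one Borel set in the product of
    directions and group, so the measure of its sections is a measurable function of the
    direction.\<close>
  define J where "J = \<theta> ` (A \<inter> S)"
  have J: "J \<in> sets borel" unfolding J_def by (rule borel_injective_image[OF Scl \<theta>c \<theta>i Ab])
  have Jp: "J \<in> sets (borel \<Otimes>\<^sub>M muG)"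
    unfolding sets_pair_measure_cong[OF refl sets_muG] borel_prod by (rule J)
  define f where "f = (\<lambda>X. emeasure muG (Pair X -` J))"
  have "f \<in> borel_measurable borel"
    unfolding f_def by (rule H.mu.measurable_emeasure_Pair[OF Jp])
  moreover have "f X = emeasure (\<nu> X) {x \<in> perp_group G X. (X, x) \<in> B}" if X: "X \<in> sph" for X
  proof -
    have nh: "normalized_haar G \<mu> X (\<nu> X)" using nu X by blast
    have sp: "space (\<nu> X) = perp_group G X" and sn: "sets (\<nu> X) = sets (restrict_space borel (perp_group G X))"
      using nh by (auto simp: normalized_haar_def haar_measure_on_def)
    have JX: "Pair X -` J \<in> sets borel"
      using sets_Pair1[OF Jp, of X] sets_muG by simp
    let ?H = "{x \<in> perp_group G X. (X, x) \<in> B}"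
    have "continuous_on UNIV (\<lambda>x :: 'a. (X, x))" by (intro continuous_intros)
    from measurable_sets[OF borel_measurable_continuous_onI[OF this] B]
    have "{x. (X, x) \<in> B} \<in> sets borel" by (simp add: vimage_def)
    then have H: "?H \<in> sets (\<nu> X)"
      unfolding sn sets_restrict_space by (intro image_eqI[of _ _ "{x. (X, x) \<in> B}"]) auto
    have sl: "emeasure lborel {t. x \<otimes>\<^bsub>G\<^esub> ex (t *\<^sub>R X) \<in> lg -` (Pair X -` J)} = indicator ?H x" if x: "x \<in> space (\<nu> X)" for x
    proof -
      obtain Y Z where YZ: "x = ex (Y + Z)" "Y \<in> V1" "inner X Y = 0" "Z \<in> V2"
        using x unfolding sp perp_group_def perp_space_eq by blast
      have iff: "(X, (Y + Z) \<star> (t *\<^sub>R X)) \<in> J \<longleftrightarrow> (X, x) \<in> B \<and> t \<in> {0..1}" for t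
      proof
        assume "(X, (Y + Z) \<star> (t *\<^sub>R X)) \<in> J"
        then obtain p where p: "p \<in> A" "p \<in> S" "\<theta> p = (X, (Y + Z) \<star> (t *\<^sub>R X))" unfolding J_def by auto
        obtain X' Y' Z' t' where pp: "p = (X', Y', Z', t')" by (metis prod_cases4)
        have X': "X' = X" using p(3) by (simp add: \<theta>_def pp)
        have "Y' = Y \<and> Z' = Z \<and> t' = t"
          using p YZ X' by (intro param_inj[OF nh X]) (auto simp: S_def \<theta>_def pp)
        then show "(X, x) \<in> B \<and> t \<in> {0..1}" using p(1) X' YZ(1) by (simp add: A_def pp)
      next
        assume a: "(X, x) \<in> B \<and> t \<in> {0..1}"
        have "(X, Y, Z, t) \<in> A \<inter> S"
          using a YZ X by (auto simp: A_def S_def layer_sphere_def)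
        moreover have "\<theta> (X, Y, Z, t) = (X, (Y + Z) \<star> (t *\<^sub>R X))" by (simp add: \<theta>_def)
        ultimately show "(X, (Y + Z) \<star> (t *\<^sub>R X)) \<in> J" unfolding J_def by (metis image_eqI)
      qed
      have "{t. x \<otimes>\<^bsub>G\<^esub> ex (t *\<^sub>R X) \<in> lg -` (Pair X -` J)} = {t. (X, (Y + Z) \<star> (t *\<^sub>R X)) \<in> J}"
        by (simp add: YZ(1) mul_def)
      also have "\<dots> = (if (X, x) \<in> B then {0..1} else {})" by (auto simp: iff)
      finally show ?thesis using x by (auto simp: sp)
    qed
    have "f X = (\<integral>\<^sup>+x. emeasure lborel {t. x \<otimes>\<^bsub>G\<^esub> ex (t *\<^sub>R X) \<in> lg -` (Pair X -` J)} \<partial>\<nu> X)"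
      unfolding f_def emeasure_muG[OF JX] by (rule slice(1)[OF nh borel_vimage_lg[OF JX]])
    also have "\<dots> = (\<integral>\<^sup>+x. indicator ?H x \<partial>\<nu> X)"
      by (intro nn_integral_cong sl)
    also have "\<dots> = emeasure (\<nu> X) ?H" by (rule nn_integral_indicator[OF H])
    finally show ?thesis .
  qed
  ultimately show thesis by (rule that)
qed

text \<open>The integrand being measurable, it vanishes for almost every direction, and every patch
  of the sphere has positive measure.\<close>

lemma good_direction_dense:
  assumes nu: "\<forall>X\<in>sph. normalized_haar G \<mu> X (\<nu> X)" and B: "B \<in> sets borel"
    and int: "(\<integral>\<^sup>+X\<in>sph. emeasure (\<nu> X) {x \<in> perp_group G X. (X, x) \<in> B} \<partial>sphere_measure V1) = 0"
    and X0: "X0 \<in> sph" and e: "0 < e"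
  shows "\<exists>X\<in>sph. dist X0 X < e \<and> emeasure (\<nu> X) {x \<in> perp_group G X. (X, x) \<in> B} = 0"
proof (rule ccontr)
  assume neg: "\<not> ?thesis"
  obtain f where f: "f \<in> borel_measurable borel" "\<And>X. X \<in> sph \<Longrightarrow> f X = emeasure (\<nu> X) {x \<in> perp_group G X. (X, x) \<in> B}"
    by (rule slice_measure_borel[OF nu B]) (rule that)
  have ss: "sets (sphere_measure V1) = sets borel" by (simp add: sphere_measure_def)
  have sph_eq: "sph = {y \<in> V1. norm y = 1}" by (simp add: layer_sphere_def)
  have "sph = V1 \<inter> sphere 0 1" by (auto simp: sph_eq)
  then have sphb: "sph \<in> sets borel" using closed_subspace[OF L.subspace_V1] by auto
  let ?T = "ball X0 e \<inter> {y \<in> V1. norm y = 1}"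
  have T: "?T \<in> sets borel" using sphb unfolding sph_eq by auto
  have "(\<integral>\<^sup>+X. f X * indicator sph X \<partial>sphere_measure V1) = (\<integral>\<^sup>+X\<in>sph. emeasure (\<nu> X) {x \<in> perp_group G X. (X, x) \<in> B} \<partial>sphere_measure V1)"
    by (intro nn_integral_cong) (auto simp: f(2) indicator_def)
  then have i: "(\<integral>\<^sup>+X. f X * indicator sph X \<partial>sphere_measure V1) = 0" using int by simp
  have m: "(\<lambda>X. f X * indicator sph X) \<in> borel_measurable (sphere_measure V1)"
    unfolding measurable_cong_sets[OF ss refl] using f(1) sphb
    by (intro borel_measurable_times_ennreal borel_measurable_indicator) auto
  have "AE X in sphere_measure V1. f X * indicator sph X = 0"
    by (rule nn_integral_0_iff_AE[OF m, THEN iffD1, OF i])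
  then have "AE X in sphere_measure V1. X \<notin> ?T"
  proof eventually_elim
    case (elim X)
    show ?case
    proof
      assume "X \<in> ?T"
      then have "X \<in> sph" "dist X0 X < e" by (auto simp: sph_eq)
      with elim f(2) neg show False by auto
    qed
  qed
  then have "emeasure (sphere_measure V1) ?T = 0"
    using T ss by (subst (asm) AE_iff_null_sets[symmetric]) auto
  with sphere_measure_pos[OF L.subspace_V1 sphD(1)[OF X0] sphD(2)[OF X0] e] show False by simp
qed

text \<open>On almost every slice the indicator of \<open>E0\<close> agrees with a monotone
  \<open>h\<close> at the times \<open>t\<close>, \<open>t + a\<close> and
  \<open>t + (a + b)\<close> simultaneously, for almost every \<open>t\<close>. The middle value of
  \<open>h\<close> lies between the outer ones, so equal outer indicators force the middle
  one.\<close>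

lemma good_pattern:
  assumes nh: "normalized_haar G \<mu> X \<nu>" and lm: "AE x in \<nu>. line_monotone G E X x"
    and N: "N \<in> null_sets \<mu>" "\<And>y. y \<notin> N \<Longrightarrow> y \<in> E \<longleftrightarrow> y \<in> E0" and E0: "E0 \<in> sets borel"
    and a: "0 \<le> a" and b: "0 \<le> b"
  shows "AE u in muG.
        (u \<in> ex -` E0 \<and> u \<star> ((a + b) *\<^sub>R X) \<in> ex -` E0 \<longrightarrow> u \<star> (a *\<^sub>R X) \<in> ex -` E0) \<and>
        (u \<notin> ex -` E0 \<and> u \<star> ((a + b) *\<^sub>R X) \<notin> ex -` E0 \<longrightarrow> u \<star> (a *\<^sub>R X) \<notin> ex -` E0)"
proof -
  let ?l = "\<lambda>y s. y \<otimes>\<^bsub>G\<^esub> ex (s *\<^sub>R X)"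
  define C where "C = {y. \<not> ((y \<in> E0 \<and> ?l y (a + b) \<in> E0 \<longrightarrow> ?l y a \<in> E0) \<and> (y \<notin> E0 \<and> ?l y (a + b) \<notin> E0 \<longrightarrow> ?l y a \<notin> E0))}"
  have lb: "{y. ?l y s \<in> E0} \<in> sets borel" for s
    using measurable_sets[OF borel_measurable_continuous_onI[OF continuous_right] E0] by (simp add: vimage_def)
  have "C = (E0 \<inter> {y. ?l y (a + b) \<in> E0} - {y. ?l y a \<in> E0}) \<union> ({y. ?l y a \<in> E0} - E0 - {y. ?l y (a + b) \<in> E0})"
    by (auto simp: C_def)
  then have C: "C \<in> sets borel" using lb E0 by auto
  have Nb: "N \<in> sets borel" "emeasure \<mu> N = 0" using N(1) sets_mu by (auto simp: null_sets_def)
  have "emeasure \<mu> C = 0"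
  proof (rule null_by_slices[OF nh C])
    show "AE x in \<nu>. AE t in lborel. ?l x t \<notin> C"
      using lm AE_slice[OF nh Nb]
    proof eventually_elim
      case (elim x)
      then obtain h :: "real \<Rightarrow> real" where h: "mono h \<or> antimono h" "AE t in lborel. indicator E (?l x t) = h t"
        unfolding line_monotone_def by blast
      have P: "AE t in lborel. indicator E0 (?l x t) = h t"
        using h(2) elim(2) by eventually_elim (use N(2) in \<open>auto simp: indicator_def split: if_splits\<close>)
      have "AE t in lborel. indicator E0 (?l x (t + a)) = h (t + a)" "AE t in lborel. indicator E0 (?l x (t + (a + b))) = h (t + (a + b))"
        by (rule AE_lborel_shift[OF P])+
      with P show "AE t in lborel. ?l x t \<notin> C"
      proof eventually_elim
        case (elim t)
        have add: "?l (?l x t) s = ?l x (t + s)" for s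
          by (simp add: m_assoc ex_add)
        have "h t \<le> h (t + a) \<and> h (t + a) \<le> h (t + (a + b)) \<or> h (t + a) \<le> h t \<and> h (t + (a + b)) \<le> h (t + a)"
          using h(1) a b by (auto simp: mono_def antimono_def)
        with elim show ?case
          unfolding C_def by (auto simp: add indicator_def split: if_splits)
      qed
    qed
  qed
  then have "ex -` C \<in> null_sets muG"
    using C emeasure_muG[OF borel_vimage_ex[OF C]] borel_vimage_ex[OF C] by (auto simp: null_sets_def sets_muG vimage_def)
  then show ?thesis
    by (rule AE_I') (auto simp: C_def)
qed

lemma sph_scale: "X \<in> V1 \<Longrightarrow> X \<noteq> 0 \<Longrightarrow> X /\<^sub>R norm X \<in> sph"
  using L.subspace_V1 by (auto simp: layer_sphere_def subspace_scale)

lemma good_directions: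
  assumes N: "N \<in> null_sets \<mu>" "\<And>y. y \<notin> N \<Longrightarrow> y \<in> E \<longleftrightarrow> y \<in> E0" and E0: "E0 \<in> sets borel"
  obtains Q where "Q \<subseteq> V1" "V1 \<subseteq> closure Q"
    "\<forall>X\<in>Q. \<forall>s>0. \<forall>t>0. AE u in muG.
        (u \<in> ex -` E0 \<and> u \<star> ((s + t) *\<^sub>R X) \<in> ex -` E0 \<longrightarrow> u \<star> (s *\<^sub>R X) \<in> ex -` E0) \<and>
        (u \<notin> ex -` E0 \<and> u \<star> ((s + t) *\<^sub>R X) \<notin> ex -` E0 \<longrightarrow> u \<star> (s *\<^sub>R X) \<notin> ex -` E0)"
proof -
  obtain \<nu> B where nu: "\<forall>X\<in>sph. normalized_haar G \<mu> X (\<nu> X)" and B: "B \<in> sets borel"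
    and bad: "{(X, x) \<in> line_parameters G. \<not> line_monotone G E X x} \<subseteq> B"
    and int: "(\<integral>\<^sup>+X\<in>sph. emeasure (\<nu> X) {x \<in> perp_group G X. (X, x) \<in> B} \<partial>sphere_measure V1) = 0"
    using mon unfolding monotone_set_def null_set_of_lines_def by (elim conjE exE) (rule that; assumption)
  define good where "good = {X \<in> sph. emeasure (\<nu> X) {x \<in> perp_group G X. (X, x) \<in> B} = 0}"
  \<comment> \<open>Multiples turn unit directions into a dense subset of all of \<open>V1\<close>:
    steps \<open>s\<close> along \<open>c *\<^sub>R Y\<close> are steps \<open>s * c\<close> along
    \<open>Y\<close>. The factor \<open>c = 0\<close> is allowed, which puts \<open>0\<close> itself
    into \<open>Q\<close>.\<close>
  define Q where "Q = {c *\<^sub>R X | c X. 0 \<le> c \<and> X \<in> good}"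
  have dense: "\<exists>X\<in>good. dist X0 X < e" if "X0 \<in> sph" "0 < e" for X0 e
    using good_direction_dense[OF nu B int that] by (auto simp: good_def)
  have "Q \<subseteq> V1" using sphD(1) L.subspace_V1 by (auto simp: Q_def good_def subspace_scale)
  moreover have "V1 \<subseteq> closure Q"
  proof
    fix X assume X: "X \<in> V1"
    show "X \<in> closure Q"
      unfolding closure_approachable
    proof (intro allI impI)
      fix e :: real assume e: "0 < e"
      show "\<exists>y\<in>Q. dist y X < e"
      proof (cases "X = 0")
        case True
        obtain X1 where "X1 \<in> V1" "X1 \<noteq> 0" using V1_nontrivial subspace_0[OF L.subspace_V1] by blast
        from dense[OF sph_scale[OF this] zero_less_one] obtain Y where "Y \<in> good" by blast
        then have "0 *\<^sub>R Y \<in> Q" unfolding Q_def by blast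
        then show ?thesis using True e by (intro bexI[of _ "0 *\<^sub>R Y"]) auto
      next
        case False
        have "0 < e / norm X" using False e by simp
        from dense[OF sph_scale[OF X False] this] obtain Y where Y: "Y \<in> good" "dist (X /\<^sub>R norm X) Y < e / norm X" by blast
        have "norm X *\<^sub>R Y \<in> Q" unfolding Q_def using Y(1) by fastforce
        moreover have "dist (norm X *\<^sub>R Y) X < e"
        proof -
          have "X = norm X *\<^sub>R (X /\<^sub>R norm X)" using False by simp
          then have "dist (norm X *\<^sub>R Y) X = norm (norm X *\<^sub>R Y - norm X *\<^sub>R (X /\<^sub>R norm X))" by (metis dist_norm)
          also have "\<dots> = norm X * dist (X /\<^sub>R norm X) Y"
            unfolding scaleR_diff_right[symmetric] by (simp only: norm_scaleR dist_norm norm_minus_commute abs_norm_cancel)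
          also have "\<dots> < e" using Y(2) False by (simp add: field_simps)
          finally show ?thesis .
        qed
        ultimately show ?thesis by blast
      qed
    qed
  qed
  moreover have "\<forall>X\<in>Q. \<forall>s>0. \<forall>t>0. AE u in muG.
        (u \<in> ex -` E0 \<and> u \<star> ((s + t) *\<^sub>R X) \<in> ex -` E0 \<longrightarrow> u \<star> (s *\<^sub>R X) \<in> ex -` E0) \<and>
        (u \<notin> ex -` E0 \<and> u \<star> ((s + t) *\<^sub>R X) \<notin> ex -` E0 \<longrightarrow> u \<star> (s *\<^sub>R X) \<notin> ex -` E0)"
  proof (intro ballI allI impI)
    fix X and s t :: real assume X: "X \<in> Q" and s: "0 < s" and t: "0 < t"
    obtain c Y where cY: "X = c *\<^sub>R Y" "0 \<le> c" "Y \<in> good" using X Q_def by blast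
    have Y: "Y \<in> sph" "emeasure (\<nu> Y) {x \<in> perp_group G Y. (Y, x) \<in> B} = 0" using cY(3) by (auto simp: good_def)
    have nh: "normalized_haar G \<mu> Y (\<nu> Y)" using nu Y(1) by blast
    have sp: "space (\<nu> Y) = perp_group G Y" and sn: "sets (\<nu> Y) = sets (restrict_space borel (perp_group G Y))"
      using nh by (auto simp: normalized_haar_def haar_measure_on_def)
    have "continuous_on UNIV (\<lambda>x :: 'a. (Y, x))" by (intro continuous_intros)
    from measurable_sets[OF borel_measurable_continuous_onI[OF this] B]
    have "{x. (Y, x) \<in> B} \<in> sets borel" by (simp add: vimage_def)
    then have "{x \<in> perp_group G Y. (Y, x) \<in> B} \<in> sets (\<nu> Y)"
      unfolding sn sets_restrict_space by (intro image_eqI[of _ _ "{x. (Y, x) \<in> B}"]) auto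
    then have "{x \<in> perp_group G Y. (Y, x) \<in> B} \<in> null_sets (\<nu> Y)" using Y(2) by (simp add: null_sets_def)
    then have "AE x in \<nu> Y. line_monotone G E Y x"
    proof (rule AE_I')
      show "{x \<in> space (\<nu> Y). \<not> line_monotone G E Y x} \<subseteq> {x \<in> perp_group G Y. (Y, x) \<in> B}"
        using bad Y(1) unfolding sp line_parameters_def by auto
    qed
    from good_pattern[OF nh this N E0, of "s * c" "t * c"] cY s t
    show "AE u in muG.
        (u \<in> ex -` E0 \<and> u \<star> ((s + t) *\<^sub>R X) \<in> ex -` E0 \<longrightarrow> u \<star> (s *\<^sub>R X) \<in> ex -` E0) \<and>
        (u \<notin> ex -` E0 \<and> u \<star> ((s + t) *\<^sub>R X) \<notin> ex -` E0 \<longrightarrow> u \<star> (s *\<^sub>R X) \<notin> ex -` E0)"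
      by (simp add: distrib_right)
  qed
  ultimately show thesis by (rule that)
qed

end

context carnot_problem
begin

text \<open>Seen from the point with the smaller time, the hypothesis says that the times spent in
  \<open>S\<close> form an interval, and the line is its continuous image.\<close>

lemma connected_line_part:
  assumes lc: "\<And>x r s. 0 < r \<Longrightarrow> 0 < s \<Longrightarrow> x \<in> S \<Longrightarrow> x \<star> ((r + s) *\<^sub>R X) \<in> S \<Longrightarrow> x \<star> (r *\<^sub>R X) \<in> S"
  shows "connected (lg -` S \<inter> line G X x)"
proof -
  let ?T = "{t. lg (x \<otimes>\<^bsub>G\<^esub> ex (t *\<^sub>R X)) \<in> S}"
  have "is_interval ?T"
    unfolding is_interval_1
  proof (intro ballI allI impI)
    fix t1 t2 t assume t1: "t1 \<in> ?T" and t2: "t2 \<in> ?T" and t: "t1 \<le> t \<and> t \<le> t2"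
    let ?y = "lg x \<star> (t1 *\<^sub>R X)"
    have l: "lg (x \<otimes>\<^bsub>G\<^esub> ex (u *\<^sub>R X)) = ?y \<star> ((u - t1) *\<^sub>R X)" for u
      by (simp only: L.assoc L.one_param) (simp add: mul_def)
    show "t \<in> ?T"
    proof (cases "t = t1 \<or> t = t2")
      case False
      have "?y \<in> S" using t1 l[of t1] by simp
      moreover have "?y \<star> ((t - t1 + (t2 - t)) *\<^sub>R X) \<in> S" using t2 l[of t2] by simp
      ultimately have "?y \<star> ((t - t1) *\<^sub>R X) \<in> S" using t False by (intro lc[of "t - t1" "t2 - t"]) auto
      then show ?thesis using l[of t] by simp
    qed (use t1 t2 in auto)
  qed
  then have "connected ?T" by (rule is_interval_connected)
  then have "connected ((\<lambda>t. x \<otimes>\<^bsub>G\<^esub> ex (t *\<^sub>R X)) ` ?T)"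
    by (intro connected_continuous_image continuous_on_subset[OF continuous_line]) auto
  moreover have "(\<lambda>t. x \<otimes>\<^bsub>G\<^esub> ex (t *\<^sub>R X)) ` ?T = lg -` S \<inter> line G X x"
    by (auto simp: line_def)
  ultimately show ?thesis by simp
qed

lemma completion_emeasure:
  assumes S: "S \<in> sets (completion \<mu>)" and S0: "S0 \<in> sets borel"
    and N: "N \<in> null_sets \<mu>" "\<And>y. y \<notin> N \<Longrightarrow> y \<in> S \<longleftrightarrow> y \<in> S0" and U: "open U"
  shows "emeasure (completion \<mu>) (S \<inter> U) = emeasure muG (ex -` S0 \<inter> ex -` U)"
proof -
  have "AE y in completion \<mu>. y \<notin> N"
    using AE_not_in[OF N(1)] by (rule AE_completion)
  then have "AE y in completion \<mu>. y \<in> S \<inter> U \<longleftrightarrow> y \<in> S0 \<inter> U"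
    by eventually_elim (use N(2) in auto)
  moreover have b: "S0 \<inter> U \<in> sets \<mu>" "U \<in> sets \<mu>" using S0 U by (auto simp: sets_mu)
  ultimately have "emeasure (completion \<mu>) (S \<inter> U) = emeasure (completion \<mu>) (S0 \<inter> U)"
    using S by (intro emeasure_eq_AE) auto
  also have "\<dots> = emeasure \<mu> (S0 \<inter> U)" using b by simp
  also have "\<dots> = emeasure \<mu> (lg -` (ex -` S0 \<inter> ex -` U))" by (simp add: vimage_def Int_def)
  also have "\<dots> = emeasure muG (ex -` S0 \<inter> ex -` U)"
    using S0 U borel_vimage_ex by (intro emeasure_muG[symmetric] sets.Int) auto
  finally show ?thesis .
qed

theorem representatives:
  "precisely_monotone G (measure_interior \<mu> E) \<and> measure_representative \<mu> E (measure_interior \<mu> E) \<and>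
   precisely_monotone G (measure_support \<mu> E) \<and> measure_representative \<mu> E (measure_support \<mu> E)"
proof -
  have Ec: "E \<in> sets (completion \<mu>)" using mon by (simp add: monotone_set_def)
  then obtain E0 M N where EN: "E = E0 \<union> M" "M \<subseteq> N" "N \<in> null_sets \<mu>" "E0 \<in> sets \<mu>"
    by (rule sets_completionE)
  have E0: "E0 \<in> sets borel" using EN(4) sets_mu by simp
  have N: "N \<in> null_sets \<mu>" "\<And>y. y \<notin> N \<Longrightarrow> y \<in> E \<longleftrightarrow> y \<in> E0" using EN by auto
  obtain Q where Q: "Q \<subseteq> V1" "V1 \<subseteq> closure Q"
    "\<forall>X\<in>Q. \<forall>s>0. \<forall>t>0. AE u in muG.
        (u \<in> ex -` E0 \<and> u \<star> ((s + t) *\<^sub>R X) \<in> ex -` E0 \<longrightarrow> u \<star> (s *\<^sub>R X) \<in> ex -` E0) \<and>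
        (u \<notin> ex -` E0 \<and> u \<star> ((s + t) *\<^sub>R X) \<notin> ex -` E0 \<longrightarrow> u \<star> (s *\<^sub>R X) \<notin> ex -` E0)"
    by (rule good_directions[OF N E0])
  interpret M: carnot_monotone mul V1 bracket muG Q
    by (intro carnot_monotone.intro carnot_monotone_axioms.intro H.carnot_haar_axioms Q(1,2))
  define F where "F = ex -` E0"
  have F: "M.line_mono F"
    unfolding M.line_mono_def F_def using Q(3) borel_vimage_ex[OF E0] by blast
  note rep = M.line_mono_representatives[OF F]
  \<comment> \<open>Used for \<open>E\<close> and for its complement, with the same exceptional null
    set \<open>N\<close> separating them from their Borel versions.\<close>
  have supp: "measure_support \<mu> S = lg -` M.msupp (ex -` S0)"
    if S: "S \<in> sets (completion \<mu>)" and S0: "S0 \<in> sets borel"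
      and N': "\<And>y. y \<notin> N \<Longrightarrow> y \<in> S \<longleftrightarrow> y \<in> S0" for S S0
  proof (rule Set.set_eqI)
    fix y
    have eq: "emeasure (completion \<mu>) (S \<inter> U) = emeasure muG (ex -` S0 \<inter> ex -` U)" if "open U" for U
      using S S0 N(1) N' that by (rule completion_emeasure)
    show "y \<in> measure_support \<mu> S \<longleftrightarrow> y \<in> lg -` M.msupp (ex -` S0)"
    proof
      assume y: "y \<in> measure_support \<mu> S"
      have "0 < emeasure muG (ex -` S0 \<inter> V)" if V: "open V" "lg y \<in> V" for V
      proof -
        have "open (lg -` V)" by (rule open_vimage[OF V(1) continuous_lg])
        moreover have "ex -` (lg -` V) = V" by auto
        ultimately show ?thesis using y V(2) eq[of "lg -` V"] by (auto simp: measure_support_def)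
      qed
      then show "y \<in> lg -` M.msupp (ex -` S0)" by (simp add: M.msupp_def)
    next
      assume y: "y \<in> lg -` M.msupp (ex -` S0)"
      have "0 < emeasure (completion \<mu>) (S \<inter> U)" if U: "open U" "y \<in> U" for U
      proof -
        have "open (ex -` U)" by (rule open_vimage[OF U(1) continuous_ex])
        then show ?thesis using y U eq[OF U(1)] by (auto simp: M.msupp_def)
      qed
      then show "y \<in> measure_support \<mu> S" by (simp add: measure_support_def)
    qed
  qed
  have supp_E: "measure_support \<mu> E = lg -` M.msupp F"
    unfolding F_def by (rule supp[OF Ec E0 N(2)])
  have "- E \<in> sets (completion \<mu>)"
    using sets.compl_sets[OF Ec] by (simp add: Compl_eq_Diff_UNIV)
  then have "measure_support \<mu> (- E) = lg -` M.msupp (ex -` (- E0))"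
    using E0 N(2) by (intro supp borel_comp) auto
  then have int_E: "measure_interior \<mu> E = lg -` M.mint F"
    by (simp add: measure_interior_def M.mint_def F_def vimage_Compl)
  have pm: "precisely_monotone G (lg -` S)" if S: "M.line_convex S" "M.line_convex (- S)" for S
    unfolding precisely_monotone_def
  proof (intro ballI allI conjI)
    fix X x assume X: "X \<in> V1 - {0}"
    show "connected (lg -` S \<inter> line G X x)"
      by (rule connected_line_part) (rule M.line_convexD[OF S(1) X])
    have "connected (lg -` (- S) \<inter> line G X x)"
      by (rule connected_line_part) (rule M.line_convexD[OF S(2) X])
    moreover have "line G X x - lg -` S = lg -` (- S) \<inter> line G X x" by auto
    ultimately show "connected (line G X x - lg -` S)" by simp
  qed
  have mr: "measure_representative \<mu> E (lg -` S)" if S: "AE u in muG. u \<in> S \<longleftrightarrow> u \<in> F" for S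
  proof -
    have "AE y in \<mu>. lg y \<in> S \<longleftrightarrow> lg y \<in> F"
      using S unfolding muG_def by (rule AE_distrD[OF lg_measurable])
    then have "AE y in \<mu>. y \<in> E \<longleftrightarrow> y \<in> lg -` S"
      using AE_not_in[OF N(1)] by eventually_elim (use N(2) in \<open>auto simp: F_def\<close>)
    then obtain K where K: "{y. \<not> (y \<in> E \<longleftrightarrow> y \<in> lg -` S)} \<subseteq> K" "emeasure \<mu> K = 0" "K \<in> sets \<mu>"
      by (auto elim!: AE_E)
    then have "K \<in> null_sets (completion \<mu>)" by (intro null_sets_completionI) (simp add: null_sets_def)
    then show ?thesis
      unfolding measure_representative_def
      by (rule null_sets_completion_subset[rotated]) (use K(1) in blast)
  qed
  show ?thesis
    unfolding supp_E int_E using pm rep(1-4) mr[OF rep(5)] mr[OF rep(6)] by blast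
qed

end

theorem corollary1p6:
  fixes G :: "('a::{second_countable_topology, t2_space}, 'e::euclidean_space, 'g::euclidean_space) carnot_data"
    and \<mu> :: "'a measure" and E :: "'a set"
  assumes "carnot_group G"
    and "haar_measure G \<mu>"
    and "\<And>X. X \<in> layer G 1 - {0} \<Longrightarrow>
           \<exists>p\<ge>2. open_map_at (layer_power_topology G p) euclidean (Gamma_map G p) (\<lambda>i\<in>{..<p}. X)"
    and "monotone_set G \<mu> E"
  shows "precisely_monotone G (measure_interior \<mu> E) \<and>
         measure_representative \<mu> E (measure_interior \<mu> E) \<and>
         precisely_monotone G (measure_support \<mu> E) \<and>
         measure_representative \<mu> E (measure_support \<mu> E)"
proof -
  interpret carnot_problem G \<mu> E
    by (intro carnot_problem.intro carnot_structure.intro carnot_problem_axioms.intro assms)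
  show ?thesis by (rule representatives)
qed

end
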